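(* Let $\lambda,\kappa,\sigma>0$ and $\alpha\ge 0$ satisfy $2\kappa\lambda^{1-\alpha}\ge\sigma^2$. Let $A$ be the doubly stochastic Poisson process with generalized CIR intensity $X$ with parameters $(\lambda,\kappa,\sigma,\alpha)$. If $X(0)\sim\pi$, where $\pi$ is the stationary distribution of $X$, then for any $t>0$, \[ \mathbb{E}_\pi[A(t)]=\lambda t,\qquad \mathrm{Var}_\pi[A(t)]=\lambda t+\frac{\sigma^2\lambda^{\alpha+1}t}{\kappa^2}\left(1-\frac{1-e^{-\kappa t}}{\kappa t}\right), \] and thus \[ \mathrm{CoD}_\pi[A(t)]=1+\frac{\sigma^2\lambda^{\alpha}}{\kappa^2}\left(1-\frac{1-e^{-\kappa t}}{\kappa t}\right). \]
   Context: Fix a complete probability space $(\Omega,\mathscr{F},\mathbb{P})$ with a right-continuous, complete filtration $\mathbb{F}=\{\mathscr{F}_t:t\ge0\}$. The generalized CIR process $X$ is the solution of \[ dX(t)=\kappa(\lambda-X(t))\,dt+\sigma\sqrt{\lambda^\alpha X(t)}\,dB(t), \] where $B$ is a standard $\mathbb{F}$-Brownian motion and $X(0)>0$ a.s. is $\mathscr{F}_0$-measurable. Its unique stationary distribution $\pi$ is the gamma distribution with shape parameter $\frac{2\kappa}{\sigma^2\lambda^{\alpha-1}}$ and rate parameter $\frac{2\kappa}{\sigma^2\lambda^\alpha}$. A doubly stochastic Poisson process with intensity $X$ (a nonnegative, integrable, $\mathbb{F}$-predictable process) is an $\mathbb{F}$-adapted counting process $A$ with $A(0)=0$ such that, for all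 $0\le s<t$, conditional on $\mathscr{F}_s$ and the path of $X$ (i.e. on $\mathscr{F}_s\vee\sigma(X(r):r\ge0)$), the increment $A(s,t]=A(t)-A(s)$ is Poisson distributed with mean $\int_s^tX(r)\,dr$. The subscript $\pi$ on $\mathbb{E}_\pi,\mathrm{Var}_\pi,\mathrm{CoD}_\pi$ means that $X(0)\sim\pi$. The coefficient of dispersion is $\mathrm{CoD}[N]=\mathrm{Var}[N]/\mathbb{E}[N]$. *)

theory Defs
  imports "HOL-Probability.Probability"
begin

section \<open>Filtered probability spaces and processes\<close>

text \<open>Time is the half-line \<open>{0..}\<close> of type \<^typ>\<open>real\<close>: filtrations and processes are functions on
  \<^typ>\<open>real\<close> whose values at negative times are never used.\<close>

locale filtered_prob_space = prob_space M + complete_measure M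
  for M :: "'a measure" and F :: "real \<Rightarrow> 'a measure" +
  assumes subalg: "0 \<le> t \<Longrightarrow> subalgebra M (F t)"
    and mono: "0 \<le> s \<Longrightarrow> s \<le> t \<Longrightarrow> sets (F s) \<subseteq> sets (F t)"
    and right_continuous: "0 \<le> t \<Longrightarrow> sets (F t) = (\<Inter>s\<in>{t<..}. sets (F s))"
    and complete_filtration: "null_sets M \<subseteq> sets (F 0)"

definition adapted :: "(real \<Rightarrow> 'a measure) \<Rightarrow> (real \<Rightarrow> 'a \<Rightarrow> real) \<Rightarrow> bool" where
  "adapted F X \<longleftrightarrow> (\<forall>t\<ge>0. X t \<in> borel_measurable (F t))"

definition progressively_measurable ::
    "(real \<Rightarrow> 'a measure) \<Rightarrow> (real \<Rightarrow> 'a \<Rightarrow> real) \<Rightarrow> bool" where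
  "progressively_measurable F X \<longleftrightarrow>
    (\<forall>T\<ge>0. (\<lambda>(t, \<omega>). X t \<omega>) \<in> borel_measurable (restrict_space borel {0..T} \<Otimes>\<^sub>M F T))"

definition predictable_sigma :: "'a measure \<Rightarrow> (real \<Rightarrow> 'a measure) \<Rightarrow> (real \<times> 'a) measure" where
  "predictable_sigma M F = sigma ({0..} \<times> space M)
    ({{0} \<times> S | S. S \<in> sets (F 0)} \<union>
     {{s<..t} \<times> S | s t S. 0 \<le> s \<and> s < t \<and> S \<in> sets (F s)})"

definition predictable ::
    "'a measure \<Rightarrow> (real \<Rightarrow> 'a measure) \<Rightarrow> (real \<Rightarrow> 'a \<Rightarrow> real) \<Rightarrow> bool" where
  "predictable M F X \<longleftrightarrow> (\<lambda>(t, \<omega>). X t \<omega>) \<in> borel_measurable (predictable_sigma M F)"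

definition AE_continuous_paths :: "'a measure \<Rightarrow> (real \<Rightarrow> 'a \<Rightarrow> real) \<Rightarrow> bool" where
  "AE_continuous_paths M X \<longleftrightarrow> (AE \<omega> in M. continuous_on {0..} (\<lambda>t. X t \<omega>))"

section \<open>Brownian motion and the Ito integral\<close>

definition brownian_motion ::
    "'a measure \<Rightarrow> (real \<Rightarrow> 'a measure) \<Rightarrow> (real \<Rightarrow> 'a \<Rightarrow> real) \<Rightarrow> bool" where
  "brownian_motion M F B \<longleftrightarrow>
    adapted F B \<and> AE_continuous_paths M B \<and> (AE \<omega> in M. B 0 \<omega> = 0) \<and>
    (\<forall>s t. 0 \<le> s \<and> s < t \<longrightarrow>
      distributed M lborel (\<lambda>\<omega>. B t \<omega> - B s \<omega>) (\<lambda>x. ennreal (normal_density 0 (sqrt (t - s)) x)) \<and>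
      prob_space.indep_set M (sets (F s))
        (sets (vimage_algebra (space M) (\<lambda>\<omega>. B t \<omega> - B s \<omega>) borel)))"

text \<open>The data \<open>(n, \<tau>, \<xi>)\<close> encode the simple process
  \<open>\<Sum>i<n. \<xi> i \<cdot> 1\<^bsub>(\<tau> i, \<tau> (i+1)]\<^esub>\<close>.\<close>

definition simple_process ::
    "'a measure \<Rightarrow> (real \<Rightarrow> 'a measure) \<Rightarrow> nat \<Rightarrow> (nat \<Rightarrow> real) \<Rightarrow> (nat \<Rightarrow> 'a \<Rightarrow> real) \<Rightarrow> bool" where
  "simple_process M F n \<tau> \<xi> \<longleftrightarrow>
    0 \<le> \<tau> 0 \<and> (\<forall>i<n. \<tau> i < \<tau> (Suc i)) \<and>
    (\<forall>i<n. \<xi> i \<in> borel_measurable (F (\<tau> i)) \<and> bounded (\<xi> i ` space M))"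

definition simple_value ::
    "nat \<Rightarrow> (nat \<Rightarrow> real) \<Rightarrow> (nat \<Rightarrow> 'a \<Rightarrow> real) \<Rightarrow> real \<Rightarrow> 'a \<Rightarrow> real" where
  "simple_value n \<tau> \<xi> t \<omega> = (\<Sum>i<n. \<xi> i \<omega> * indicator {\<tau> i<..\<tau> (Suc i)} t)"

definition simple_ito ::
    "(real \<Rightarrow> 'a \<Rightarrow> real) \<Rightarrow> nat \<Rightarrow> (nat \<Rightarrow> real) \<Rightarrow> (nat \<Rightarrow> 'a \<Rightarrow> real) \<Rightarrow> real \<Rightarrow> 'a \<Rightarrow> real" where
  "simple_ito B n \<tau> \<xi> t \<omega> =
    (\<Sum>i<n. \<xi> i \<omega> * (B (min t (\<tau> (Suc i))) \<omega> - B (min t (\<tau> i)) \<omega>))"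

definition vanishes_in_probability :: "'a measure \<Rightarrow> (nat \<Rightarrow> 'a \<Rightarrow> ennreal) \<Rightarrow> bool" where
  "vanishes_in_probability M Z \<longleftrightarrow>
    (\<forall>\<epsilon>>0. (\<lambda>n. measure M {\<omega> \<in> space M. Z n \<omega> > ennreal \<epsilon>}) \<longlonglongrightarrow> 0)"

text \<open>\<open>I\<close> is (a continuous version of) the process \<open>t \<mapsto> \<integral>\<^sub>0\<^sup>t H dB\<close>: the limit in probability of
  the elementary integrals of simple processes approximating \<open>H\<close>. Being independent of the
  approximating sequence, the limit is determined by the existence of one such sequence. The square
  integrals are taken in \<^typ>\<open>ennreal\<close>, so that divergence is not mistaken for the value \<open>0\<close>.\<close>

definition is_ito_integral ::
    "'a measure \<Rightarrow> (real \<Rightarrow> 'a measure) \<Rightarrow> (real \<Rightarrow> 'a \<Rightarrow> real) \<Rightarrow> (real \<Rightarrow> 'a \<Rightarrow> real) \<Rightarrow>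
      (real \<Rightarrow> 'a \<Rightarrow> real) \<Rightarrow> bool" where
  "is_ito_integral M F B H I \<longleftrightarrow>
    progressively_measurable F H \<and>
    (AE \<omega> in M. \<forall>T\<ge>0. (\<integral>\<^sup>+ s\<in>{0..T}. ennreal ((H s \<omega>)\<^sup>2) \<partial>lborel) < \<infinity>) \<and>
    adapted F I \<and> AE_continuous_paths M I \<and>
    (\<exists>n \<tau> \<xi>.
      (\<forall>k. simple_process M F (n k) (\<tau> k) (\<xi> k)) \<and>
      (\<forall>T\<ge>0. vanishes_in_probability M (\<lambda>k \<omega>.
        \<integral>\<^sup>+ s\<in>{0..T}. ennreal ((simple_value (n k) (\<tau> k) (\<xi> k) s \<omega> - H s \<omega>)\<^sup>2) \<partial>lborel)) \<and>
      (\<forall>t\<ge>0. vanishes_in_probability M (\<lambda>k \<omega>.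
        ennreal \<bar>simple_ito B (n k) (\<tau> k) (\<xi> k) t \<omega> - I t \<omega>\<bar>)))"

section \<open>The generalized CIR process\<close>

definition sde_solution ::
    "'a measure \<Rightarrow> (real \<Rightarrow> 'a measure) \<Rightarrow> (real \<Rightarrow> 'a \<Rightarrow> real) \<Rightarrow> (real \<Rightarrow> real) \<Rightarrow> (real \<Rightarrow> real) \<Rightarrow>
      (real \<Rightarrow> 'a \<Rightarrow> real) \<Rightarrow> bool" where
  "sde_solution M F B drift diffusion X \<longleftrightarrow>
    adapted F X \<and> AE_continuous_paths M X \<and>
    (AE \<omega> in M. \<forall>t\<ge>0. set_integrable lborel {0..t} (\<lambda>s. drift (X s \<omega>))) \<and>
    (\<exists>I. is_ito_integral M F B (\<lambda>s \<omega>. diffusion (X s \<omega>)) I \<and>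
      (AE \<omega> in M. \<forall>t\<ge>0. X t \<omega> = X 0 \<omega> + (LBINT s:{0..t}. drift (X s \<omega>)) + I t \<omega>))"

text \<open>The generalized CIR equation \<open>dX = \<kappa>(l - X) dt + \<sigma> sqrt(l\<^sup>\<alpha> X) dB\<close>; the mean-reversion level
  is written \<open>l\<close>, since lambda is reserved for abstraction. Nonnegativity of \<open>X\<close> is what gives the square root its meaning (the library's \<^const>\<open>sqrt\<close> is
  odd and total).\<close>

definition cir_process ::
    "'a measure \<Rightarrow> (real \<Rightarrow> 'a measure) \<Rightarrow> (real \<Rightarrow> 'a \<Rightarrow> real) \<Rightarrow> real \<Rightarrow> real \<Rightarrow> real \<Rightarrow> real \<Rightarrow>
      (real \<Rightarrow> 'a \<Rightarrow> real) \<Rightarrow> bool" where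
  "cir_process M F B l \<kappa> \<sigma> \<alpha> X \<longleftrightarrow>
    (AE \<omega> in M. X 0 \<omega> > 0) \<and> (AE \<omega> in M. \<forall>t\<ge>0. X t \<omega> \<ge> 0) \<and>
    sde_solution M F B (\<lambda>x. \<kappa> * (l - x)) (\<lambda>x. \<sigma> * sqrt (l powr \<alpha> * x)) X"

text \<open>Shape \<open>a\<close> and rate \<open>b\<close>.\<close>

definition gamma_density :: "real \<Rightarrow> real \<Rightarrow> real \<Rightarrow> real" where
  "gamma_density a b x =
    (if x \<le> 0 then 0 else b powr a / Gamma a * x powr (a - 1) * exp (- b * x))"

text \<open>The stationary distribution of the equation, given by its known explicit form: the gamma law
  with shape \<open>2\<kappa> / (\<sigma>\<^sup>2 l\<^bsup>\<alpha> - 1\<^esup>)\<close> and rate \<open>2\<kappa> / (\<sigma>\<^sup>2 l\<^sup>\<alpha>)\<close>.\<close>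

definition cir_stationary :: "real \<Rightarrow> real \<Rightarrow> real \<Rightarrow> real \<Rightarrow> real measure" where
  "cir_stationary l \<kappa> \<sigma> \<alpha> = density lborel (\<lambda>x. ennreal
    (gamma_density (2 * \<kappa> / (\<sigma>\<^sup>2 * l powr (\<alpha> - 1))) (2 * \<kappa> / (\<sigma>\<^sup>2 * l powr \<alpha>)) x))"

section \<open>Doubly stochastic Poisson processes\<close>

text \<open>For a nondecreasing \<open>\<nat>\<close>-valued path, the last clause says that all jumps have size one.\<close>

definition counting_path :: "(real \<Rightarrow> nat) \<Rightarrow> bool" where
  "counting_path a \<longleftrightarrow> a 0 = 0 \<and> mono_on {0..} a \<and>
    (\<forall>t\<ge>0. continuous (at_right t) (\<lambda>s. real (a s))) \<and>
    (\<forall>t>0. \<exists>s\<in>{0..<t}. a t \<le> Suc (a s))"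

text \<open>The \<open>\<sigma>\<close>-algebra \<open>F\<^sub>s \<or> \<sigma>(X\<^sub>r : r \<ge> 0)\<close>.\<close>

definition join_path_sigma ::
    "'a measure \<Rightarrow> 'a measure \<Rightarrow> (real \<Rightarrow> 'a \<Rightarrow> real) \<Rightarrow> 'a measure" where
  "join_path_sigma M G X = sigma (space M)
    (sets G \<union> {X r -` S \<inter> space M | r S. 0 \<le> r \<and> S \<in> sets borel})"

definition doubly_stochastic_poisson ::
    "'a measure \<Rightarrow> (real \<Rightarrow> 'a measure) \<Rightarrow> (real \<Rightarrow> 'a \<Rightarrow> real) \<Rightarrow> (real \<Rightarrow> 'a \<Rightarrow> nat) \<Rightarrow> bool" where
  "doubly_stochastic_poisson M F X A \<longleftrightarrow>
    predictable M F X \<and> (AE \<omega> in M. \<forall>t\<ge>0. X t \<omega> \<ge> 0) \<and>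
    (AE \<omega> in M. \<forall>t\<ge>0. set_integrable lborel {0..t} (\<lambda>r. X r \<omega>)) \<and>
    adapted F (\<lambda>t \<omega>. real (A t \<omega>)) \<and> (AE \<omega> in M. counting_path (\<lambda>t. A t \<omega>)) \<and>
    (\<forall>s t k. 0 \<le> s \<and> s < t \<longrightarrow>
      (AE \<omega> in M.
        real_cond_exp M (join_path_sigma M (F s) X)
          (indicator {\<omega> \<in> space M. A t \<omega> = A s \<omega> + k}) \<omega> =
        (LBINT r:{s..t}. X r \<omega>) ^ k / fact k * exp (- (LBINT r:{s..t}. X r \<omega>))))"

definition coefficient_of_dispersion :: "'a measure \<Rightarrow> ('a \<Rightarrow> real) \<Rightarrow> real" where
  "coefficient_of_dispersion M N = prob_space.variance M N / prob_space.expectation M N"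

end

theory Submission
  imports Defs
begin

text \<open>Conditionally on the intensity path, \<open>A t\<close> is Poisson with mean \<open>L = \<integral>\<^sub>0\<^sup>t X\<close>, so that
  \<open>E A = E L\<close> and \<open>Var A = E L + Var L\<close>, and it remains to compute the first two moments of \<open>L\<close>.

  Write \<open>I\<close> for the stochastic integral in the equation and \<open>c = \<sigma>\<^sup>2 l\<^sup>\<alpha>\<close>, so that its quadratic
  variation is \<open>c L\<close>. Integrability is not known beforehand and is obtained without stopping times:
  \<open>exp (\<theta> I - \<theta>\<^sup>2 c L / 2)\<close> has expectation one for simple integrands, hence at most one
  in general by Fatou's lemma. For \<open>\<theta> = \<kappa> / c\<close> and \<open>I = X t - X 0 + \<kappa> L - \<kappa> l t\<close> this bounds exponential
  moments of \<open>X t\<close> and \<open>L\<close> relative to \<open>X 0\<close>. With second moments of \<open>L\<close> at hand, truncation of the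
  approximating simple integrands at a level of their quadratic variation shows that \<open>I\<close> is an
  \<open>L\<^sup>2\<close> martingale satisfying the Ito isometry.

  With \<open>Y = X - l\<close>, \<open>Z = \<integral>\<^sub>0\<^sup>t Y\<close> and \<open>q = c l\<close>, orthogonality of martingale increments gives linear integral
  equations for \<open>E Y\<close>, \<open>E (Y s Y t)\<close>, \<open>E (I t Y t)\<close> and \<open>E (Y t)\<^sup>2\<close>; the stationary start makes
  the last one constant, and the variance of \<open>L\<close> is read off from \<open>\<kappa> Z = I - Y t + Y 0\<close>.\<close>

section \<open>Mixed Poisson laws and gamma moments\<close>

text \<open>The Ito integral is given here as a bare limit in probability of elementary sums:
  neither a martingale property, nor the isometry, nor Ito's formula comes with it. The first two
  are rebuilt from Gaussian increments. Ito's formula is avoided by testing the identity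
  \<open>I t = Y t - Y 0 + \<kappa> * Z t\<close> against square-integrable variables: a variable
  known at time s gives the decay of \<open>Y\<close>, \<open>I t\<close> gives the covariance of
  \<open>I\<close> and \<open>Y\<close>, and \<open>Y t\<close> gives the variance of
  \<open>Y\<close>, each as an integral equation in one unknown function. The value \<theta> =
  \<kappa> / c maximizes the factor \<theta> \<kappa> - \<theta>^2 c / 2 with which L remains in the
  exponent. In the truncation argument several rates have to match: at level N the sums have fourth
  moments of order N^2, an approximation error can be made as improbable as N^(-3), and the event
  that the quadratic variation exceeds N has probability o(N^(-2)) because the second moment of L is
  finite. This is why second moments of L, and not just first ones, precede the isometry.\<close>

lemma linear_integral_equation:
  fixes u :: "real \<Rightarrow> real"
  assumes ab: "a \<le> b" and int: "set_integrable lborel {a..b} u"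
    and eq: "\<And>r. r \<in> {a..b} \<Longrightarrow> u r = u a - c * (LBINT x:{a..r}. u x)"
  shows "u b = u a * exp (- c * (b - a))"
proof -
  have int': "set_integrable lborel {a..r} u" if "r \<in> {a..b}" for r
    by (rule set_integrable_subset[OF int]) (use that in auto)
  have eq': "u r = u a - c * integral {a..r} u" if "r \<in> {a..b}" for r
    using eq[OF that] set_borel_integral_eq_integral(2)[OF int'[OF that]] by simp
  have hk: "u integrable_on {a..b}"
    by (rule set_borel_integral_eq_integral(1)[OF int])
  \<comment> \<open>Of \<open>u\<close> only integrability is known, as Fubini's theorem supplies
    it. The right-hand side of the equation is continuous, hence so is \<open>u\<close>, and the
    fundamental theorem of calculus applies.\<close>
  have "continuous_on {a..b} (\<lambda>r. u a - c * integral {a..r} u)"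
    by (intro continuous_intros indefinite_integral_continuous_1 hk)
  then have cont: "continuous_on {a..b} u"
    by (rule continuous_on_eq) (rule eq'[symmetric])
  \<comment> \<open>The solution times the integrating factor; by the equation its derivative
    vanishes.\<close>
  define w where "w = (\<lambda>r. (u a - c * integral {a..r} u) * exp (c * (r - a)))"
  have der: "(w has_field_derivative 0) (at r within {a..b})" if r: "r \<in> {a..b}" for r
  proof -
    have "((\<lambda>r. integral {a..r} u) has_field_derivative u r) (at r within {a..b})"
      using integral_has_vector_derivative[OF cont r]
      by (simp add: has_real_derivative_iff_has_vector_derivative)
    then have "(w has_field_derivative (- c * u r) * exp (c * (r - a)) +
        (exp (c * (r - a)) * c) * (u a - c * integral {a..r} u)) (at r within {a..b})"
      unfolding w_def by (auto intro!: derivative_eq_intros)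
    then show ?thesis
      using eq'[OF r] by (simp add: algebra_simps)
  qed
  have "w b = w a"
    by (rule has_field_derivative_zero_constant[of "{a..b}" w, THEN exE])
       (use der ab in auto)
  moreover have "w b = u b * exp (c * (b - a))" "w a = u a"
    using eq'[of b] ab by (simp_all add: w_def)
  ultimately have "u a * exp (- c * (b - a)) = u b * (exp (c * (b - a)) * exp (- (c * (b - a))))"
    by simp
  then show ?thesis
    by (simp add: exp_minus)
qed

section \<open>Moments of a Poisson law with random mean\<close>

lemma poisson_mean_sums: "(\<lambda>k. real k * (x ^ k / fact k * exp (- x))) sums x" for x :: real
proof -
  have "(\<lambda>k. x * exp (- x) * (x ^ k / fact k)) sums (x * exp (- x) * exp x)"
    by (intro sums_mult) (use exp_converges[of x] in \<open>simp add: field_simps scaleR_conv_of_real\<close>)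
  then have "(\<lambda>k. real (Suc k) * (x ^ Suc k / fact (Suc k) * exp (- x))) sums x"
    by (simp add: exp_minus field_simps del: of_nat_Suc)
  then show ?thesis
    by (subst (asm) sums_Suc_iff) simp
qed

lemma poisson_square_sums:
  "(\<lambda>k. (real k)\<^sup>2 * (x ^ k / fact k * exp (- x))) sums (x + x\<^sup>2)" for x :: real
proof -
  have "(\<lambda>k. x * (real k * (x ^ k / fact k * exp (- x))) + x * exp (- x) * (x ^ k / fact k))
      sums (x * x + x * exp (- x) * exp x)"
    by (intro sums_add sums_mult poisson_mean_sums)
       (use exp_converges[of x] in \<open>simp add: field_simps scaleR_conv_of_real\<close>)
  \<comment> \<open>One factor k + 1 cancels against the factorial; the other splits into k and 1,
    which produce the first moment and the total mass.\<close>
  moreover have "x * (real k * (x ^ k / fact k * exp (- x))) + x * exp (- x) * (x ^ k / fact k) =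
      (real (Suc k))\<^sup>2 * (x ^ Suc k / fact (Suc k) * exp (- x))" for k
  proof -
    have "real (Suc k) * (x ^ Suc k / fact (Suc k)) = x * (x ^ k / fact k)"
      by (simp del: of_nat_Suc)
    moreover have "(real (Suc k))\<^sup>2 * (x ^ Suc k / fact (Suc k) * exp (- x)) =
        real (Suc k) * (real (Suc k) * (x ^ Suc k / fact (Suc k))) * exp (- x)"
      unfolding power2_eq_square by (simp only: mult.assoc)
    ultimately have "(real (Suc k))\<^sup>2 * (x ^ Suc k / fact (Suc k) * exp (- x)) =
        real (Suc k) * (x * (x ^ k / fact k)) * exp (- x)"
      by (simp only:)
    also have "\<dots> = x * (real k * (x ^ k / fact k * exp (- x))) + x * exp (- x) * (x ^ k / fact k)"
      unfolding of_nat_Suc by (simp add: algebra_simps add_divide_distrib)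
    finally show ?thesis by simp
  qed
  moreover have "x * exp (- x) * exp x = x" by (simp add: exp_minus)
  ultimately have "(\<lambda>k. (real (Suc k))\<^sup>2 * (x ^ Suc k / fact (Suc k) * exp (- x))) sums (x\<^sup>2 + x)"
    by (simp add: power2_eq_square)
  then show ?thesis
    by (subst (asm) sums_Suc_iff) (simp add: add.commute)
qed

text \<open>The integral is summed over the values of \<open>A\<close>, the mixed probabilities are
  inserted, and sum and integral are exchanged back, so that the inner sum is the Poisson
  expectation \<open>g\<close> at the random mean. Nonnegative integrals make both exchanges free of
  integrability conditions, and integrability of \<open>A\<close> can be concluded
  afterwards.\<close>

lemma (in prob_space) mixed_poisson_nn_integral:
  assumes [measurable]: "A \<in> measurable M (count_space UNIV)" "L \<in> borel_measurable M"
    and L: "AE \<omega> in M. L \<omega> \<ge> 0"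
    and P: "\<And>k. prob {\<omega> \<in> space M. A \<omega> = k} = expectation (\<lambda>\<omega>. L \<omega> ^ k / fact k * exp (- L \<omega>))"
    and f: "\<And>k. f k \<ge> 0" and g: "\<And>x. x \<ge> 0 \<Longrightarrow> (\<lambda>k. f k * (x ^ k / fact k * exp (- x))) sums g x"
  shows "(\<integral>\<^sup>+\<omega>. ennreal (f (A \<omega>)) \<partial>M) = (\<integral>\<^sup>+\<omega>. ennreal (g (L \<omega>)) \<partial>M)"
proof -
  \<comment> \<open>One term of the exponential series is at most its sum, so Poisson weights are
    bounded by 1; this makes the Bochner expectation in \<open>P\<close> equal to a nonnegative
    integral.\<close>
  have bound: "x ^ k / fact k * exp (- x) \<le> 1" if "x \<ge> 0" for x :: real and k
  proof -
    have "(\<Sum>i\<in>{k}. x ^ i /\<^sub>R fact i) \<le> exp x"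
      unfolding exp_def by (rule sum_le_suminf[OF summable_exp_generic]) (use that in auto)
    then have "x ^ k / fact k \<le> exp x" by (simp add: field_simps)
    then show ?thesis by (simp add: exp_minus field_simps)
  qed
  have P': "(\<integral>\<^sup>+\<omega>. indicator {\<omega> \<in> space M. A \<omega> = k} \<omega> \<partial>M) =
      (\<integral>\<^sup>+\<omega>. ennreal (L \<omega> ^ k / fact k * exp (- L \<omega>)) \<partial>M)" for k
  proof -
    have "integrable M (\<lambda>\<omega>. L \<omega> ^ k / fact k * exp (- L \<omega>))"
      by (rule integrable_const_bound[where B = 1]) (use L bound in \<open>auto simp: abs_mult\<close>)
    then show ?thesis
      using L by (subst nn_integral_eq_integral) (auto simp: P[symmetric, simplified] emeasure_eq_measure)
  qed
  have "ennreal (f (A \<omega>)) = (\<Sum>k. ennreal (f k) * indicator {\<omega> \<in> space M. A \<omega> = k} \<omega>)"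
    if "\<omega> \<in> space M" for \<omega>
    by (subst suminf_finite[of "{A \<omega>}"]) (use that in auto)
  then have "(\<integral>\<^sup>+\<omega>. ennreal (f (A \<omega>)) \<partial>M) =
      (\<integral>\<^sup>+\<omega>. (\<Sum>k. ennreal (f k) * indicator {\<omega> \<in> space M. A \<omega> = k} \<omega>) \<partial>M)"
    by (intro nn_integral_cong) simp
  also have "\<dots> = (\<Sum>k. \<integral>\<^sup>+\<omega>. ennreal (f k) * indicator {\<omega> \<in> space M. A \<omega> = k} \<omega> \<partial>M)"
    by (rule nn_integral_suminf) simp
  also have "\<dots> = (\<Sum>k. \<integral>\<^sup>+\<omega>. ennreal (f k) * ennreal (L \<omega> ^ k / fact k * exp (- L \<omega>)) \<partial>M)"
    by (subst nn_integral_cmult, simp, subst nn_integral_cmult, simp, simp only: P')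
  also have "\<dots> = (\<integral>\<^sup>+\<omega>. (\<Sum>k. ennreal (f k) * ennreal (L \<omega> ^ k / fact k * exp (- L \<omega>))) \<partial>M)"
    by (rule nn_integral_suminf[symmetric]) simp
  also have "\<dots> = (\<integral>\<^sup>+\<omega>. ennreal (g (L \<omega>)) \<partial>M)"
  proof (rule nn_integral_cong_AE, use L in eventually_elim)
    case (elim \<omega>)
    then show ?case
      using g[OF elim] f
      by (simp add: ennreal_mult'[symmetric] suminf_ennreal2 sums_iff)
  qed
  finally show ?thesis .
qed

lemma (in prob_space) mixed_poisson_moments:
  assumes [measurable]: "A \<in> measurable M (count_space UNIV)" "L \<in> borel_measurable M"
    and L: "AE \<omega> in M. L \<omega> \<ge> 0"
    and P: "\<And>k. prob {\<omega> \<in> space M. A \<omega> = k} = expectation (\<lambda>\<omega>. L \<omega> ^ k / fact k * exp (- L \<omega>))"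
    and int: "integrable M L" "integrable M (\<lambda>\<omega>. (L \<omega>)\<^sup>2)"
  shows "integrable M (\<lambda>\<omega>. real (A \<omega>))" "integrable M (\<lambda>\<omega>. (real (A \<omega>))\<^sup>2)"
    "expectation (\<lambda>\<omega>. real (A \<omega>)) = expectation L"
    "expectation (\<lambda>\<omega>. (real (A \<omega>))\<^sup>2) = expectation L + expectation (\<lambda>\<omega>. (L \<omega>)\<^sup>2)"
proof -
  have "(\<integral>\<^sup>+\<omega>. ennreal (real (A \<omega>)) \<partial>M) = (\<integral>\<^sup>+\<omega>. ennreal (L \<omega>) \<partial>M)"
    by (rule mixed_poisson_nn_integral[OF assms(1,2) L P]) (rule poisson_mean_sums | simp)+
  also have "\<dots> = ennreal (expectation L)"
    by (rule nn_integral_eq_integral[OF int(1) L])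
  finally have 1: "(\<integral>\<^sup>+\<omega>. ennreal (real (A \<omega>)) \<partial>M) = ennreal (expectation L)" .
  have "(\<integral>\<^sup>+\<omega>. ennreal ((real (A \<omega>))\<^sup>2) \<partial>M) = (\<integral>\<^sup>+\<omega>. ennreal (L \<omega> + (L \<omega>)\<^sup>2) \<partial>M)"
    by (rule mixed_poisson_nn_integral[OF assms(1,2) L P]) (rule poisson_square_sums | simp)+
  also have "\<dots> = ennreal (expectation (\<lambda>\<omega>. L \<omega> + (L \<omega>)\<^sup>2))"
    by (rule nn_integral_eq_integral) (use L int in auto)
  finally have 2: "(\<integral>\<^sup>+\<omega>. ennreal ((real (A \<omega>))\<^sup>2) \<partial>M) =
      ennreal (expectation (\<lambda>\<omega>. L \<omega> + (L \<omega>)\<^sup>2))" .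
  have 0: "expectation L \<ge> 0" "expectation (\<lambda>\<omega>. L \<omega> + (L \<omega>)\<^sup>2) \<ge> 0"
    using L by (auto intro!: integral_nonneg_AE)
  show "integrable M (\<lambda>\<omega>. real (A \<omega>))" "integrable M (\<lambda>\<omega>. (real (A \<omega>))\<^sup>2)"
    using 1 2 by (auto intro!: integrableI_nonneg)
  show "expectation (\<lambda>\<omega>. real (A \<omega>)) = expectation L"
    using 1 0 by (subst integral_eq_nn_integral) auto
  have "expectation (\<lambda>\<omega>. (real (A \<omega>))\<^sup>2) = expectation (\<lambda>\<omega>. L \<omega> + (L \<omega>)\<^sup>2)"
    using 2 0 by (subst integral_eq_nn_integral) auto
  then show "expectation (\<lambda>\<omega>. (real (A \<omega>))\<^sup>2) = expectation L + expectation (\<lambda>\<omega>. (L \<omega>)\<^sup>2)"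
    using int by simp
qed

section \<open>Moments of the gamma law\<close>

lemma borel_measurable_gamma_density[measurable]: "gamma_density a b \<in> borel_measurable borel"
  unfolding gamma_density_def[abs_def] by measurable

text \<open>Substituting x / b for x turns the moment into Euler's integral for Gamma at a + p; the
  power \<open>b powr a\<close> of the density is absorbed and \<open>b powr p\<close> remains in
  the denominator.\<close>

lemma nn_integral_gamma_density_powr:
  assumes a: "a > 0" and b: "b > 0" and p: "p \<ge> 0"
  shows "(\<integral>\<^sup>+x. ennreal (x powr p * gamma_density a b x) \<partial>lborel) =
    ennreal (Gamma (a + p) / (Gamma a * b powr p))"
proof -
  have Ga: "Gamma a > 0" using a by (rule Gamma_real_pos)
  have *: "1 / b * ((x / b) powr p * gamma_density a b (x / b)) =
      1 / (Gamma a * b powr p) * (indicator {0..} x * x powr (a + p - 1) / exp x)"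
    if "x \<noteq> 0" for x
  proof (cases "x > 0")
    case True
    have "b powr a = b * b powr (a - 1)"
      using b by (simp add: powr_diff)
    moreover have "x powr (a + p - 1) = x powr p * x powr (a - 1)"
      by (simp add: powr_add[symmetric] algebra_simps)
    ultimately show ?thesis
      using True b Ga
      by (simp add: gamma_density_def powr_divide exp_minus field_simps)
  next
    case False
    then have "x / b \<le> 0" using b by (simp add: divide_nonpos_pos)
    then show ?thesis using False that by (simp add: gamma_density_def)
  qed
  have "(\<integral>\<^sup>+x. ennreal (x powr p * gamma_density a b x) \<partial>lborel) =
      ennreal \<bar>1 / b\<bar> * (\<integral>\<^sup>+x. ennreal ((0 + 1 / b * x) powr p * gamma_density a b (0 + 1 / b * x)) \<partial>lborel)"
    by (rule nn_integral_real_affine) (use b in auto)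
  also have "\<dots> = (\<integral>\<^sup>+x. ennreal (1 / b * ((x / b) powr p * gamma_density a b (x / b))) \<partial>lborel)"
    using b by (subst nn_integral_cmult[symmetric]) (auto simp: ennreal_mult'[symmetric])
  also have "\<dots> = (\<integral>\<^sup>+x. ennreal (1 / (Gamma a * b powr p) *
      (indicator {0..} x * x powr (a + p - 1) / exp x)) \<partial>lborel)"
    using AE_lborel_singleton[of "0::real"]
    by (intro nn_integral_cong_AE, elim eventually_mono) (rule arg_cong[where f = ennreal], rule *)
  also have "\<dots> = ennreal (1 / (Gamma a * b powr p)) * ennreal (Gamma (a + p))"
    using Ga b a p
    by (subst ennreal_mult') (auto simp: nn_integral_cmult Gamma_conv_nn_integral_real)
  also have "\<dots> = ennreal (Gamma (a + p) / (Gamma a * b powr p))"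
    using Ga a p by (simp add: ennreal_mult'[symmetric])
  finally show ?thesis .
qed

lemma gamma_distributed_moments:
  assumes X[measurable]: "X \<in> borel_measurable M"
    and distr: "distr M borel X = density lborel (\<lambda>x. ennreal (gamma_density a b x))"
    and a: "a > 0" and b: "b > 0"
  shows "integrable M X" "integrable M (\<lambda>\<omega>. (X \<omega>)\<^sup>2)"
    "(\<integral>\<omega>. X \<omega> \<partial>M) = a / b" "(\<integral>\<omega>. (X \<omega>)\<^sup>2 \<partial>M) = a * (a + 1) / b\<^sup>2"
proof -
  have nonneg: "gamma_density a b x \<ge> 0" for x
    using Gamma_real_pos[OF a] by (simp add: gamma_density_def)
  have tr: "(\<integral>\<^sup>+\<omega>. f (X \<omega>) \<partial>M) = (\<integral>\<^sup>+x. ennreal (gamma_density a b x) * f x \<partial>lborel)"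
    if [measurable]: "f \<in> borel_measurable borel" for f
    using nn_integral_distr[of X M borel f] by (simp add: distr nn_integral_density)
  have AE: "AE \<omega> in M. X \<omega> \<ge> 0"
  proof -
    have "AE x in density lborel (\<lambda>x. ennreal (gamma_density a b x)). x \<ge> 0"
      by (subst AE_density) (auto simp: gamma_density_def)
    then show ?thesis
      unfolding distr[symmetric] by (subst (asm) AE_distr_iff) auto
  qed
  have Gp: "Gamma (a + 1) = a * Gamma a" "Gamma (a + 2) = (a + 1) * (a * Gamma a)"
  proof -
    have notin: "x \<notin> \<int>\<^sub>\<le>\<^sub>0" if "x > 0" for x :: real
      using that nonpos_Ints_nonpos[of x] by linarith
    show 1: "Gamma (a + 1) = a * Gamma a"
      using a by (intro Gamma_plus1 notin)
    have "Gamma (a + 1 + 1) = (a + 1) * Gamma (a + 1)"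
      using a by (intro Gamma_plus1 notin) simp
    then show "Gamma (a + 2) = (a + 1) * (a * Gamma a)" by (simp add: 1 add.assoc)
  qed
  have 1: "(\<integral>\<^sup>+\<omega>. ennreal (X \<omega>) \<partial>M) = ennreal (a / b)"
  proof -
    have "(\<integral>\<^sup>+\<omega>. ennreal (X \<omega>) \<partial>M) = (\<integral>\<^sup>+x. ennreal (x powr 1 * gamma_density a b x) \<partial>lborel)"
      by (subst tr, simp, rule nn_integral_cong)
         (auto simp: gamma_density_def ennreal_mult'[symmetric] mult.commute powr_one_gt_zero_iff)
    also have "\<dots> = ennreal (a / b)"
      using less_imp_neq[OF Gamma_real_pos[OF a]] a b
      by (subst nn_integral_gamma_density_powr) (auto simp: Gp)
    finally show ?thesis .
  qed
  have 2: "(\<integral>\<^sup>+\<omega>. ennreal ((X \<omega>)\<^sup>2) \<partial>M) = ennreal (a * (a + 1) / b\<^sup>2)"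
  proof -
    have "(\<integral>\<^sup>+\<omega>. ennreal ((X \<omega>)\<^sup>2) \<partial>M) = (\<integral>\<^sup>+x. ennreal (x powr 2 * gamma_density a b x) \<partial>lborel)"
      by (subst tr[of "\<lambda>x. ennreal (x\<^sup>2)"], simp, rule nn_integral_cong)
         (auto simp: gamma_density_def ennreal_mult'[symmetric] mult.commute)
    also have "\<dots> = ennreal (a * (a + 1) / b\<^sup>2)"
      using less_imp_neq[OF Gamma_real_pos[OF a]] a b
      by (subst nn_integral_gamma_density_powr) (auto simp: Gp mult_ac)
    finally show ?thesis .
  qed
  show "integrable M X" by (rule integrableI_nonneg) (use 1 AE in auto)
  show "integrable M (\<lambda>\<omega>. (X \<omega>)\<^sup>2)" by (rule integrableI_nonneg) (use 2 in auto)
  show "(\<integral>\<omega>. X \<omega> \<partial>M) = a / b"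
    using 1 AE a b by (subst integral_eq_nn_integral) auto
  show "(\<integral>\<omega>. (X \<omega>)\<^sup>2 \<partial>M) = a * (a + 1) / b\<^sup>2"
    using 2 a b by (subst integral_eq_nn_integral) auto
qed

section \<open>Elementary stochastic integrals\<close>

locale brownian = filtered_prob_space M F
  for M :: "'a measure" and F :: "real \<Rightarrow> 'a measure" +
  fixes B :: "real \<Rightarrow> 'a \<Rightarrow> real"
  assumes brownian: "brownian_motion M F B"
begin

lemma space_F: "0 \<le> t \<Longrightarrow> space (F t) = space M"
  using subalg[of t] by (simp add: subalgebra_def)

lemma measurable_F_mono:
  assumes "f \<in> measurable (F s) N" "0 \<le> s" "s \<le> t"
  shows "f \<in> measurable (F t) N"
  using assms mono[of s t] space_F[of s] space_F[of t] by (auto simp: measurable_def)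

lemma measurable_F_M:
  assumes "f \<in> measurable (F s) N" "0 \<le> s"
  shows "f \<in> measurable M N"
  using assms subalg[of s] measurable_from_subalg by blast

lemma B_measurable: "0 \<le> s \<Longrightarrow> s \<le> t \<Longrightarrow> B s \<in> borel_measurable (F t)"
  using brownian measurable_F_mono[of "B s" s borel t]
  by (auto simp: brownian_motion_def adapted_def)

lemma B_measurable_M[measurable (raw)]: "0 \<le> s \<Longrightarrow> B s \<in> borel_measurable M"
  using B_measurable[of s s] measurable_F_M by blast

lemma increment_distributed:
  "0 \<le> s \<Longrightarrow> s < t \<Longrightarrow>
    distributed M lborel (\<lambda>\<omega>. B t \<omega> - B s \<omega>) (\<lambda>x. ennreal (normal_density 0 (sqrt (t - s)) x))"
  using brownian by (simp add: brownian_motion_def)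

lemma increment_indep_prob:
  assumes st: "0 \<le> s" "s < t" and A: "A \<in> sets (F s)" and S: "S \<in> sets borel"
  shows "prob (A \<inter> ((\<lambda>\<omega>. B t \<omega> - B s \<omega>) -` S \<inter> space M)) =
    prob A * prob ((\<lambda>\<omega>. B t \<omega> - B s \<omega>) -` S \<inter> space M)"
proof (rule indep_setD)
  show "indep_set (sets (F s)) (sets (vimage_algebra (space M) (\<lambda>\<omega>. B t \<omega> - B s \<omega>) borel))"
    using brownian st by (simp add: brownian_motion_def)
  show "(\<lambda>\<omega>. B t \<omega> - B s \<omega>) -` S \<inter> space M \<in> sets (vimage_algebra (space M) (\<lambda>\<omega>. B t \<omega> - B s \<omega>) borel)"
    using S by (rule in_vimage_algebra)
qed (rule A)

text \<open>Independence is given as a product formula on rectangles, and rectangles determine a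
  product measure. \<open>U\<close> may take values in any space, since the exponential formula
  below needs the joint law of the increment with a pair of random variables.\<close>

lemma increment_joint_distr:
  assumes st: "0 \<le> s" "s < t" and U: "U \<in> measurable (F s) N"
  shows "distr M (N \<Otimes>\<^sub>M borel) (\<lambda>\<omega>. (U \<omega>, B t \<omega> - B s \<omega>)) =
    distr M N U \<Otimes>\<^sub>M distr M borel (\<lambda>\<omega>. B t \<omega> - B s \<omega>)"
proof (rule sym, rule pair_measure_eqI)
  let ?D = "\<lambda>\<omega>. B t \<omega> - B s \<omega>"
  have D[measurable]: "?D \<in> borel_measurable M" using st by auto
  have UM[measurable]: "U \<in> measurable M N" using measurable_F_M[OF U st(1)] .
  interpret U: prob_space "distr M N U" by (rule prob_space_distr) fact
  interpret D: prob_space "distr M borel ?D" by (rule prob_space_distr) fact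
  show "sigma_finite_measure (distr M N U)" "sigma_finite_measure (distr M borel ?D)" ..
  fix A S assume "A \<in> sets (distr M N U)" "S \<in> sets (distr M borel ?D)"
  then have A: "A \<in> sets N" and S: "S \<in> sets borel" by auto
  have "(\<lambda>\<omega>. (U \<omega>, ?D \<omega>)) -` (A \<times> S) \<inter> space M = (U -` A \<inter> space M) \<inter> (?D -` S \<inter> space M)"
    by auto
  moreover have "U -` A \<inter> space M \<in> sets (F s)"
    using measurable_sets[OF U A] by (simp add: space_F[OF st(1)])
  ultimately show "emeasure (distr M N U) A * emeasure (distr M borel ?D) S =
      emeasure (distr M (N \<Otimes>\<^sub>M borel) (\<lambda>\<omega>. (U \<omega>, ?D \<omega>))) (A \<times> S)"
    using A S increment_indep_prob[OF st _ S]
    by (simp add: emeasure_distr emeasure_eq_measure ennreal_mult')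
qed simp

lemma increment_indep:
  assumes st: "0 \<le> s" "s < t" and U: "U \<in> borel_measurable (F s)"
  shows "indep_var borel U borel (\<lambda>\<omega>. B t \<omega> - B s \<omega>)"
  using increment_joint_distr[OF st U] measurable_F_M[OF U st(1)] st
  by (simp add: indep_var_distribution_eq)

lemma increment_moments:
  assumes st: "0 \<le> s" "s \<le> t"
  shows "integrable M (\<lambda>\<omega>. B t \<omega> - B s \<omega>)" "expectation (\<lambda>\<omega>. B t \<omega> - B s \<omega>) = 0"
    "integrable M (\<lambda>\<omega>. (B t \<omega> - B s \<omega>)\<^sup>2)" "expectation (\<lambda>\<omega>. (B t \<omega> - B s \<omega>)\<^sup>2) = t - s"
proof -
  have *: "integrable M (\<lambda>\<omega>. B t \<omega> - B s \<omega>) \<and> expectation (\<lambda>\<omega>. B t \<omega> - B s \<omega>) = 0 \<and>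
    integrable M (\<lambda>\<omega>. (B t \<omega> - B s \<omega>)\<^sup>2) \<and> expectation (\<lambda>\<omega>. (B t \<omega> - B s \<omega>)\<^sup>2) = t - s"
  proof (cases "s = t")
    case False
    then have s: "s < t" "0 < sqrt (t - s)" using st by auto
    note D = increment_distributed[OF st(1) s(1)]
    have 1: "integrable M (\<lambda>\<omega>. B t \<omega> - B s \<omega>)"
      using distributed_integrable[OF D, of "\<lambda>x. x"] integrable_normal_moment_nz_1[OF s(2), of 0] by simp
    have 2: "expectation (\<lambda>\<omega>. B t \<omega> - B s \<omega>) = 0"
      by (rule normal_distributed_expectation[OF s(2) D])
    have 3: "integrable M (\<lambda>\<omega>. (B t \<omega> - B s \<omega>)\<^sup>2)"
      using distributed_integrable[OF D, of "\<lambda>x. x\<^sup>2"] integrable_normal_moment[OF s(2), of 0 2] by simp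
    have "variance (\<lambda>\<omega>. B t \<omega> - B s \<omega>) = (sqrt (t - s))\<^sup>2"
      by (rule normal_distributed_variance[OF s(2) D])
    then show ?thesis using 1 2 3 st by simp
  qed simp
  show "integrable M (\<lambda>\<omega>. B t \<omega> - B s \<omega>)" "expectation (\<lambda>\<omega>. B t \<omega> - B s \<omega>) = 0"
    "integrable M (\<lambda>\<omega>. (B t \<omega> - B s \<omega>)\<^sup>2)" "expectation (\<lambda>\<omega>. (B t \<omega> - B s \<omega>)\<^sup>2) = t - s"
    using * by auto
qed

lemma expectation_mult_increment:
  assumes st: "0 \<le> s" "s \<le> t" and U: "U \<in> borel_measurable (F s)" "integrable M U"
  shows "integrable M (\<lambda>\<omega>. U \<omega> * (B t \<omega> - B s \<omega>))"
    "expectation (\<lambda>\<omega>. U \<omega> * (B t \<omega> - B s \<omega>)) = 0"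
    "integrable M (\<lambda>\<omega>. U \<omega> * (B t \<omega> - B s \<omega>)\<^sup>2)"
    "expectation (\<lambda>\<omega>. U \<omega> * (B t \<omega> - B s \<omega>)\<^sup>2) = expectation U * (t - s)"
proof -
  note m = increment_moments[OF st]
  have *: "integrable M (\<lambda>\<omega>. U \<omega> * (B t \<omega> - B s \<omega>)) \<and>
    expectation (\<lambda>\<omega>. U \<omega> * (B t \<omega> - B s \<omega>)) = 0 \<and>
    integrable M (\<lambda>\<omega>. U \<omega> * (B t \<omega> - B s \<omega>)\<^sup>2) \<and>
    expectation (\<lambda>\<omega>. U \<omega> * (B t \<omega> - B s \<omega>)\<^sup>2) = expectation U * (t - s)"
  proof (cases "s = t")
    case False
    then have s: "s < t" using st by auto
    note i = increment_indep[OF st(1) s U(1)]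
    have i2: "indep_var borel U borel (\<lambda>\<omega>. (B t \<omega> - B s \<omega>)\<^sup>2)"
      using indep_var_compose[OF i, of "\<lambda>x. x" borel "\<lambda>x. x\<^sup>2" borel] by (simp add: comp_def)
    show ?thesis
      using indep_var_integrable[OF i U(2) m(1)] indep_var_lebesgue_integral[OF i U(2) m(1)]
        indep_var_integrable[OF i2 U(2) m(3)] indep_var_lebesgue_integral[OF i2 U(2) m(3)] m
      by simp
  qed simp
  show "integrable M (\<lambda>\<omega>. U \<omega> * (B t \<omega> - B s \<omega>))"
    "expectation (\<lambda>\<omega>. U \<omega> * (B t \<omega> - B s \<omega>)) = 0"
    "integrable M (\<lambda>\<omega>. U \<omega> * (B t \<omega> - B s \<omega>)\<^sup>2)"
    "expectation (\<lambda>\<omega>. U \<omega> * (B t \<omega> - B s \<omega>)\<^sup>2) = expectation U * (t - s)"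
    using * by auto
qed

text \<open>Given \<open>F s\<close>, the increment D is a centred Gaussian, so exp (v D - v^2 (t -
  s) / 2) has mean one for every constant v; independence allows the random \<open>V\<close> in
  place of v. With nonnegative integrals, \<open>U\<close> and \<open>V\<close> are subject to
  measurability alone.\<close>

lemma nn_integral_exp_increment:
  assumes st: "0 \<le> s" "s \<le> t" and U: "U \<in> borel_measurable (F s)" and V: "V \<in> borel_measurable (F s)"
  shows "(\<integral>\<^sup>+\<omega>. ennreal (exp (U \<omega> + V \<omega> * (B t \<omega> - B s \<omega>) - (V \<omega>)\<^sup>2 * (t - s) / 2)) \<partial>M) =
    (\<integral>\<^sup>+\<omega>. ennreal (exp (U \<omega>)) \<partial>M)"
proof (cases "s = t")
  case False
  then have s: "s < t" using st by auto
  define d where "d = sqrt (t - s)"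
  have d: "d > 0" "d\<^sup>2 = t - s" using s by (auto simp: d_def)
  have UV: "(\<lambda>\<omega>. (U \<omega>, V \<omega>)) \<in> measurable (F s) (borel \<Otimes>\<^sub>M borel)"
    using U V by simp
  let ?D = "\<lambda>\<omega>. B t \<omega> - B s \<omega>" and ?UV = "\<lambda>\<omega>. (U \<omega>, V \<omega>)"
  let ?f = "\<lambda>((u, v), x). ennreal (exp (u + v * x - v\<^sup>2 * d\<^sup>2 / 2))"
  have [measurable]: "?UV \<in> measurable M (borel \<Otimes>\<^sub>M borel)" "?D \<in> borel_measurable M"
    using measurable_F_M[OF UV] st by auto
  interpret D: prob_space "distr M borel ?D" by (rule prob_space_distr) simp
  have inner: "(\<integral>\<^sup>+x. ennreal (exp (u + v * x - v\<^sup>2 * d\<^sup>2 / 2)) \<partial>distr M borel ?D) = ennreal (exp u)" for u v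
  proof -
    have "(\<integral>\<^sup>+x. ennreal (exp (u + v * x - v\<^sup>2 * d\<^sup>2 / 2)) \<partial>distr M borel ?D) =
        (\<integral>\<^sup>+\<omega>. ennreal (exp (u + v * ?D \<omega> - v\<^sup>2 * d\<^sup>2 / 2)) \<partial>M)"
      by (rule nn_integral_distr) auto
    also have "\<dots> = (\<integral>\<^sup>+x. ennreal (normal_density 0 d x) * ennreal (exp (u + v * x - v\<^sup>2 * d\<^sup>2 / 2)) \<partial>lborel)"
      by (rule distributed_nn_integral[symmetric]) (use increment_distributed[OF st(1) s] in \<open>auto simp: d_def\<close>)
    also have "\<dots> = (\<integral>\<^sup>+x. ennreal (exp u) * ennreal (normal_density (v * d\<^sup>2) d x) \<partial>lborel)"
    proof (rule nn_integral_cong)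
      fix x
      \<comment> \<open>Completing the square: the exponential tilts the centred normal density to
        the one with mean \<open>v * d\<^sup>2\<close>, whose total mass is 1.\<close>
      have "- (x\<^sup>2 / (2 * d\<^sup>2)) + (u + v * x - v\<^sup>2 * d\<^sup>2 / 2) = u + (- ((x - v * d\<^sup>2)\<^sup>2 / (2 * d\<^sup>2)))"
        using d(1) by (simp add: power2_eq_square field_simps)
      then have "exp (- (x\<^sup>2 / (2 * d\<^sup>2))) * exp (u + v * x - v\<^sup>2 * d\<^sup>2 / 2) =
          exp u * exp (- ((x - v * d\<^sup>2)\<^sup>2 / (2 * d\<^sup>2)))"
        by (simp only: exp_add[symmetric])
      then have "normal_density 0 d x * exp (u + v * x - v\<^sup>2 * d\<^sup>2 / 2) =
          exp u * normal_density (v * d\<^sup>2) d x"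
        by (simp add: normal_density_def)
      then show "ennreal (normal_density 0 d x) * ennreal (exp (u + v * x - v\<^sup>2 * d\<^sup>2 / 2)) =
          ennreal (exp u) * ennreal (normal_density (v * d\<^sup>2) d x)"
        by (simp add: ennreal_mult'[symmetric])
    qed
    also have "\<dots> = ennreal (exp u)"
      using d(1) by (subst nn_integral_cmult) (auto simp: nn_integral_eq_integral)
    finally show ?thesis .
  qed
  have "(\<integral>\<^sup>+\<omega>. ennreal (exp (U \<omega> + V \<omega> * ?D \<omega> - (V \<omega>)\<^sup>2 * (t - s) / 2)) \<partial>M) =
      (\<integral>\<^sup>+z. ?f z \<partial>distr M ((borel \<Otimes>\<^sub>M borel) \<Otimes>\<^sub>M borel) (\<lambda>\<omega>. (?UV \<omega>, ?D \<omega>)))"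
    by (subst nn_integral_distr) (auto simp: d split_beta')
  also have "\<dots> = (\<integral>\<^sup>+z. ?f z \<partial>(distr M (borel \<Otimes>\<^sub>M borel) ?UV \<Otimes>\<^sub>M distr M borel ?D))"
    by (simp only: increment_joint_distr[OF st(1) s UV])
  also have "\<dots> = (\<integral>\<^sup>+y. (\<integral>\<^sup>+x. ?f (y, x) \<partial>distr M borel ?D) \<partial>distr M (borel \<Otimes>\<^sub>M borel) ?UV)"
    by (rule D.nn_integral_fst[symmetric]) (simp add: split_beta')
  also have "\<dots> = (\<integral>\<^sup>+y. ennreal (exp (fst y)) \<partial>distr M (borel \<Otimes>\<^sub>M borel) ?UV)"
    by (simp add: split_beta' inner)
  also have "\<dots> = (\<integral>\<^sup>+\<omega>. ennreal (exp (U \<omega>)) \<partial>M)"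
    by (subst nn_integral_distr) auto
  finally show ?thesis .
qed simp

text \<open>\<open>step_integrand c \<eta>\<close> encodes the elementary predictable process with value \<open>\<eta> i\<close> on
  \<open>(c i, c (i+1)]\<close>; degenerate intervals \<open>c i = c (i+1)\<close> are allowed.\<close>

definition step_integrand :: "(nat \<Rightarrow> real) \<Rightarrow> (nat \<Rightarrow> 'a \<Rightarrow> real) \<Rightarrow> bool" where
  "step_integrand c \<eta> \<longleftrightarrow> 0 \<le> c 0 \<and> (\<forall>i. c i \<le> c (Suc i)) \<and>
    (\<forall>i. \<eta> i \<in> borel_measurable (F (c i)) \<and> bounded (\<eta> i ` space M))"

definition step_sum :: "(nat \<Rightarrow> real) \<Rightarrow> (nat \<Rightarrow> 'a \<Rightarrow> real) \<Rightarrow> nat \<Rightarrow> 'a \<Rightarrow> real" where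
  "step_sum c \<eta> n \<omega> = (\<Sum>i<n. \<eta> i \<omega> * (B (c (Suc i)) \<omega> - B (c i) \<omega>))"

definition step_qv :: "(nat \<Rightarrow> real) \<Rightarrow> (nat \<Rightarrow> 'a \<Rightarrow> real) \<Rightarrow> nat \<Rightarrow> 'a \<Rightarrow> real" where
  "step_qv c \<eta> n \<omega> = (\<Sum>i<n. (\<eta> i \<omega>)\<^sup>2 * (c (Suc i) - c i))"

section \<open>Moments of finite stochastic sums and their truncation\<close>

context
  fixes c \<eta> assumes step: "step_integrand c \<eta>"
begin

lemma step_mono: "i \<le> j \<Longrightarrow> c i \<le> c j"
  using step by (auto intro: lift_Suc_mono_le simp: step_integrand_def)

lemma step_nonneg: "0 \<le> c i"
  using step step_mono[of 0 i] by (auto simp: step_integrand_def)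

lemma step_Suc: "c i \<le> c (Suc i)"
  by (rule step_mono) simp

lemma step_measurable: "i \<le> j \<Longrightarrow> \<eta> i \<in> borel_measurable (F (c j))"
  using step step_mono[of i j] step_nonneg[of i]
  by (auto simp: step_integrand_def intro: measurable_F_mono)

lemma step_measurable_M[measurable]: "\<eta> i \<in> borel_measurable M"
  using step_measurable[of i i] step_nonneg measurable_F_M by blast

lemma B_step_measurable_M[measurable]: "B (c i) \<in> borel_measurable M"
  by (rule B_measurable_M[OF step_nonneg])

lemma step_bound: obtains K where "\<And>\<omega>. \<omega> \<in> space M \<Longrightarrow> \<bar>\<eta> i \<omega>\<bar> \<le> K"
  using step by (fastforce simp: step_integrand_def bounded_iff)

lemma step_sum_measurable: "step_sum c \<eta> n \<in> borel_measurable (F (c n))"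
  unfolding step_sum_def[abs_def]
  by (intro borel_measurable_sum borel_measurable_times borel_measurable_diff)
     (auto intro!: step_measurable B_measurable step_mono step_nonneg)

text \<open>The index shift is deliberate: the summand with index \<open>m\<close> involves only
  \<open>\<eta> m\<close> and deterministic times, so a sum of \<open>m + 1\<close> terms is already
  known at time \<open>c m\<close>.\<close>

lemma step_qv_measurable: "step_qv c \<eta> n \<in> borel_measurable (F (c m))" if "n \<le> Suc m"
  unfolding step_qv_def[abs_def] using that
  by (intro borel_measurable_sum borel_measurable_times borel_measurable_power)
     (auto intro!: step_measurable)

lemma step_sum_measurable_M[measurable]: "step_sum c \<eta> n \<in> borel_measurable M"
  using step_sum_measurable step_nonneg measurable_F_M by blast

lemma step_qv_measurable_M[measurable]: "step_qv c \<eta> n \<in> borel_measurable M"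
  using measurable_F_M[OF step_qv_measurable[of n n] step_nonneg] by simp

lemma step_qv_nonneg: "0 \<le> step_qv c \<eta> n \<omega>"
  using step_Suc by (auto simp: step_qv_def intro!: sum_nonneg mult_nonneg_nonneg)

lemma step_qv_mono: "m \<le> n \<Longrightarrow> step_qv c \<eta> m \<omega> \<le> step_qv c \<eta> n \<omega>"
  unfolding step_qv_def using step_Suc by (intro sum_mono2) auto

lemma integrable_step_mult:
  assumes "integrable M f" shows "integrable M (\<lambda>\<omega>. \<eta> i \<omega> * f \<omega>)"
proof -
  obtain K where K: "\<And>\<omega>. \<omega> \<in> space M \<Longrightarrow> \<bar>\<eta> i \<omega>\<bar> \<le> K" by (rule step_bound[of i]) blast
  show ?thesis
    by (rule Bochner_Integration.integrable_bound[of M "\<lambda>\<omega>. K * f \<omega>"])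
       (use assms in \<open>auto simp: abs_mult intro!: mult_right_mono order_trans[OF K abs_ge_self]\<close>)
qed

text \<open>Each new summand is an increment times a bounded factor known at its left endpoint,
  hence centred. In the limit, \<open>Z\<close> becomes an arbitrary bounded variable known at the
  start of the time interval.\<close>

lemma step_sum_martingale:
  assumes Z: "Z \<in> borel_measurable (F (c 0))" and bd: "\<And>\<omega>. \<omega> \<in> space M \<Longrightarrow> \<bar>Z \<omega>\<bar> \<le> K"
  shows "integrable M (\<lambda>\<omega>. Z \<omega> * step_sum c \<eta> n \<omega>) \<and> expectation (\<lambda>\<omega>. Z \<omega> * step_sum c \<eta> n \<omega>) = 0"
proof (induction n)
  case 0
  then show ?case by (simp add: step_sum_def)
next
  case (Suc n)
  have ZM: "Z \<in> borel_measurable M"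
    using measurable_F_M[OF Z step_nonneg] .
  have "integrable M Z"
    by (rule integrable_const_bound[where B = K]) (use bd ZM in auto)
  then have int: "integrable M (\<lambda>\<omega>. \<eta> n \<omega> * Z \<omega>)" by (rule integrable_step_mult)
  have meas: "(\<lambda>\<omega>. \<eta> n \<omega> * Z \<omega>) \<in> borel_measurable (F (c n))"
    using measurable_F_mono[OF Z step_nonneg step_mono[of 0 n]] step_measurable[of n n]
    by (intro borel_measurable_times) auto
  note e = expectation_mult_increment(1,2)[OF step_nonneg step_Suc meas int]
  have "Z \<omega> * step_sum c \<eta> (Suc n) \<omega> =
      Z \<omega> * step_sum c \<eta> n \<omega> + \<eta> n \<omega> * Z \<omega> * (B (c (Suc n)) \<omega> - B (c n) \<omega>)" for \<omega>
    by (simp add: step_sum_def algebra_simps)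
  then show ?case
    using Suc e by simp
qed

text \<open>In the expanded square, the cross term carries a centred increment independent of its
  other factors, and the squared increment contributes its variance.\<close>

lemma step_sum_isometry:
  "integrable M (\<lambda>\<omega>. (step_sum c \<eta> n \<omega>)\<^sup>2) \<and> integrable M (step_qv c \<eta> n) \<and>
    expectation (\<lambda>\<omega>. (step_sum c \<eta> n \<omega>)\<^sup>2) = expectation (step_qv c \<eta> n)"
proof (induction n)
  case 0
  then show ?case by (simp add: step_sum_def step_qv_def[abs_def])
next
  case (Suc n)
  let ?D = "\<lambda>\<omega>. B (c (Suc n)) \<omega> - B (c n) \<omega>"
  have "integrable M (step_sum c \<eta> n)"
    by (rule square_integrable_imp_integrable) (use Suc in auto)
  then have int1: "integrable M (\<lambda>\<omega>. \<eta> n \<omega> * step_sum c \<eta> n \<omega>)" by (rule integrable_step_mult)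
  have "integrable M (\<lambda>\<omega>. \<eta> n \<omega> * (\<eta> n \<omega> * 1))"
    by (intro integrable_step_mult) simp
  then have int2: "integrable M (\<lambda>\<omega>. (\<eta> n \<omega>)\<^sup>2)" by (simp add: power2_eq_square)
  have meas: "(\<lambda>\<omega>. \<eta> n \<omega> * step_sum c \<eta> n \<omega>) \<in> borel_measurable (F (c n))"
    "(\<lambda>\<omega>. (\<eta> n \<omega>)\<^sup>2) \<in> borel_measurable (F (c n))"
    using step_sum_measurable[of n] step_measurable[of n n]
    by (auto intro!: borel_measurable_times borel_measurable_power)
  note e1 = expectation_mult_increment[OF step_nonneg step_Suc meas(1) int1]
  note e2 = expectation_mult_increment[OF step_nonneg step_Suc meas(2) int2]
  have 1: "(step_sum c \<eta> (Suc n) \<omega>)\<^sup>2 = (step_sum c \<eta> n \<omega>)\<^sup>2 +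
      2 * (\<eta> n \<omega> * step_sum c \<eta> n \<omega> * ?D \<omega>) + (\<eta> n \<omega>)\<^sup>2 * (?D \<omega>)\<^sup>2" for \<omega>
    by (simp add: step_sum_def power2_eq_square algebra_simps)
  have 2: "step_qv c \<eta> (Suc n) = (\<lambda>\<omega>. step_qv c \<eta> n \<omega> + (\<eta> n \<omega>)\<^sup>2 * (c (Suc n) - c n))"
    by (simp add: step_qv_def fun_eq_iff)
  show ?case
    unfolding 1 2 using Suc e1 e2 int2 by simp
qed

text \<open>Each further interval multiplies the exponential by a factor with conditional mean one
  given the past; the exponent reached so far plays the role of \<open>U\<close> in
  \<open>nn_integral_exp_increment\<close>.\<close>

lemma step_sum_exponential:
  "(\<integral>\<^sup>+\<omega>. ennreal (exp (\<theta> * step_sum c \<eta> n \<omega> - \<theta>\<^sup>2 / 2 * step_qv c \<eta> n \<omega>)) \<partial>M) = 1"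
proof (induction n)
  case 0
  then show ?case by (simp add: step_sum_def step_qv_def emeasure_space_1)
next
  case (Suc n)
  let ?U = "\<lambda>\<omega>. \<theta> * step_sum c \<eta> n \<omega> - \<theta>\<^sup>2 / 2 * step_qv c \<eta> n \<omega>"
  have U: "?U \<in> borel_measurable (F (c n))" and V: "(\<lambda>\<omega>. \<theta> * \<eta> n \<omega>) \<in> borel_measurable (F (c n))"
    using step_sum_measurable[of n] step_qv_measurable[of n n] step_measurable[of n n] by auto
  have "\<theta> * step_sum c \<eta> (Suc n) \<omega> - \<theta>\<^sup>2 / 2 * step_qv c \<eta> (Suc n) \<omega> =
      ?U \<omega> + \<theta> * \<eta> n \<omega> * (B (c (Suc n)) \<omega> - B (c n) \<omega>) - (\<theta> * \<eta> n \<omega>)\<^sup>2 * (c (Suc n) - c n) / 2" for \<omega>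
    by (simp add: step_sum_def step_qv_def power_mult_distrib diff_divide_distrib algebra_simps)
  then show ?case
    using nn_integral_exp_increment[OF step_nonneg step_Suc U V] Suc by simp
qed

text \<open>The exponential identity alone gives the bound: \<open>\<bar>x\<bar> ^ 4 / 24\<close> is
  a term of the series of \<open>exp \<bar>x\<bar>\<close>, which is at most
  \<open>exp x + exp (- x)\<close>, so the identity is used at \<theta> and at - \<theta>. In the
  constant, 24 is 4!, one factor 2 bounds \<open>exp (1 / 2)\<close>, and the other counts the two
  exponentials of mean one.\<close>

lemma step_sum_fourth_moment:
  assumes N: "N > 0" and qv: "\<And>\<omega>. \<omega> \<in> space M \<Longrightarrow> step_qv c \<eta> n \<omega> \<le> N"
  shows "(\<integral>\<^sup>+\<omega>. ennreal ((step_sum c \<eta> n \<omega>) ^ 4) \<partial>M) \<le> ennreal (96 * N\<^sup>2)"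
proof -
  \<comment> \<open>With this scaling the compensator in the exponent is at most 1/2, and undoing it
    in the fourth power produces \<open>N\<^sup>2\<close>.\<close>
  define \<theta> where "\<theta> = 1 / sqrt N"
  have \<theta>: "\<theta>\<^sup>2 = 1 / N" "\<theta> ^ 4 = 1 / N\<^sup>2"
    using N by (auto simp: \<theta>_def power_divide power4_eq_xxxx power2_eq_square)
  let ?S = "step_sum c \<eta> n" and ?Q = "step_qv c \<eta> n"
  have "?S \<omega> ^ 4 \<le> 48 * N\<^sup>2 * (exp (\<theta> * ?S \<omega> - \<theta>\<^sup>2 / 2 * ?Q \<omega>) + exp ((- \<theta>) * ?S \<omega> - (- \<theta>)\<^sup>2 / 2 * ?Q \<omega>))"
    if \<omega>: "\<omega> \<in> space M" for \<omega>
  proof -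
    have exp4: "\<bar>x\<bar> ^ 4 / 24 \<le> exp \<bar>x\<bar>" for x :: real
    proof -
      have "(\<Sum>i\<in>{4::nat}. \<bar>x\<bar> ^ i /\<^sub>R fact i) \<le> exp \<bar>x\<bar>"
        unfolding exp_def by (rule sum_le_suminf[OF summable_exp_generic]) auto
      then show ?thesis by (simp add: fact_numeral)
    qed
    have e12: "exp (1 / 2 :: real) \<le> 2"
    proof -
      have "(exp (1 / 2 :: real))\<^sup>2 = exp 1" by (simp add: power2_eq_square exp_add[symmetric])
      also have "\<dots> \<le> 2\<^sup>2" using exp_le by simp
      finally show ?thesis by (rule power2_le_imp_le) simp
    qed
    have q: "\<theta>\<^sup>2 / 2 * ?Q \<omega> \<le> 1 / 2"
      using qv[OF \<omega>] N by (simp add: \<theta> field_simps)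
    have "(\<theta> * ?S \<omega>) ^ 4 \<le> 24 * exp \<bar>\<theta> * ?S \<omega>\<bar>"
      using exp4[of "\<theta> * ?S \<omega>"] by (simp add: power_even_abs)
    also have "exp \<bar>\<theta> * ?S \<omega>\<bar> \<le> exp (\<theta> * ?S \<omega>) + exp (- (\<theta> * ?S \<omega>))"
      by (simp add: abs_if)
    also have "\<dots> = exp (\<theta>\<^sup>2 / 2 * ?Q \<omega>) *
        (exp (\<theta> * ?S \<omega> - \<theta>\<^sup>2 / 2 * ?Q \<omega>) + exp ((- \<theta>) * ?S \<omega> - (- \<theta>)\<^sup>2 / 2 * ?Q \<omega>))"
      by (simp add: distrib_left exp_add[symmetric])
    also have "\<dots> \<le> 2 * (exp (\<theta> * ?S \<omega> - \<theta>\<^sup>2 / 2 * ?Q \<omega>) + exp ((- \<theta>) * ?S \<omega> - (- \<theta>)\<^sup>2 / 2 * ?Q \<omega>))"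
      using q e12 by (intro mult_right_mono order_trans[OF _ e12] add_nonneg_nonneg) auto
    finally show ?thesis using N by (simp add: power_mult_distrib \<theta> field_simps)
  qed
  then have "(\<integral>\<^sup>+\<omega>. ennreal (?S \<omega> ^ 4) \<partial>M) \<le> (\<integral>\<^sup>+\<omega>. ennreal (48 * N\<^sup>2) *
      (ennreal (exp (\<theta> * ?S \<omega> - \<theta>\<^sup>2 / 2 * ?Q \<omega>)) + ennreal (exp ((- \<theta>) * ?S \<omega> - (- \<theta>)\<^sup>2 / 2 * ?Q \<omega>))) \<partial>M)"
    by (intro nn_integral_mono) (auto simp: ennreal_mult'[symmetric] ennreal_plus[symmetric] simp del: ennreal_plus intro!: ennreal_leI)
  also have "\<dots> = ennreal (48 * N\<^sup>2) * (1 + 1)"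
    by (subst nn_integral_cmult, simp, subst nn_integral_add, simp, simp, simp only: step_sum_exponential)
  also have "\<dots> = ennreal (96 * N\<^sup>2)"
    using N by (simp add: ennreal_mult'[symmetric] flip: ennreal_numeral)
  finally show ?thesis .
qed

text \<open>Truncating at the first index where the quadratic variation exceeds \<open>N\<close>: since
  \<open>step_qv c \<eta> (i+1)\<close> is known at time \<open>c i\<close>, the result is again a step integrand.\<close>

definition truncate :: "real \<Rightarrow> nat \<Rightarrow> 'a \<Rightarrow> real" where
  "truncate N i \<omega> = (if step_qv c \<eta> (Suc i) \<omega> \<le> N then \<eta> i \<omega> else 0)"

lemma step_integrand_truncate: "step_integrand c (truncate N)"
  unfolding step_integrand_def
proof (intro conjI allI)
  show "0 \<le> c 0" "c i \<le> c (Suc i)" for i by (rule step_nonneg step_Suc)+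
  show "truncate N i \<in> borel_measurable (F (c i))" for i
    unfolding truncate_def[abs_def]
    using step_qv_measurable[of "Suc i" i] step_measurable[of i i] by measurable
  show "bounded (truncate N i ` space M)" for i
  proof -
    obtain K where K: "\<And>\<omega>. \<omega> \<in> space M \<Longrightarrow> \<bar>\<eta> i \<omega>\<bar> \<le> K" by (rule step_bound[of i]) blast
    show ?thesis
      by (auto simp: bounded_iff truncate_def intro!: exI[of _ K] K order_trans[OF abs_ge_zero K])
  qed
qed

text \<open>As long as the original sum is within \<open>N\<close>, it dominates the truncated one
  term by term; otherwise the last term has been set to 0 and the induction hypothesis
  applies.\<close>

lemma step_qv_truncate_le: "N \<ge> 0 \<Longrightarrow> step_qv c (truncate N) n \<omega> \<le> N"
proof (induction n)
  case (Suc n)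
  show ?case
  proof (cases "step_qv c \<eta> (Suc n) \<omega> \<le> N")
    case True
    have "step_qv c (truncate N) (Suc n) \<omega> \<le> step_qv c \<eta> (Suc n) \<omega>"
      unfolding step_qv_def using step_Suc
      by (intro sum_mono mult_right_mono) (auto simp: truncate_def)
    then show ?thesis using True by simp
  next
    case False
    then show ?thesis using Suc by (simp add: step_qv_def truncate_def)
  qed
qed (simp add: step_qv_def)

text \<open>The quadratic variation is nondecreasing in the index, so a final value within the level
  means that no earlier value was cut.\<close>

lemma truncate_eq:
  assumes "step_qv c \<eta> n \<omega> \<le> N"
  shows "step_sum c (truncate N) n \<omega> = step_sum c \<eta> n \<omega>" "step_qv c (truncate N) n \<omega> = step_qv c \<eta> n \<omega>"
proof -
  have "truncate N i \<omega> = \<eta> i \<omega>" if "i < n" for i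
    using step_qv_mono[of "Suc i" n \<omega>] that assms by (simp add: truncate_def)
  then show "step_sum c (truncate N) n \<omega> = step_sum c \<eta> n \<omega>" "step_qv c (truncate N) n \<omega> = step_qv c \<eta> n \<omega>"
    by (auto simp: step_sum_def step_qv_def)
qed

end

end

section \<open>Convergence in probability and in quadratic mean\<close>

lemma (in prob_space) vanishes_in_probability_add:
  assumes [measurable]: "\<And>k. Z k \<in> borel_measurable M" "\<And>k. W k \<in> borel_measurable M"
    and Z: "vanishes_in_probability M Z" and W: "vanishes_in_probability M W"
  shows "vanishes_in_probability M (\<lambda>k \<omega>. Z k \<omega> + W k \<omega>)"
  unfolding vanishes_in_probability_def
proof (intro allI impI)
  fix \<epsilon> :: real assume \<epsilon>: "\<epsilon> > 0"
  let ?z = "\<lambda>k. prob {\<omega> \<in> space M. Z k \<omega> > ennreal (\<epsilon> / 2)}"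
  let ?w = "\<lambda>k. prob {\<omega> \<in> space M. W k \<omega> > ennreal (\<epsilon> / 2)}"
  have lim: "?z \<longlonglongrightarrow> 0" "?w \<longlonglongrightarrow> 0"
    using Z W \<epsilon> by (auto simp: vanishes_in_probability_def)
  have "prob {\<omega> \<in> space M. Z k \<omega> + W k \<omega> > ennreal \<epsilon>} \<le> ?z k + ?w k" for k
  proof -
    have "Z k \<omega> > ennreal (\<epsilon> / 2) \<or> W k \<omega> > ennreal (\<epsilon> / 2)" if "Z k \<omega> + W k \<omega> > ennreal \<epsilon>" for \<omega>
    proof (rule ccontr)
      assume "\<not> ?thesis"
      then have "Z k \<omega> + W k \<omega> \<le> ennreal (\<epsilon> / 2) + ennreal (\<epsilon> / 2)"
        by (intro add_mono) auto
      also have "\<dots> = ennreal \<epsilon>" using \<epsilon> by (simp flip: ennreal_plus)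
      finally show False using that by simp
    qed
    then have "prob {\<omega> \<in> space M. Z k \<omega> + W k \<omega> > ennreal \<epsilon>} \<le>
        prob ({\<omega> \<in> space M. Z k \<omega> > ennreal (\<epsilon> / 2)} \<union> {\<omega> \<in> space M. W k \<omega> > ennreal (\<epsilon> / 2)})"
      by (intro finite_measure_mono) auto
    also have "\<dots> \<le> ?z k + ?w k"
      by (intro measure_Un_le) auto
    finally show ?thesis .
  qed
  then show "(\<lambda>k. prob {\<omega> \<in> space M. Z k \<omega> + W k \<omega> > ennreal \<epsilon>}) \<longlonglongrightarrow> 0"
    by (intro Lim_null_comparison[OF _ tendsto_add_zero[OF lim]]) auto
qed

text \<open>The index \<open>r j\<close> is chosen so that exceeding \<open>(1/2) ^ j\<close> has
  probability below \<open>(1/2) ^ j\<close>; these probabilities are summable, and the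
  Borel-Cantelli lemma gives convergence along \<open>r\<close>. Extended nonnegative values let the
  error integrals of the Ito definition enter without a proof that they are finite.\<close>

lemma (in prob_space) vanishes_in_probability_AE_subseq:
  assumes [measurable]: "\<And>k. Z k \<in> borel_measurable M"
    and Z: "vanishes_in_probability M Z"
  obtains r :: "nat \<Rightarrow> nat" where "AE \<omega> in M. (\<lambda>j. Z (r j) \<omega>) \<longlonglongrightarrow> 0"
proof -
  have "\<exists>k. prob {\<omega> \<in> space M. Z k \<omega> > ennreal ((1/2) ^ j)} < (1/2) ^ j" for j :: nat
  proof -
    have "(\<lambda>k. prob {\<omega> \<in> space M. Z k \<omega> > ennreal ((1/2) ^ j)}) \<longlonglongrightarrow> 0"
      using Z by (auto simp: vanishes_in_probability_def)
    then have "\<forall>\<^sub>F k in sequentially. prob {\<omega> \<in> space M. Z k \<omega> > ennreal ((1/2) ^ j)} < (1/2) ^ j"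
      by (rule order_tendstoD) simp
    then show ?thesis by (rule eventually_happens'[OF sequentially_bot])
  qed
  then obtain r where r: "\<And>j. prob {\<omega> \<in> space M. Z (r j) \<omega> > ennreal ((1/2) ^ j)} < (1/2) ^ j"
    by metis
  let ?A = "\<lambda>j. {\<omega> \<in> space M. Z (r j) \<omega> > ennreal ((1/2) ^ j)}"
  have "summable (\<lambda>j. prob (?A j))"
    by (rule summable_comparison_test'[OF summable_geometric[of "1/2 :: real"], of 0])
       (use r less_imp_le in auto)
  then have "AE \<omega> in M. eventually (\<lambda>j. \<omega> \<in> space M - ?A j) sequentially"
    by (intro borel_cantelli_AE1) (auto simp: emeasure_eq_measure)
  then have "AE \<omega> in M. (\<lambda>j. Z (r j) \<omega>) \<longlonglongrightarrow> 0"
  proof eventually_elim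
    case (elim \<omega>)
    have "(\<lambda>j. ennreal ((1/2) ^ j)) \<longlonglongrightarrow> ennreal 0"
      by (intro tendsto_ennrealI LIMSEQ_realpow_zero) auto
    then have lim0: "(\<lambda>j. ennreal ((1/2) ^ j)) \<longlonglongrightarrow> 0" by simp
    show ?case
      by (rule tendsto_sandwich[OF _ _ tendsto_const lim0])
         (use elim in \<open>auto elim: eventually_mono simp: not_less\<close>)
  qed
  then show ?thesis by (rule that)
qed

lemma (in prob_space) AE_tendsto_imp_tendsto_prob:
  fixes f :: "nat \<Rightarrow> 'a \<Rightarrow> real"
  assumes [measurable]: "\<And>k. f k \<in> borel_measurable M" "g \<in> borel_measurable M"
    and lim: "AE \<omega> in M. (\<lambda>k. f k \<omega>) \<longlonglongrightarrow> g \<omega>" and \<epsilon>: "\<epsilon> > 0"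
  shows "(\<lambda>k. prob {\<omega> \<in> space M. \<bar>f k \<omega> - g \<omega>\<bar> > \<epsilon>}) \<longlonglongrightarrow> 0"
proof -
  let ?A = "\<lambda>k. {\<omega> \<in> space M. \<bar>f k \<omega> - g \<omega>\<bar> > \<epsilon>}"
  have "(\<lambda>k. expectation (indicator (?A k) :: 'a \<Rightarrow> real)) \<longlonglongrightarrow> expectation (\<lambda>\<omega>. 0)"
  proof (rule integral_dominated_convergence[where w = "\<lambda>_. 1"])
    show "AE \<omega> in M. (\<lambda>k. indicator (?A k) \<omega> :: real) \<longlonglongrightarrow> 0"
      using lim
    proof eventually_elim
      case (elim \<omega>)
      have "\<forall>\<^sub>F k in sequentially. dist (f k \<omega>) (g \<omega>) < \<epsilon>"
        using tendstoD[OF elim \<epsilon>] .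
      then have "\<forall>\<^sub>F k in sequentially. (indicator (?A k) \<omega> :: real) = 0"
        by eventually_elim (auto simp: dist_real_def)
      then show ?case by (rule tendsto_eventually)
    qed
  qed (auto simp: indicator_def)
  then show ?thesis by simp
qed

text \<open>On the bad set, \<open>f\<close> is at most its part above the level N + 1 plus that
  level. The first contribution vanishes by integrability of \<open>f\<close>, the second by
  \<open>lim\<close>.\<close>

lemma (in prob_space) expectation_indicator_small:
  assumes f: "integrable M f" "\<And>\<omega>. f \<omega> \<ge> (0 :: real)"
    and bad[measurable]: "\<And>N. bad N \<in> sets M"
    and lim: "(\<lambda>N. real (Suc N) * prob (bad N)) \<longlonglongrightarrow> 0"
  shows "(\<lambda>N. expectation (\<lambda>\<omega>. f \<omega> * indicator (bad N) \<omega>)) \<longlonglongrightarrow> 0"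
proof -
  have [measurable]: "f \<in> borel_measurable M" using f by simp
  let ?g = "\<lambda>N \<omega>. f \<omega> * indicator {\<omega> \<in> space M. f \<omega> > real (Suc N)} \<omega>"
  have g: "(\<lambda>N. expectation (?g N)) \<longlonglongrightarrow> expectation (\<lambda>\<omega>. 0)"
  proof (rule integral_dominated_convergence[OF _ _ f(1)])
    show "AE \<omega> in M. (\<lambda>N. ?g N \<omega>) \<longlonglongrightarrow> 0"
    proof (intro AE_I2 tendsto_eventually)
      fix \<omega>
      obtain n where n: "f \<omega> \<le> real n" using real_arch_simple by blast
      show "\<forall>\<^sub>F N in sequentially. ?g N \<omega> = 0"
        using eventually_ge_at_top[of n] by eventually_elim (use n in \<open>auto simp: indicator_def\<close>)
    qed
  qed (use f in \<open>auto simp: indicator_def\<close>)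
  have bi: "integrable M (indicator (bad N) :: 'a \<Rightarrow> real)" for N
    by (rule integrable_const_bound[where B = 1]) auto
  have int: "integrable M (?g N)" "integrable M (\<lambda>\<omega>. f \<omega> * indicator (bad N) \<omega>)" for N
    by (rule Bochner_Integration.integrable_bound[OF f(1)]; use f in \<open>auto simp: indicator_def\<close>)+
  have "expectation (\<lambda>\<omega>. f \<omega> * indicator (bad N) \<omega>) \<le>
      expectation (\<lambda>\<omega>. ?g N \<omega> + real (Suc N) * indicator (bad N) \<omega>)" for N
    by (rule integral_mono) (use int f bi in \<open>auto split: split_indicator simp del: of_nat_Suc\<close>)
  then have le: "expectation (\<lambda>\<omega>. f \<omega> * indicator (bad N) \<omega>) \<le>
      expectation (?g N) + real (Suc N) * prob (bad N)" for N
    using int bi by (simp del: of_nat_Suc)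
  show ?thesis
  proof (rule Lim_null_comparison)
    show "(\<lambda>N. expectation (?g N) + real (Suc N) * prob (bad N)) \<longlonglongrightarrow> 0"
      using tendsto_add[OF g lim] by simp
    show "\<forall>\<^sub>F N in sequentially. norm (expectation (\<lambda>\<omega>. f \<omega> * indicator (bad N) \<omega>)) \<le>
        expectation (?g N) + real (Suc N) * prob (bad N)"
      using le f(2) by (simp add: abs_of_nonneg del: of_nat_Suc)
  qed
qed

text \<open>The fourth moments of \<open>Y N\<close> may grow like \<open>N\<^sup>2\<close>, which is compensated by
  \<open>prob (bad N) = o(N\<^sup>-\<^sup>2)\<close>.\<close>

lemma (in prob_space) tendsto_L2_outside_bad_sets:
  fixes Y :: "nat \<Rightarrow> 'a \<Rightarrow> real"
  assumes [measurable]: "\<And>N. Y N \<in> borel_measurable M" "D \<in> borel_measurable M" "\<And>N. bad N \<in> sets M"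
    and D: "integrable M (\<lambda>\<omega>. (D \<omega>)\<^sup>2)"
    and Y4: "\<And>N. (\<integral>\<^sup>+\<omega>. ennreal (Y N \<omega> ^ 4) \<partial>M) \<le> ennreal (C * (real (Suc N))\<^sup>2)" and C: "C \<ge> 0"
    and good: "\<And>N \<omega>. \<omega> \<in> space M - bad N \<Longrightarrow> \<bar>Y N \<omega> - D \<omega>\<bar> \<le> 1 / real (Suc N)"
    and bad: "(\<lambda>N. (real (Suc N))\<^sup>2 * prob (bad N)) \<longlonglongrightarrow> 0"
  shows "integrable M (\<lambda>\<omega>. (Y N \<omega>)\<^sup>2)"
    "(\<lambda>N. expectation (\<lambda>\<omega>. \<bar>Y N \<omega> - D \<omega>\<bar>)) \<longlonglongrightarrow> 0"
    "(\<lambda>N. expectation (\<lambda>\<omega>. (Y N \<omega>)\<^sup>2)) \<longlonglongrightarrow> expectation (\<lambda>\<omega>. (D \<omega>)\<^sup>2)"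
proof -
  have inv0: "(\<lambda>N. 1 / real (Suc N)) \<longlonglongrightarrow> 0"
    using LIMSEQ_inverse_real_of_nat by (simp add: inverse_eq_divide)
  define p where "p N = (real (Suc N))\<^sup>2 * prob (bad N)" for N
  have p: "p \<longlonglongrightarrow> 0" "p N \<ge> 0" for N
    using bad by (auto simp: p_def[abs_def])
  have int4: "integrable M (\<lambda>\<omega>. Y N \<omega> ^ 4)" for N
    by (rule integrableI_nonneg) (use le_less_trans[OF Y4] in auto)
  have E4: "expectation (\<lambda>\<omega>. Y N \<omega> ^ 4) \<le> C * (real (Suc N))\<^sup>2" for N
    using Y4[of N] C by (subst (asm) nn_integral_eq_integral[OF int4]) auto
  have int2: "integrable M (\<lambda>\<omega>. (Y N \<omega>)\<^sup>2)" for N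
    by (rule square_integrable_imp_integrable) (use int4[of N] in \<open>auto simp flip: power_mult\<close>)
  have int1: "integrable M (Y N)" for N
    by (rule square_integrable_imp_integrable[OF _ int2]) simp
  have intD: "integrable M D"
    by (rule square_integrable_imp_integrable[OF _ D]) simp
  have bi: "integrable M (indicator (bad N) :: 'a \<Rightarrow> real)" for N
    by (rule integrable_const_bound[where B = 1]) auto
  note mi = integrable_real_mult_indicator
  have Yb: "integrable M (\<lambda>\<omega>. (Y N \<omega>)\<^sup>2 * indicator (bad N) \<omega>)"
    "integrable M (\<lambda>\<omega>. (D \<omega>)\<^sup>2 * indicator (bad N) \<omega>)" for N
    by (intro mi int2 D; simp)+
  have Ylim: "(\<lambda>N. expectation (\<lambda>\<omega>. (Y N \<omega>)\<^sup>2 * indicator (bad N) \<omega>)) \<longlonglongrightarrow> 0"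
  proof -
    \<comment> \<open>Weight for Young's inequality between \<open>y ^ 4\<close> and the indicator.
      The choice \<open>sqrt (p N)\<close> balances the two resulting terms; the summand
      \<open>1 / real (Suc N)\<close> keeps the weight positive when \<open>p N\<close>
      vanishes.\<close>
    define e where "e N = sqrt (p N) + 1 / real (Suc N)" for N
    have e: "e N > 0" "sqrt (p N) \<le> e N" for N
      using p(2)[of N] by (auto simp: e_def add_nonneg_pos)
    have le: "expectation (\<lambda>\<omega>. (Y N \<omega>)\<^sup>2 * indicator (bad N) \<omega>) \<le> C * e N / 2 + sqrt (p N) / 2" for N
    proof -
      let ?m = "(real (Suc N))\<^sup>2"
      have m: "?m > 0" by simp
      have "y\<^sup>2 * i \<le> e N / (2 * ?m) * y ^ 4 + ?m / (2 * e N) * i" if "i = 0 \<or> i = 1" for y i :: real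
      proof -
        have "0 \<le> (e N / (2 * ?m)) * (y\<^sup>2 - ?m / e N)\<^sup>2"
          using e(1)[of N] m by simp
        also have "\<dots> = e N / (2 * ?m) * y ^ 4 + ?m / (2 * e N) - y\<^sup>2"
          using e(1)[of N] m
          by (simp add: field_simps power2_eq_square power4_eq_xxxx del: of_nat_Suc)
        finally show ?thesis
          using that e(1)[of N] by (auto simp del: of_nat_Suc)
      qed
      then have "expectation (\<lambda>\<omega>. (Y N \<omega>)\<^sup>2 * indicator (bad N) \<omega>) \<le>
          expectation (\<lambda>\<omega>. e N / (2 * ?m) * Y N \<omega> ^ 4 + ?m / (2 * e N) * indicator (bad N) \<omega>)"
        using Yb int4 bi by (intro integral_mono) (auto split: split_indicator simp del: of_nat_Suc)
      also have "\<dots> = e N / (2 * ?m) * expectation (\<lambda>\<omega>. Y N \<omega> ^ 4) + ?m / (2 * e N) * prob (bad N)"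
        using int4 bi by (simp del: of_nat_Suc)
      also have "e N / (2 * ?m) * expectation (\<lambda>\<omega>. Y N \<omega> ^ 4) \<le> e N / (2 * ?m) * (C * ?m)"
        using e(1)[of N] E4[of N] by (intro mult_left_mono) (auto simp del: of_nat_Suc)
      also have "\<dots> = C * e N / 2" using m by (simp del: of_nat_Suc)
      also have "?m / (2 * e N) * prob (bad N) \<le> sqrt (p N) / 2"
      proof -
        have "sqrt (p N) * sqrt (p N) \<le> sqrt (p N) * e N"
          using e(2)[of N] p(2)[of N] by (intro mult_left_mono) auto
        then have "p N \<le> sqrt (p N) * e N" using p(2)[of N] by simp
        then have "p N / (2 * e N) \<le> sqrt (p N) / 2"
          using e(1)[of N] by (simp add: field_simps)
        then show ?thesis by (simp add: p_def)
      qed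
      finally show ?thesis by simp
    qed
    have "(\<lambda>N. C * e N / 2 + sqrt (p N) / 2) \<longlonglongrightarrow> C * (sqrt 0 + 0) / 2 + sqrt 0 / 2"
      unfolding e_def by (intro tendsto_intros p(1) inv0) auto
    then have lim: "(\<lambda>N. C * e N / 2 + sqrt (p N) / 2) \<longlonglongrightarrow> 0" by simp
    show ?thesis
      by (rule Lim_null_comparison[OF _ lim]) (use le in \<open>simp add: abs_of_nonneg\<close>)
  qed
  have bad1: "(\<lambda>N. real (Suc N) * prob (bad N)) \<longlonglongrightarrow> 0"
  proof (rule Lim_null_comparison[OF _ p(1)])
    show "\<forall>\<^sub>F N in sequentially. norm (real (Suc N) * prob (bad N)) \<le> p N"
      unfolding p_def power2_eq_square real_norm_def abs_mult
      by (intro always_eventually allI mult_mono) (auto simp: algebra_simps)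
  qed
  have Dlim: "(\<lambda>N. expectation (\<lambda>\<omega>. (D \<omega>)\<^sup>2 * indicator (bad N) \<omega>)) \<longlonglongrightarrow> 0"
    by (rule expectation_indicator_small[OF D _ _ bad1]) auto
  have blim: "(\<lambda>N. prob (bad N)) \<longlonglongrightarrow> 0"
  proof (rule Lim_null_comparison[OF _ bad1])
    show "\<forall>\<^sub>F N in sequentially. norm (prob (bad N)) \<le> real (Suc N) * prob (bad N)"
      by (intro always_eventually allI) (simp add: algebra_simps)
  qed
  \<comment> \<open>Common bound for the errors on the bad set; the constant 2 comes from applying
    \<open>\<bar>x\<bar> \<le> 1 + x\<^sup>2\<close> to both \<open>Y N\<close> and
    \<open>D\<close>.\<close>
  define w where "w N = 2 * prob (bad N) + expectation (\<lambda>\<omega>. (Y N \<omega>)\<^sup>2 * indicator (bad N) \<omega>) +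
    expectation (\<lambda>\<omega>. (D \<omega>)\<^sup>2 * indicator (bad N) \<omega>)" for N
  have wlim: "w \<longlonglongrightarrow> 2 * 0 + 0 + 0"
    unfolding w_def by (intro tendsto_intros blim Ylim Dlim)
  have wE: "expectation (\<lambda>\<omega>. a + b * \<bar>D \<omega>\<bar> + (2 * indicator (bad N) \<omega> + (Y N \<omega>)\<^sup>2 * indicator (bad N) \<omega> +
      (D \<omega>)\<^sup>2 * indicator (bad N) \<omega>)) = a + b * expectation (\<lambda>\<omega>. \<bar>D \<omega>\<bar>) + w N"
    and wI: "integrable M (\<lambda>\<omega>. a + b * \<bar>D \<omega>\<bar> + (2 * indicator (bad N) \<omega> +
      (Y N \<omega>)\<^sup>2 * indicator (bad N) \<omega> + (D \<omega>)\<^sup>2 * indicator (bad N) \<omega>))" for N a b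
    using Yb[of N] intD bi by (simp_all add: w_def prob_space)
  have sq: "\<bar>x\<bar> \<le> 1 + x\<^sup>2" for x :: real
  proof -
    have "0 \<le> (\<bar>x\<bar> - 1)\<^sup>2" by simp
    then have "2 * \<bar>x\<bar> \<le> 1 + x\<^sup>2" by (simp add: power2_eq_square algebra_simps)
    then show ?thesis using abs_ge_zero[of x] by linarith
  qed
  show "integrable M (\<lambda>\<omega>. (Y N \<omega>)\<^sup>2)" by (rule int2)
  show "(\<lambda>N. expectation (\<lambda>\<omega>. \<bar>Y N \<omega> - D \<omega>\<bar>)) \<longlonglongrightarrow> 0"
  proof (rule Lim_null_comparison)
    \<comment> \<open>The vanishing term \<open>0 * \<bar>D \<omega>\<bar>\<close> gives the bound
      the shape of \<open>wE\<close> and \<open>wI\<close>; the comparison of squares below has a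
      genuine coefficient there.\<close>
    have "\<bar>Y N \<omega> - D \<omega>\<bar> \<le> 1 / real (Suc N) + 0 * \<bar>D \<omega>\<bar> + (2 * indicator (bad N) \<omega> +
        (Y N \<omega>)\<^sup>2 * indicator (bad N) \<omega> + (D \<omega>)\<^sup>2 * indicator (bad N) \<omega>)" if "\<omega> \<in> space M" for \<omega> N
    proof (cases "\<omega> \<in> bad N")
      case True
      have "\<bar>Y N \<omega> - D \<omega>\<bar> \<le> 2 + (Y N \<omega>)\<^sup>2 + (D \<omega>)\<^sup>2"
        using sq[of "Y N \<omega>"] sq[of "D \<omega>"] by linarith
      then show ?thesis using True by (simp add: add_increasing)
    qed (use good that in auto)
    then have "expectation (\<lambda>\<omega>. \<bar>Y N \<omega> - D \<omega>\<bar>) \<le> 1 / real (Suc N) + 0 * expectation (\<lambda>\<omega>. \<bar>D \<omega>\<bar>) + w N" for N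
      unfolding wE[symmetric] using int1 intD wI[of "1 / real (Suc N)" 0 N] by (intro integral_mono) auto
    then show "\<forall>\<^sub>F N in sequentially. norm (expectation (\<lambda>\<omega>. \<bar>Y N \<omega> - D \<omega>\<bar>)) \<le> 1 / real (Suc N) + w N"
      by (simp add: abs_of_nonneg)
    show "(\<lambda>N. 1 / real (Suc N) + w N) \<longlonglongrightarrow> 0"
      using tendsto_add[OF inv0 wlim] by simp
  qed
  have "(\<lambda>N. expectation (\<lambda>\<omega>. (Y N \<omega>)\<^sup>2) - expectation (\<lambda>\<omega>. (D \<omega>)\<^sup>2)) \<longlonglongrightarrow> 0"
  proof (rule Lim_null_comparison)
    have *: "\<bar>(Y N \<omega>)\<^sup>2 - (D \<omega>)\<^sup>2\<bar> \<le> 1 / real (Suc N) + 2 / real (Suc N) * \<bar>D \<omega>\<bar> + (2 * indicator (bad N) \<omega> +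
        (Y N \<omega>)\<^sup>2 * indicator (bad N) \<omega> + (D \<omega>)\<^sup>2 * indicator (bad N) \<omega>)" if "\<omega> \<in> space M" for \<omega> N
    proof (cases "\<omega> \<in> bad N")
      case True
      have "\<bar>(Y N \<omega>)\<^sup>2 - (D \<omega>)\<^sup>2\<bar> \<le> (Y N \<omega>)\<^sup>2 + (D \<omega>)\<^sup>2"
        using zero_le_power2[of "Y N \<omega>"] zero_le_power2[of "D \<omega>"] by linarith
      moreover have "0 \<le> 2 / real (Suc N) * \<bar>D \<omega>\<bar>" "0 \<le> 1 / real (Suc N)" by auto
      moreover have "indicator (bad N) \<omega> = (1 :: real)" using True by simp
      ultimately show ?thesis by (simp only: mult_1_right)
    next
      case False
      let ?d = "Y N \<omega> - D \<omega>"
      have d: "\<bar>?d\<bar> \<le> 1 / real (Suc N)" using good that False by auto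
      \<comment> \<open>In the squared difference one factor is kept small and the other is merely
        bounded by 1.\<close>
      have "1 / real (Suc N) \<le> 1" by simp
      then have "\<bar>?d\<bar> \<le> 1" using d by linarith
      then have "\<bar>?d\<bar> * \<bar>?d\<bar> \<le> 1 / real (Suc N) * 1"
        using d by (intro mult_mono) auto
      moreover have "2 * \<bar>D \<omega>\<bar> * \<bar>?d\<bar> \<le> 2 * \<bar>D \<omega>\<bar> * (1 / real (Suc N))"
        using d by (intro mult_left_mono) auto
      moreover have "\<bar>(Y N \<omega>)\<^sup>2 - (D \<omega>)\<^sup>2\<bar> \<le> \<bar>?d\<bar> * \<bar>?d\<bar> + 2 * \<bar>D \<omega>\<bar> * \<bar>?d\<bar>"
      proof -
        have "(Y N \<omega>)\<^sup>2 - (D \<omega>)\<^sup>2 = ?d * ?d + 2 * D \<omega> * ?d"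
          by (simp add: power2_eq_square algebra_simps)
        then show ?thesis
          by (simp only: abs_mult[symmetric]) (metis abs_mult abs_numeral abs_triangle_ineq)
      qed
      ultimately show ?thesis using False by (simp del: of_nat_Suc)
    qed
    have "\<bar>expectation (\<lambda>\<omega>. (Y N \<omega>)\<^sup>2) - expectation (\<lambda>\<omega>. (D \<omega>)\<^sup>2)\<bar> \<le>
        1 / real (Suc N) + 2 / real (Suc N) * expectation (\<lambda>\<omega>. \<bar>D \<omega>\<bar>) + w N" for N
    proof -
      have "\<bar>expectation (\<lambda>\<omega>. (Y N \<omega>)\<^sup>2) - expectation (\<lambda>\<omega>. (D \<omega>)\<^sup>2)\<bar> =
          \<bar>expectation (\<lambda>\<omega>. (Y N \<omega>)\<^sup>2 - (D \<omega>)\<^sup>2)\<bar>"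
        using int2 D by simp
      also have "\<dots> \<le> expectation (\<lambda>\<omega>. \<bar>(Y N \<omega>)\<^sup>2 - (D \<omega>)\<^sup>2\<bar>)"
        by (rule integral_abs_bound)
      also have "\<dots> \<le> 1 / real (Suc N) + 2 / real (Suc N) * expectation (\<lambda>\<omega>. \<bar>D \<omega>\<bar>) + w N"
        unfolding wE[symmetric] using int2 D wI[of "1 / real (Suc N)" "2 / real (Suc N)" N] *
        by (intro integral_mono) (auto simp del: of_nat_Suc)
      finally show ?thesis .
    qed
    then show "\<forall>\<^sub>F N in sequentially. norm (expectation (\<lambda>\<omega>. (Y N \<omega>)\<^sup>2) - expectation (\<lambda>\<omega>. (D \<omega>)\<^sup>2)) \<le>
        1 / real (Suc N) + 2 * (1 / real (Suc N)) * expectation (\<lambda>\<omega>. \<bar>D \<omega>\<bar>) + w N"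
      by (simp del: of_nat_Suc)
    show "(\<lambda>N. 1 / real (Suc N) + 2 * (1 / real (Suc N)) * expectation (\<lambda>\<omega>. \<bar>D \<omega>\<bar>) + w N) \<longlonglongrightarrow> 0"
    proof -
      have "(\<lambda>N. 1 / real (Suc N) + 2 * (1 / real (Suc N)) * expectation (\<lambda>\<omega>. \<bar>D \<omega>\<bar>) + w N) \<longlonglongrightarrow>
          0 + 2 * 0 * expectation (\<lambda>\<omega>. \<bar>D \<omega>\<bar>) + (2 * 0 + 0 + 0)"
        by (intro tendsto_intros inv0 wlim)
      then show ?thesis by simp
    qed
  qed
  then show "(\<lambda>N. expectation (\<lambda>\<omega>. (Y N \<omega>)\<^sup>2)) \<longlonglongrightarrow> expectation (\<lambda>\<omega>. (D \<omega>)\<^sup>2)"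
    by (simp only: LIM_zero_iff)
qed

text \<open>Convergence in quadratic mean implies convergence of squared norms. Applied on the time
  axis, path by path, it turns convergence of integrands into convergence of quadratic variations.
  For early indices the integrals may be infinite, so finiteness is obtained only
  eventually.\<close>

lemma tendsto_nn_integral_square:
  fixes f :: "nat \<Rightarrow> 'b \<Rightarrow> real"
  assumes [measurable]: "\<And>k. f k \<in> borel_measurable N" "h \<in> borel_measurable N"
    and h: "(\<integral>\<^sup>+x. ennreal ((h x)\<^sup>2) \<partial>N) < \<infinity>"
    and lim: "(\<lambda>k. \<integral>\<^sup>+x. ennreal ((f k x - h x)\<^sup>2) \<partial>N) \<longlonglongrightarrow> 0"
  shows "(\<lambda>k. enn2real (\<integral>\<^sup>+x. ennreal ((f k x)\<^sup>2) \<partial>N)) \<longlonglongrightarrow> enn2real (\<integral>\<^sup>+x. ennreal ((h x)\<^sup>2) \<partial>N)"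
proof -
  have e2r: "enn2real (\<integral>\<^sup>+x. ennreal ((g x)\<^sup>2) \<partial>N) = (\<integral>x. (g x)\<^sup>2 \<partial>N)"
    if "g \<in> borel_measurable N" for g :: "'b \<Rightarrow> real"
    using that by (subst integral_eq_nn_integral) auto
  have hi: "integrable N (\<lambda>x. (h x)\<^sup>2)"
    by (rule integrableI_nonneg) (use h in auto)
  define d where "d k = enn2real (\<integral>\<^sup>+x. ennreal ((f k x - h x)\<^sup>2) \<partial>N)" for k
  have d: "d \<longlonglongrightarrow> 0"
    unfolding d_def by (rule tendsto_enn2real) (use lim in auto)
  have d0: "d k \<ge> 0" for k by (simp add: d_def)
  \<comment> \<open>Weight for Young's inequality, chosen so that both \<open>d k / e k\<close> and
    \<open>e k\<close> tend to 0, and positive even if \<open>d k = 0\<close>.\<close>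
  define e where "e k = sqrt (d k) + 1 / real (Suc k)" for k
  have e: "e k > 0" "sqrt (d k) \<le> e k" for k
    using d0[of k] by (auto simp: e_def add_nonneg_pos)
  let ?b = "\<integral>x. (h x)\<^sup>2 \<partial>N"
  have "\<forall>\<^sub>F k in sequentially. (\<integral>\<^sup>+x. ennreal ((f k x - h x)\<^sup>2) \<partial>N) < \<infinity>"
    by (rule order_tendstoD[OF lim]) simp
  then have le: "\<forall>\<^sub>F k in sequentially. \<bar>(\<integral>x. (f k x)\<^sup>2 \<partial>N) - ?b\<bar> \<le> d k + sqrt (d k) + e k * ?b"
  proof eventually_elim
    case (elim k)
    then have di: "integrable N (\<lambda>x. (f k x - h x)\<^sup>2)"
      by (intro integrableI_nonneg) auto
    have dk: "d k = (\<integral>x. (f k x - h x)\<^sup>2 \<partial>N)"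
      unfolding d_def by (rule e2r) simp
    have pt: "\<bar>x\<^sup>2 - y\<^sup>2\<bar> \<le> (1 + 1 / e k) * (x - y)\<^sup>2 + e k * y\<^sup>2" for x y :: real
    proof -
      have "\<bar>2 * y * (x - y)\<bar> \<le> e k * y\<^sup>2 + (x - y)\<^sup>2 / e k"
      proof -
        have "0 \<le> (e k * \<bar>y\<bar> - \<bar>x - y\<bar>)\<^sup>2 / e k" using e(1)[of k] by simp
        also have "\<dots> = e k * y\<^sup>2 + (x - y)\<^sup>2 / e k - 2 * \<bar>y\<bar> * \<bar>x - y\<bar>"
        proof -
          have "(e k * \<bar>y\<bar> - \<bar>x - y\<bar>)\<^sup>2 = (e k)\<^sup>2 * y\<^sup>2 + (x - y)\<^sup>2 - 2 * (e k * \<bar>y\<bar>) * \<bar>x - y\<bar>"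
            by (simp add: power2_diff power_mult_distrib)
          then show ?thesis
            using e(1)[of k] by (simp add: add_divide_distrib diff_divide_distrib power2_eq_square)
        qed
        finally show ?thesis by (simp add: abs_mult)
      qed
      moreover have "x\<^sup>2 - y\<^sup>2 = (x - y)\<^sup>2 + 2 * y * (x - y)"
        by (simp add: power2_eq_square algebra_simps)
      ultimately have "\<bar>x\<^sup>2 - y\<^sup>2\<bar> \<le> (x - y)\<^sup>2 + (e k * y\<^sup>2 + (x - y)\<^sup>2 / e k)"
        using abs_triangle_ineq[of "(x - y)\<^sup>2" "2 * y * (x - y)"] by simp
      then show ?thesis by (simp add: algebra_simps)
    qed
    have fi: "integrable N (\<lambda>x. (f k x)\<^sup>2)"
    proof (rule Bochner_Integration.integrable_bound)
      show "integrable N (\<lambda>x. (1 + 1 / e k) * (f k x - h x)\<^sup>2 + (e k + 1) * (h x)\<^sup>2)"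
        using hi di by simp
      have "(f k x)\<^sup>2 \<le> (1 + 1 / e k) * (f k x - h x)\<^sup>2 + (e k + 1) * (h x)\<^sup>2" for x
        using pt[of "f k x" "h x"] by (simp add: algebra_simps)
      then show "AE x in N. norm ((f k x)\<^sup>2) \<le> norm ((1 + 1 / e k) * (f k x - h x)\<^sup>2 + (e k + 1) * (h x)\<^sup>2)"
        by (auto intro: order_trans[OF _ abs_ge_self])
    qed simp
    have "\<bar>(\<integral>x. (f k x)\<^sup>2 \<partial>N) - ?b\<bar> = \<bar>\<integral>x. (f k x)\<^sup>2 - (h x)\<^sup>2 \<partial>N\<bar>"
      using fi hi by simp
    also have "\<dots> \<le> (\<integral>x. \<bar>(f k x)\<^sup>2 - (h x)\<^sup>2\<bar> \<partial>N)"
      by (rule integral_abs_bound)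
    also have "\<dots> \<le> (\<integral>x. (1 + 1 / e k) * (f k x - h x)\<^sup>2 + e k * (h x)\<^sup>2 \<partial>N)"
      by (rule integral_mono) (use fi hi di pt in auto)
    also have "\<dots> = (1 + 1 / e k) * d k + e k * ?b"
      using di hi by (simp add: dk)
    also have "\<dots> \<le> d k + sqrt (d k) + e k * ?b"
    proof -
      have "sqrt (d k) * sqrt (d k) \<le> sqrt (d k) * e k"
        using e(2)[of k] d0[of k] by (intro mult_left_mono) auto
      then have "d k / e k \<le> sqrt (d k)"
        using d0[of k] e(1)[of k] by (simp add: field_simps)
      then show ?thesis by (simp add: algebra_simps)
    qed
    finally show ?case .
  qed
  have lim': "(\<lambda>k. d k + sqrt (d k) + e k * ?b) \<longlonglongrightarrow> 0"
  proof -
    have "(\<lambda>N. 1 / real (Suc N)) \<longlonglongrightarrow> 0"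
      using LIMSEQ_inverse_real_of_nat by (simp add: inverse_eq_divide)
    then have "(\<lambda>k. d k + sqrt (d k) + e k * ?b) \<longlonglongrightarrow> 0 + sqrt 0 + (sqrt 0 + 0) * ?b"
      unfolding e_def by (intro tendsto_intros d)
    then show ?thesis by simp
  qed
  have "(\<lambda>k. (\<integral>x. (f k x)\<^sup>2 \<partial>N) - ?b) \<longlonglongrightarrow> 0"
    by (rule Lim_null_comparison[OF _ lim']) (use le in simp)
  then show ?thesis
    by (simp add: e2r LIM_zero_iff)
qed

section \<open>The Ito integral\<close>

text \<open>Progressive measurability is stated on a restricted time interval; extension by 0 gives
  a function on the full product space, where Fubini's theorem applies.\<close>

lemma measurable_extend_restrict_space:
  fixes f :: "'b \<times> 'c \<Rightarrow> real"
  assumes A: "A \<in> sets L" and f: "f \<in> borel_measurable (restrict_space L A \<Otimes>\<^sub>M N)"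
  shows "(\<lambda>p. if fst p \<in> A then f p else 0) \<in> borel_measurable (L \<Otimes>\<^sub>M N)"
proof (subst measurable_If_restrict_space_iff)
  show "{p \<in> space (L \<Otimes>\<^sub>M N). fst p \<in> A} \<in> sets (L \<Otimes>\<^sub>M N)"
    using A by measurable
  have "(\<lambda>p. (fst p, snd p)) \<in> restrict_space (L \<Otimes>\<^sub>M N) {p. fst p \<in> A} \<rightarrow>\<^sub>M restrict_space L A \<Otimes>\<^sub>M N"
    by (intro measurable_Pair measurable_restrict_space2 measurable_restrict_space1)
       (auto simp: space_restrict_space)
  from measurable_compose[OF this f]
  show "f \<in> borel_measurable (restrict_space (L \<Otimes>\<^sub>M N) {p. fst p \<in> A}) \<and>
      (\<lambda>p. 0) \<in> borel_measurable (restrict_space (L \<Otimes>\<^sub>M N) {p. \<not> fst p \<in> A})"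
    by simp
qed

context brownian
begin

lemma progressively_measurable_joint:
  assumes "progressively_measurable F H" "0 \<le> T"
  shows "(\<lambda>p. if fst p \<in> {0..T} then H (fst p) (snd p) else 0) \<in> borel_measurable (lborel \<Otimes>\<^sub>M M)"
proof -
  have H: "(\<lambda>(t, \<omega>). H t \<omega>) \<in> borel_measurable (restrict_space borel {0..T} \<Otimes>\<^sub>M F T)"
    using assms by (simp add: progressively_measurable_def)
  have "(\<lambda>p. if fst p \<in> {0..T} then H (fst p) (snd p) else 0) \<in> borel_measurable (borel \<Otimes>\<^sub>M F T)"
    using measurable_extend_restrict_space[OF _ H] by (simp add: split_beta' cong: if_cong)
  moreover have "(\<lambda>p. (fst p, snd p)) \<in> lborel \<Otimes>\<^sub>M M \<rightarrow>\<^sub>M borel \<Otimes>\<^sub>M F T"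
    using measurable_F_M[of "\<lambda>\<omega>. \<omega>" T "F T"] assms(2) by (intro measurable_Pair) auto
  ultimately show ?thesis
    using measurable_compose[of "\<lambda>p. (fst p, snd p)" "lborel \<Otimes>\<^sub>M M" "borel \<Otimes>\<^sub>M F T"] by auto
qed

section \<open>Simple processes restricted to a time interval\<close>

context
  fixes n \<tau> \<xi> assumes simple: "simple_process M F n \<tau> \<xi>"
begin

lemma simple_mono: "i \<le> j \<Longrightarrow> j \<le> n \<Longrightarrow> \<tau> i \<le> \<tau> j"
proof (induction j rule: dec_induct)
  case (step m)
  then show ?case using simple by (force simp: simple_process_def dest!: spec[of _ m])
qed simp

lemma simple_nonneg: "i \<le> n \<Longrightarrow> 0 \<le> \<tau> i"
  using simple_mono[of 0 i] simple by (auto simp: simple_process_def)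

text \<open>The intervals are disjoint, so at each time at most one term is nonzero and squaring
  passes through the sum.\<close>

lemma simple_value_square:
  "(simple_value n \<tau> \<xi> r \<omega>)\<^sup>2 = (\<Sum>i<n. (\<xi> i \<omega>)\<^sup>2 * indicator {\<tau> i<..\<tau> (Suc i)} r)"
proof (cases "\<exists>i<n. r \<in> {\<tau> i<..\<tau> (Suc i)}")
  case True
  then obtain i where i: "i < n" "r \<in> {\<tau> i<..\<tau> (Suc i)}" by auto
  have other: "r \<notin> {\<tau> j<..\<tau> (Suc j)}" if "j < n" "j \<noteq> i" for j
  proof (cases "j < i")
    case True
    then show ?thesis using simple_mono[of "Suc j" i] i by auto
  next
    case False
    then show ?thesis using simple_mono[of "Suc i" j] i that by auto
  qed
  have *: "(\<Sum>j<n. a j * indicator {\<tau> j<..\<tau> (Suc j)} r) = a i" for a :: "nat \<Rightarrow> real"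
  proof -
    have "(\<Sum>j<n. a j * indicator {\<tau> j<..\<tau> (Suc j)} r) = (\<Sum>j<n. if j = i then a i else 0)"
      by (rule sum.cong) (use i other in auto)
    then show ?thesis using i by simp
  qed
  show ?thesis unfolding simple_value_def * ..
next
  case False
  then show ?thesis by (auto simp: simple_value_def intro!: sum.neutral)
qed

lemma simple_value_joint_measurable:
  "(\<lambda>p. simple_value n \<tau> \<xi> (fst p) (snd p)) \<in> borel_measurable (lborel \<Otimes>\<^sub>M M)"
proof -
  have "\<xi> i \<in> borel_measurable M" if "i < n" for i
    using simple that simple_nonneg[of i] measurable_F_M[of "\<xi> i" "\<tau> i" borel] by (auto simp: simple_process_def)
  then show ?thesis
    unfolding simple_value_def by (intro borel_measurable_sum borel_measurable_times) auto
qed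

context
  fixes s t :: real assumes st: "0 \<le> s" "s \<le> t"
begin

text \<open>The grid is clamped into [s, t], so that intervals outside collapse to points. The index
  is capped at \<open>n\<close> because nothing is known of \<open>\<tau>\<close> beyond, whereas a
  step integrand has a nondecreasing grid over all indices.\<close>

definition clip_time :: "nat \<Rightarrow> real" where
  "clip_time i = max s (min t (\<tau> (min i n)))"

text \<open>The value is set to \<open>0\<close> on degenerate intervals, where \<open>\<xi> i\<close> need not be known at time
  \<open>clip_time i\<close>.\<close>

definition clip_value :: "nat \<Rightarrow> 'a \<Rightarrow> real" where
  "clip_value i = (if i < n \<and> clip_time i < clip_time (Suc i) then \<xi> i else (\<lambda>_. 0))"

lemma clip_time_Suc: "clip_time i \<le> clip_time (Suc i)"
proof -
  have "\<tau> (min i n) \<le> \<tau> (min (Suc i) n)" by (rule simple_mono) auto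
  then show ?thesis by (auto simp: clip_time_def)
qed

lemma step_integrand_clip: "step_integrand clip_time clip_value"
  unfolding step_integrand_def
proof (intro conjI allI)
  show "0 \<le> clip_time 0" using st by (simp add: clip_time_def)
  show "clip_time i \<le> clip_time (Suc i)" for i by (rule clip_time_Suc)
  show "clip_value i \<in> borel_measurable (F (clip_time i))" for i
  proof (cases "i < n \<and> clip_time i < clip_time (Suc i)")
    case True
    then have "\<tau> i \<le> clip_time i" by (auto simp: clip_time_def min_def max_def split: if_splits)
    moreover have "\<xi> i \<in> borel_measurable (F (\<tau> i))"
      using simple True by (auto simp: simple_process_def)
    ultimately show ?thesis
      using True simple_nonneg[of i] by (auto simp: clip_value_def intro: measurable_F_mono)
  next
    case False
    then have "clip_value i = (\<lambda>_. 0)" by (auto simp: clip_value_def)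
    then show ?thesis by simp
  qed
  show "bounded (clip_value i ` space M)" for i
    using simple by (auto simp: clip_value_def simple_process_def bounded_iff intro!: exI[of _ 0])
qed

lemma clip_time_ge: "s \<le> clip_time i"
  by (simp add: clip_time_def)

lemma step_sum_clip:
  "step_sum clip_time clip_value n \<omega> = simple_ito B n \<tau> \<xi> t \<omega> - simple_ito B n \<tau> \<xi> s \<omega>"
proof -
  \<comment> \<open>True for each position of \<open>x\<close> relative to \<open>s\<close> and
    \<open>t\<close>; the term \<open>B s\<close> cancels when differences are taken.\<close>
  have B: "B (max s (min t x)) \<omega> = B (min t x) \<omega> - B (min s x) \<omega> + B s \<omega>" for x
    using st by (auto simp: max_def min_def)
  have "clip_value i \<omega> * (B (clip_time (Suc i)) \<omega> - B (clip_time i) \<omega>) =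
      \<xi> i \<omega> * (B (min t (\<tau> (Suc i))) \<omega> - B (min t (\<tau> i)) \<omega>) -
      \<xi> i \<omega> * (B (min s (\<tau> (Suc i))) \<omega> - B (min s (\<tau> i)) \<omega>)" if i: "i < n" for i
  proof -
    have "clip_value i \<omega> * (B (clip_time (Suc i)) \<omega> - B (clip_time i) \<omega>) =
        \<xi> i \<omega> * (B (clip_time (Suc i)) \<omega> - B (clip_time i) \<omega>)"
      using clip_time_Suc[of i] i by (auto simp: clip_value_def)
    also have "\<dots> = \<xi> i \<omega> * (B (max s (min t (\<tau> (Suc i)))) \<omega> - B (max s (min t (\<tau> i))) \<omega>)"
      using i by (simp add: clip_time_def)
    finally show ?thesis by (simp add: B algebra_simps)
  qed
  then show ?thesis
    by (simp add: step_sum_def simple_ito_def sum_subtractf)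
qed

text \<open>The Ito definition measures integrands by square integrals over time, whereas the moment
  bounds concern \<open>step_qv\<close>; this identifies the two. Disjointness of the intervals
  splits the integral into a sum over the grid.\<close>

lemma step_qv_clip:
  "(\<integral>\<^sup>+r. ennreal ((indicator {s<..t} r * simple_value n \<tau> \<xi> r \<omega>)\<^sup>2) \<partial>lborel) =
    ennreal (step_qv clip_time clip_value n \<omega>)"
proof -
  have "(indicator {s<..t} r * simple_value n \<tau> \<xi> r \<omega>)\<^sup>2 =
      (\<Sum>i<n. (\<xi> i \<omega>)\<^sup>2 * indicator ({\<tau> i<..\<tau> (Suc i)} \<inter> {s<..t}) r)" for r
    by (auto simp: power_mult_distrib simple_value_square indicator_inter_arith[symmetric]
        split: split_indicator)
  then have "ennreal ((indicator {s<..t} r * simple_value n \<tau> \<xi> r \<omega>)\<^sup>2) =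
      (\<Sum>i<n. ennreal ((\<xi> i \<omega>)\<^sup>2) * indicator ({\<tau> i<..\<tau> (Suc i)} \<inter> {s<..t}) r)" for r
    by (simp only:) (subst sum_ennreal[symmetric], auto intro!: sum.cong split: split_indicator)
  then have "(\<integral>\<^sup>+r. ennreal ((indicator {s<..t} r * simple_value n \<tau> \<xi> r \<omega>)\<^sup>2) \<partial>lborel) =
      (\<Sum>i<n. ennreal ((\<xi> i \<omega>)\<^sup>2) * emeasure lborel ({\<tau> i<..\<tau> (Suc i)} \<inter> {s<..t}))"
    by (simp only:) (subst nn_integral_sum, simp, intro sum.cong refl nn_integral_cmult_indicator, simp)
  also have "\<dots> = (\<Sum>i<n. ennreal ((clip_value i \<omega>)\<^sup>2 * (clip_time (Suc i) - clip_time i)))"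
  proof (rule sum.cong)
    fix i assume "i \<in> {..<n}"
    then have i: "i < n" by simp
    have \<tau>: "\<tau> i \<le> \<tau> (Suc i)" using simple_mono[of i "Suc i"] i by simp
    have "{\<tau> i<..\<tau> (Suc i)} \<inter> {s<..t} = {max (\<tau> i) s<..min (\<tau> (Suc i)) t}" by auto
    moreover have "emeasure lborel {max (\<tau> i) s<..min (\<tau> (Suc i)) t} =
        ennreal (max s (min t (\<tau> (Suc i))) - max s (min t (\<tau> i)))"
    proof (cases "max (\<tau> i) s \<le> min (\<tau> (Suc i)) t")
      case True
      then have "min (\<tau> (Suc i)) t - max (\<tau> i) s = max s (min t (\<tau> (Suc i))) - max s (min t (\<tau> i))"
        using \<tau> st by (auto simp: min_def max_def)
      then show ?thesis using True by simp
    next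
      case False
      then have "max s (min t (\<tau> (Suc i))) - max s (min t (\<tau> i)) = 0"
        using \<tau> st by (auto simp: min_def max_def split: if_splits)
      then show ?thesis using False by simp
    qed
    ultimately have "ennreal ((\<xi> i \<omega>)\<^sup>2) * emeasure lborel ({\<tau> i<..\<tau> (Suc i)} \<inter> {s<..t}) =
        ennreal ((\<xi> i \<omega>)\<^sup>2 * (clip_time (Suc i) - clip_time i))"
      using i by (simp add: clip_time_def ennreal_mult'[symmetric])
    then show "ennreal ((\<xi> i \<omega>)\<^sup>2) * emeasure lborel ({\<tau> i<..\<tau> (Suc i)} \<inter> {s<..t}) =
        ennreal ((clip_value i \<omega>)\<^sup>2 * (clip_time (Suc i) - clip_time i))"
      using i clip_time_Suc[of i] by (auto simp: clip_value_def)
  qed simp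
  also have "\<dots> = ennreal (step_qv clip_time clip_value n \<omega>)"
    unfolding step_qv_def using clip_time_Suc by (subst sum_ennreal) auto
  finally show ?thesis .
qed

end

end

section \<open>Passage from simple integrands to the Ito integral\<close>

lemma simple_ito_measurable:
  assumes "simple_process M F n \<tau> \<xi>" "0 \<le> t"
  shows "simple_ito B n \<tau> \<xi> t \<in> borel_measurable M"
proof -
  have "\<xi> i \<in> borel_measurable M" if "i < n" for i
    using assms that simple_nonneg[OF assms(1), of i] measurable_F_M[of "\<xi> i" "\<tau> i" borel] by (auto simp: simple_process_def)
  then show ?thesis
    unfolding simple_ito_def[abs_def] using assms simple_nonneg[OF assms(1)]
    by (intro borel_measurable_sum borel_measurable_times borel_measurable_diff B_measurable_M) auto
qed

text \<open>The quadratic variation of the Ito integral of \<open>H\<close> over (s, t]. An infinite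
  integral would be read as 0, a case that \<open>is_ito_integral\<close> excludes almost
  surely.\<close>

definition qv :: "(real \<Rightarrow> 'a \<Rightarrow> real) \<Rightarrow> real \<Rightarrow> real \<Rightarrow> 'a \<Rightarrow> real" where
  "qv H s t \<omega> = enn2real (\<integral>\<^sup>+r\<in>{s<..t}. ennreal ((H r \<omega>)\<^sup>2) \<partial>lborel)"

lemma qv_measurable[measurable]:
  assumes H: "progressively_measurable F H" and st: "0 \<le> s" "s \<le> t"
  shows "qv H s t \<in> borel_measurable M"
proof -
  define h where "h p = (if fst p \<in> {0..t} then H (fst p) (snd p) else 0)" for p
  have [measurable]: "h \<in> borel_measurable (lborel \<Otimes>\<^sub>M M)"
    unfolding h_def[abs_def] using progressively_measurable_joint[OF H] st by simp
  have "qv H s t = (\<lambda>\<omega>. enn2real (\<integral>\<^sup>+r. ennreal ((h (r, \<omega>))\<^sup>2) * indicator {s<..t} r \<partial>lborel))"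
    unfolding qv_def using st
    by (intro ext arg_cong[where f = enn2real] nn_integral_cong) (auto simp: h_def split: split_indicator)
  also have "\<dots> \<in> borel_measurable M"
    by (intro borel_measurable_enn2real lborel.borel_measurable_nn_integral) measurable
  finally show ?thesis .
qed

lemma ito_integral_measurable:
  "is_ito_integral M F B H I \<Longrightarrow> 0 \<le> t \<Longrightarrow> I t \<in> borel_measurable M"
  using measurable_F_M by (auto simp: is_ito_integral_def adapted_def)

text \<open>Converts the convergences in probability of the definition into almost sure ones along a
  common choice of indices. The bound \<open>s \<le> c k 0\<close> records that the integrands start
  no earlier than \<open>s\<close>, so that factors known at time \<open>s\<close> can be tested
  against the sums.\<close>

lemma ito_step_approximation:
  assumes ito: "is_ito_integral M F B H I" and st: "0 \<le> s" "s \<le> t"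
  obtains n :: "nat \<Rightarrow> nat" and c :: "nat \<Rightarrow> nat \<Rightarrow> real" and \<eta> :: "nat \<Rightarrow> nat \<Rightarrow> 'a \<Rightarrow> real" where
    "\<And>k. step_integrand (c k) (\<eta> k)" "\<And>k. s \<le> c k 0"
    "AE \<omega> in M. (\<lambda>k. step_sum (c k) (\<eta> k) (n k) \<omega>) \<longlonglongrightarrow> I t \<omega> - I s \<omega>"
    "AE \<omega> in M. (\<lambda>k. step_qv (c k) (\<eta> k) (n k) \<omega>) \<longlonglongrightarrow> qv H s t \<omega>"
proof -
  have t: "0 \<le> t" using st by simp
  have H: "progressively_measurable F H"
    and fin: "AE \<omega> in M. \<forall>T\<ge>0. (\<integral>\<^sup>+r\<in>{0..T}. ennreal ((H r \<omega>)\<^sup>2) \<partial>lborel) < \<infinity>"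
    using ito by (auto simp: is_ito_integral_def)
  obtain n \<tau> \<xi> where approx: "\<forall>k. simple_process M F (n k) (\<tau> k) (\<xi> k)"
    "\<forall>T\<ge>0. vanishes_in_probability M (\<lambda>k \<omega>.
        \<integral>\<^sup>+r\<in>{0..T}. ennreal ((simple_value (n k) (\<tau> k) (\<xi> k) r \<omega> - H r \<omega>)\<^sup>2) \<partial>lborel)"
    "\<forall>T\<ge>0. vanishes_in_probability M (\<lambda>k \<omega>.
        ennreal \<bar>simple_ito B (n k) (\<tau> k) (\<xi> k) T \<omega> - I T \<omega>\<bar>)"
    using ito unfolding is_ito_integral_def by blast
  note simple = approx(1)[rule_format] and L2 = approx(2)[rule_format] and conv = approx(3)[rule_format]
  define h where "h p = (if fst p \<in> {0..t} then H (fst p) (snd p) else 0)" for p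
  define S where "S k p = simple_value (n k) (\<tau> k) (\<xi> k) (fst p) (snd p)" for k p
  have [measurable]: "h \<in> borel_measurable (lborel \<Otimes>\<^sub>M M)" "S k \<in> borel_measurable (lborel \<Otimes>\<^sub>M M)" for k
    unfolding h_def[abs_def] S_def[abs_def]
    using progressively_measurable_joint[OF H] simple_value_joint_measurable[OF simple] t by auto
  define Z1 where "Z1 k \<omega> = (\<integral>\<^sup>+r\<in>{0..t}. ennreal ((simple_value (n k) (\<tau> k) (\<xi> k) r \<omega> - H r \<omega>)\<^sup>2) \<partial>lborel)" for k \<omega>
  define Z2 where "Z2 k \<omega> = ennreal \<bar>simple_ito B (n k) (\<tau> k) (\<xi> k) t \<omega> - I t \<omega>\<bar>" for k \<omega>
  define Z3 where "Z3 k \<omega> = ennreal \<bar>simple_ito B (n k) (\<tau> k) (\<xi> k) s \<omega> - I s \<omega>\<bar>" for k \<omega>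
  have Z1[measurable]: "Z1 k \<in> borel_measurable M" for k
  proof -
    have "Z1 k = (\<lambda>\<omega>. \<integral>\<^sup>+r. ennreal ((S k (r, \<omega>) - h (r, \<omega>))\<^sup>2) * indicator {0..t} r \<partial>lborel)"
      unfolding Z1_def[abs_def]
      by (intro ext nn_integral_cong) (auto simp: h_def S_def split: split_indicator)
    also have "\<dots> \<in> borel_measurable M"
      by (intro lborel.borel_measurable_nn_integral) measurable
    finally show ?thesis .
  qed
  have Z23[measurable]: "Z2 k \<in> borel_measurable M" "Z3 k \<in> borel_measurable M" for k
    unfolding Z2_def[abs_def] Z3_def[abs_def]
    using simple_ito_measurable[OF simple] ito_integral_measurable[OF ito] st t by measurable
  \<comment> \<open>The three errors are added so that a single choice of indices serves the
    integrands and both endpoints of the integral.\<close>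
  have "vanishes_in_probability M (\<lambda>k \<omega>. Z1 k \<omega> + Z2 k \<omega> + Z3 k \<omega>)"
    by (intro vanishes_in_probability_add borel_measurable_add Z1 Z23)
       (use L2[OF t] conv[OF t] conv[OF st(1)] in \<open>simp_all add: Z1_def[abs_def] Z2_def[abs_def] Z3_def[abs_def]\<close>)
  then obtain r where r: "AE \<omega> in M. (\<lambda>j. Z1 (r j) \<omega> + Z2 (r j) \<omega> + Z3 (r j) \<omega>) \<longlonglongrightarrow> 0"
    by (rule vanishes_in_probability_AE_subseq[rotated]) auto
  have Z0: "AE \<omega> in M. (\<lambda>j. Z1 (r j) \<omega>) \<longlonglongrightarrow> 0 \<and> (\<lambda>j. Z2 (r j) \<omega>) \<longlonglongrightarrow> 0 \<and> (\<lambda>j. Z3 (r j) \<omega>) \<longlonglongrightarrow> 0"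
    using r
  proof eventually_elim
    case (elim \<omega>)
    show ?case
      by (intro conjI; rule tendsto_sandwich[OF _ _ tendsto_const elim])
         (auto intro!: always_eventually simp: add_increasing add_increasing2 add.assoc)
  qed
  have lim: "(\<lambda>j. f j) \<longlonglongrightarrow> L" if "(\<lambda>j. ennreal \<bar>f j - L\<bar>) \<longlonglongrightarrow> 0" for f :: "nat \<Rightarrow> real" and L
  proof -
    have "(\<lambda>j. \<bar>f j - L\<bar>) \<longlonglongrightarrow> 0"
      using tendsto_enn2real[of "\<lambda>j. ennreal \<bar>f j - L\<bar>" 0] that by simp
    then show ?thesis by (simp add: tendsto_rabs_zero_iff LIM_zero_iff)
  qed
  let ?c = "\<lambda>k. clip_time (n k) (\<tau> k) s t" and ?\<eta> = "\<lambda>k. clip_value (n k) (\<tau> k) (\<xi> k) s t"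
  show ?thesis
  proof (rule that[of "\<lambda>j. ?c (r j)" "\<lambda>j. ?\<eta> (r j)" "\<lambda>j. n (r j)"])
    show "step_integrand (?c (r j)) (?\<eta> (r j))" for j by (rule step_integrand_clip[OF simple st])
    show "s \<le> ?c (r j) 0" for j by (rule clip_time_ge[OF simple st])
    show "AE \<omega> in M. (\<lambda>j. step_sum (?c (r j)) (?\<eta> (r j)) (n (r j)) \<omega>) \<longlonglongrightarrow> I t \<omega> - I s \<omega>"
      using Z0
    proof eventually_elim
      case (elim \<omega>)
      then show ?case
        unfolding step_sum_clip[OF simple st] Z2_def Z3_def by (intro tendsto_diff lim) auto
    qed
    show "AE \<omega> in M. (\<lambda>j. step_qv (?c (r j)) (?\<eta> (r j)) (n (r j)) \<omega>) \<longlonglongrightarrow> qv H s t \<omega>"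
      using Z0 fin AE_space
    proof eventually_elim
      case (elim \<omega>)
      \<comment> \<open>Both paths are cut to (s, t], so that their square integrals are the
        quadratic variations over exactly this interval.\<close>
      define g where "g x = indicator {s<..t} x * h (x, \<omega>)" for x
      define f where "f j x = indicator {s<..t} x * S (r j) (x, \<omega>)" for j x
      have [measurable]: "g \<in> borel_measurable lborel" "f j \<in> borel_measurable lborel" for j
        unfolding g_def[abs_def] f_def[abs_def] using elim(3) by measurable
      have g2: "ennreal ((g x)\<^sup>2) = ennreal ((H x \<omega>)\<^sup>2) * indicator {s<..t} x" for x
        using st by (auto simp: g_def h_def split: split_indicator)
      have "(\<lambda>j. enn2real (\<integral>\<^sup>+x. ennreal ((f j x)\<^sup>2) \<partial>lborel)) \<longlonglongrightarrow>
          enn2real (\<integral>\<^sup>+x. ennreal ((g x)\<^sup>2) \<partial>lborel)"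
      proof (rule tendsto_nn_integral_square)
        have "(\<integral>\<^sup>+x. ennreal ((g x)\<^sup>2) \<partial>lborel) \<le> (\<integral>\<^sup>+x\<in>{0..t}. ennreal ((H x \<omega>)\<^sup>2) \<partial>lborel)"
          unfolding g2 using st by (intro nn_integral_mono) (auto split: split_indicator)
        also have "\<dots> < \<infinity>" using elim(2) t by auto
        finally show "(\<integral>\<^sup>+x. ennreal ((g x)\<^sup>2) \<partial>lborel) < \<infinity>" .
        have le: "(\<integral>\<^sup>+x. ennreal ((f j x - g x)\<^sup>2) \<partial>lborel) \<le> Z1 (r j) \<omega>" for j
          unfolding Z1_def using st
          by (intro nn_integral_mono) (auto simp: f_def g_def h_def S_def split: split_indicator)
        have lim1: "(\<lambda>j. Z1 (r j) \<omega>) \<longlonglongrightarrow> 0" using elim(1) by simp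
        show "(\<lambda>j. \<integral>\<^sup>+x. ennreal ((f j x - g x)\<^sup>2) \<partial>lborel) \<longlonglongrightarrow> 0"
          by (rule tendsto_sandwich[OF _ _ tendsto_const lim1]) (use le in \<open>auto intro!: always_eventually\<close>)
      qed auto
      moreover have "(\<integral>\<^sup>+x. ennreal ((f j x)\<^sup>2) \<partial>lborel) =
          ennreal (step_qv (?c (r j)) (?\<eta> (r j)) (n (r j)) \<omega>)" for j
        unfolding f_def S_def fst_conv snd_conv by (rule step_qv_clip[OF simple st])
      ultimately show ?case
        unfolding g2 qv_def
        using step_qv_nonneg[OF step_integrand_clip[OF simple st]] by simp
    qed
  qed
qed

lemma ito_exponential_supermartingale:
  assumes ito: "is_ito_integral M F B H I" and st: "0 \<le> s" "s \<le> t"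
  shows "(\<integral>\<^sup>+\<omega>. ennreal (exp (\<theta> * (I t \<omega> - I s \<omega>) - \<theta>\<^sup>2 / 2 * qv H s t \<omega>)) \<partial>M) \<le> 1"
proof -
  obtain n c \<eta> where *: "\<And>k. step_integrand (c k) (\<eta> k)" "\<And>k. s \<le> c k 0"
    "AE \<omega> in M. (\<lambda>k. step_sum (c k) (\<eta> k) (n k) \<omega>) \<longlonglongrightarrow> I t \<omega> - I s \<omega>"
    "AE \<omega> in M. (\<lambda>k. step_qv (c k) (\<eta> k) (n k) \<omega>) \<longlonglongrightarrow> qv H s t \<omega>"
    by (rule ito_step_approximation[OF ito st]) blast
  let ?f = "\<lambda>k \<omega>. ennreal (exp (\<theta> * step_sum (c k) (\<eta> k) (n k) \<omega> - \<theta>\<^sup>2 / 2 * step_qv (c k) (\<eta> k) (n k) \<omega>))"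
  note [measurable] = step_sum_measurable_M[OF *(1)] step_qv_measurable_M[OF *(1)]
  have "(\<integral>\<^sup>+\<omega>. ennreal (exp (\<theta> * (I t \<omega> - I s \<omega>) - \<theta>\<^sup>2 / 2 * qv H s t \<omega>)) \<partial>M) =
      (\<integral>\<^sup>+\<omega>. liminf (\<lambda>k. ?f k \<omega>) \<partial>M)"
  proof (rule nn_integral_cong_AE, use *(3,4) in eventually_elim)
    case (elim \<omega>)
    have "(\<lambda>k. ?f k \<omega>) \<longlonglongrightarrow> ennreal (exp (\<theta> * (I t \<omega> - I s \<omega>) - \<theta>\<^sup>2 / 2 * qv H s t \<omega>))"
      by (intro tendsto_intros elim)
    then show ?case by (rule lim_imp_Liminf[OF sequentially_bot, symmetric])
  qed
  also have "\<dots> \<le> liminf (\<lambda>k. \<integral>\<^sup>+\<omega>. ?f k \<omega> \<partial>M)"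
    by (rule nn_integral_liminf) measurable
  also have "\<dots> = 1"
    unfolding step_sum_exponential[OF *(1)] by (simp add: Liminf_const)
  finally show ?thesis .
qed

text \<open>Almost sure convergence alone does not carry moments to the limit. Truncating the N-th
  approximation at quadratic variation N + 1 changes nothing outside an event of probability
  o(N^(-2)), and bounds its fourth moment by a multiple of (N + 1)^2; then mean differences vanish
  and second moments converge. Square integrability of the increment and of its quadratic variation
  is an assumption here and is later drawn from the equation.\<close>

lemma ito_martingale_isometry:
  assumes ito: "is_ito_integral M F B H I" and st: "0 \<le> s" "s \<le> t"
    and D2: "integrable M (\<lambda>\<omega>. (I t \<omega> - I s \<omega>)\<^sup>2)"
    and Q2: "integrable M (\<lambda>\<omega>. (qv H s t \<omega>)\<^sup>2)"
  shows "expectation (\<lambda>\<omega>. (I t \<omega> - I s \<omega>)\<^sup>2) = expectation (qv H s t)" (is ?isometry)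
    and "\<And>(Z :: 'a \<Rightarrow> real) K. Z \<in> borel_measurable (F s) \<Longrightarrow> (\<And>\<omega>. \<omega> \<in> space M \<Longrightarrow> \<bar>Z \<omega>\<bar> \<le> K) \<Longrightarrow>
      expectation (\<lambda>\<omega>. Z \<omega> * (I t \<omega> - I s \<omega>)) = 0" (is "PROP ?martingale")
proof -
  have H: "progressively_measurable F H"
    using ito by (auto simp: is_ito_integral_def)
  define D where "D \<omega> = I t \<omega> - I s \<omega>" for \<omega>
  define Q where "Q = qv H s t"
  have [measurable]: "D \<in> borel_measurable M" "Q \<in> borel_measurable M"
    using ito_integral_measurable[OF ito] qv_measurable[OF H st] st by (auto simp: D_def[abs_def] Q_def)
  have Q0: "Q \<omega> \<ge> 0" for \<omega> by (simp add: Q_def qv_def)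
  have Qint: "integrable M Q"
    by (rule square_integrable_imp_integrable) (use Q2 in \<open>simp_all add: Q_def[symmetric]\<close>)
  obtain n c \<eta> where *: "\<And>k. step_integrand (c k) (\<eta> k)" "\<And>k. s \<le> c k 0"
    "AE \<omega> in M. (\<lambda>k. step_sum (c k) (\<eta> k) (n k) \<omega>) \<longlonglongrightarrow> D \<omega>"
    "AE \<omega> in M. (\<lambda>k. step_qv (c k) (\<eta> k) (n k) \<omega>) \<longlonglongrightarrow> Q \<omega>"
    unfolding D_def Q_def by (rule ito_step_approximation[OF ito st]) blast
  define S where "S k = step_sum (c k) (\<eta> k) (n k)" for k
  define V where "V k = step_qv (c k) (\<eta> k) (n k)" for k
  have [measurable]: "S k \<in> borel_measurable M" "V k \<in> borel_measurable M" for k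
    unfolding S_def V_def by (rule step_sum_measurable_M[OF *(1)] step_qv_measurable_M[OF *(1)])+
  have conv: "AE \<omega> in M. (\<lambda>k. S k \<omega>) \<longlonglongrightarrow> D \<omega>" "AE \<omega> in M. (\<lambda>k. V k \<omega>) \<longlonglongrightarrow> Q \<omega>"
    using *(3,4) by (simp_all add: S_def V_def)
  \<comment> \<open>Tolerance for the approximation and, cubed, for the probability of missing it:
    (N + 1)^2 times \<open>\<delta> N ^ 3\<close> is \<open>\<delta> N\<close> and still tends to
    0.\<close>
  define \<delta> where "\<delta> N = 1 / real (Suc N)" for N
  have \<delta>: "\<delta> N > 0" "\<delta> N \<le> 1" for N by (auto simp: \<delta>_def)
  have ex: "\<forall>N. \<exists>k. prob {\<omega> \<in> space M. \<bar>S k \<omega> - D \<omega>\<bar> > \<delta> N} < \<delta> N ^ 3 \<and>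
      prob {\<omega> \<in> space M. \<bar>V k \<omega> - Q \<omega>\<bar> > \<delta> N} < \<delta> N ^ 3"
  proof
    fix N
    have "(\<lambda>k. prob {\<omega> \<in> space M. \<bar>S k \<omega> - D \<omega>\<bar> > \<delta> N}) \<longlonglongrightarrow> 0"
      "(\<lambda>k. prob {\<omega> \<in> space M. \<bar>V k \<omega> - Q \<omega>\<bar> > \<delta> N}) \<longlonglongrightarrow> 0"
      by (rule AE_tendsto_imp_tendsto_prob; (measurable; fail | rule conv \<delta>))+
    then have "\<forall>\<^sub>F k in sequentially. prob {\<omega> \<in> space M. \<bar>S k \<omega> - D \<omega>\<bar> > \<delta> N} < \<delta> N ^ 3 \<and>
      prob {\<omega> \<in> space M. \<bar>V k \<omega> - Q \<omega>\<bar> > \<delta> N} < \<delta> N ^ 3"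
      using \<delta>[of N] by (intro eventually_conj order_tendstoD(2)) auto
    then show "\<exists>k. prob {\<omega> \<in> space M. \<bar>S k \<omega> - D \<omega>\<bar> > \<delta> N} < \<delta> N ^ 3 \<and>
      prob {\<omega> \<in> space M. \<bar>V k \<omega> - Q \<omega>\<bar> > \<delta> N} < \<delta> N ^ 3"
      by (rule eventually_happens'[OF sequentially_bot])
  qed
  obtain k where k': "\<forall>N. prob {\<omega> \<in> space M. \<bar>S (k N) \<omega> - D \<omega>\<bar> > \<delta> N} < \<delta> N ^ 3 \<and>
      prob {\<omega> \<in> space M. \<bar>V (k N) \<omega> - Q \<omega>\<bar> > \<delta> N} < \<delta> N ^ 3"
    using choice[OF ex] by blast
  note k = k'[rule_format, THEN conjunct1] k'[rule_format, THEN conjunct2]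
  \<comment> \<open>The level exceeds the bound \<open>real N\<close> for \<open>Q\<close> outside
    \<open>bad\<close> by 1, which leaves room for the error \<open>\<delta> N \<le> 1\<close> of
    the quadratic variation; hence nothing is cut there.\<close>
  define \<zeta> where "\<zeta> N = truncate (c (k N)) (\<eta> (k N)) (real (Suc N))" for N
  define Y where "Y N = step_sum (c (k N)) (\<zeta> N) (n (k N))" for N
  define W where "W N = step_qv (c (k N)) (\<zeta> N) (n (k N))" for N
  have step: "step_integrand (c (k N)) (\<zeta> N)" for N
    unfolding \<zeta>_def by (rule step_integrand_truncate[OF *(1)])
  have [measurable]: "Y N \<in> borel_measurable M" "W N \<in> borel_measurable M" for N
    unfolding Y_def W_def by (rule step_sum_measurable_M[OF step] step_qv_measurable_M[OF step])+
  have W: "0 \<le> W N \<omega>" "W N \<omega> \<le> real (Suc N)" for N \<omega>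
    unfolding W_def \<zeta>_def
    by (rule step_qv_nonneg[OF step_integrand_truncate[OF *(1)]])
       (rule step_qv_truncate_le[OF *(1)], simp)
  define bad where "bad N = {\<omega> \<in> space M. \<bar>S (k N) \<omega> - D \<omega>\<bar> > \<delta> N} \<union>
    {\<omega> \<in> space M. \<bar>V (k N) \<omega> - Q \<omega>\<bar> > \<delta> N} \<union> {\<omega> \<in> space M. Q \<omega> > real N}" for N
  have bad_meas[measurable]: "bad N \<in> sets M" for N by (auto simp: bad_def)
  have good: "\<bar>Y N \<omega> - D \<omega>\<bar> \<le> \<delta> N" "\<bar>W N \<omega> - Q \<omega>\<bar> \<le> \<delta> N" if "\<omega> \<in> space M - bad N" for N \<omega>
  proof -
    have 1: "\<bar>S (k N) \<omega> - D \<omega>\<bar> \<le> \<delta> N" "\<bar>V (k N) \<omega> - Q \<omega>\<bar> \<le> \<delta> N" "Q \<omega> \<le> real N"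
      using that by (auto simp: bad_def)
    have "V (k N) \<omega> \<le> real (Suc N)" using 1 \<delta>(2)[of N] by simp
    then have "Y N \<omega> = S (k N) \<omega>" "W N \<omega> = V (k N) \<omega>"
      unfolding Y_def W_def \<zeta>_def S_def V_def by (simp_all only: truncate_eq[OF *(1)])
    then show "\<bar>Y N \<omega> - D \<omega>\<bar> \<le> \<delta> N" "\<bar>W N \<omega> - Q \<omega>\<bar> \<le> \<delta> N" using 1 by auto
  qed
  have inv0: "\<delta> \<longlonglongrightarrow> 0"
    unfolding \<delta>_def[abs_def] using LIMSEQ_inverse_real_of_nat by (simp add: inverse_eq_divide)
  have bi: "integrable M (indicator A :: 'a \<Rightarrow> real)" if "A \<in> sets M" for A
    by (rule integrable_const_bound[where B = 1]) (use that in auto)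
  \<comment> \<open>Markov's inequality for the full second moment would only bound this product;
    restricted to the event \<open>Q > N\<close>, the expectation of \<open>(Q + 1)\<^sup>2\<close>
    tends to 0.\<close>
  have tail: "(\<lambda>N. (real (Suc N))\<^sup>2 * prob {\<omega> \<in> space M. Q \<omega> > real N}) \<longlonglongrightarrow> 0"
  proof -
    let ?g = "\<lambda>N \<omega>. (Q \<omega> + 1)\<^sup>2 * indicator {\<omega> \<in> space M. Q \<omega> > real N} \<omega>"
    have int: "integrable M (\<lambda>\<omega>. (Q \<omega> + 1)\<^sup>2)"
      using Q2 Qint by (simp add: power2_sum Q_def)
    have g: "(\<lambda>N. expectation (?g N)) \<longlonglongrightarrow> expectation (\<lambda>\<omega>. 0)"
    proof (rule integral_dominated_convergence[OF _ _ int])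
      show "AE \<omega> in M. (\<lambda>N. ?g N \<omega>) \<longlonglongrightarrow> 0"
      proof (intro AE_I2 tendsto_eventually)
        fix \<omega>
        obtain m where m: "Q \<omega> \<le> real m" using real_arch_simple by blast
        show "\<forall>\<^sub>F N in sequentially. ?g N \<omega> = 0"
          using eventually_ge_at_top[of m] by eventually_elim (use m in \<open>auto split: split_indicator\<close>)
      qed
    qed (auto split: split_indicator)
    have le: "(real (Suc N))\<^sup>2 * prob {\<omega> \<in> space M. Q \<omega> > real N} \<le> expectation (?g N)" for N
    proof -
      have "(real (Suc N))\<^sup>2 * prob {\<omega> \<in> space M. Q \<omega> > real N} =
          expectation (\<lambda>\<omega>. (real (Suc N))\<^sup>2 * indicator {\<omega> \<in> space M. Q \<omega> > real N} \<omega>)"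
        using bi by (simp del: of_nat_Suc)
      also have "\<dots> \<le> expectation (?g N)"
        using bi integrable_real_mult_indicator[OF _ int]
        by (intro integral_mono) (auto split: split_indicator intro!: power_mono)
      finally show ?thesis .
    qed
    have g0: "(\<lambda>N. expectation (?g N)) \<longlonglongrightarrow> 0" using g by simp
    show ?thesis
      by (rule Lim_null_comparison[OF _ g0]) (use le in \<open>simp add: abs_mult del: of_nat_Suc\<close>)
  qed
  have bad: "(\<lambda>N. (real (Suc N))\<^sup>2 * prob (bad N)) \<longlonglongrightarrow> 0"
  proof -
    have le: "(real (Suc N))\<^sup>2 * prob (bad N) \<le>
        2 * \<delta> N + (real (Suc N))\<^sup>2 * prob {\<omega> \<in> space M. Q \<omega> > real N}" for N
    proof -
      have "prob (bad N) \<le> prob ({\<omega> \<in> space M. \<bar>S (k N) \<omega> - D \<omega>\<bar> > \<delta> N} \<union>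
          {\<omega> \<in> space M. \<bar>V (k N) \<omega> - Q \<omega>\<bar> > \<delta> N}) + prob {\<omega> \<in> space M. Q \<omega> > real N}"
        unfolding bad_def by (rule measure_Un_le) auto
      also have "\<dots> \<le> prob {\<omega> \<in> space M. \<bar>S (k N) \<omega> - D \<omega>\<bar> > \<delta> N} +
          prob {\<omega> \<in> space M. \<bar>V (k N) \<omega> - Q \<omega>\<bar> > \<delta> N} + prob {\<omega> \<in> space M. Q \<omega> > real N}"
        by (intro add_right_mono measure_Un_le) auto
      also have "\<dots> \<le> 2 * \<delta> N ^ 3 + prob {\<omega> \<in> space M. Q \<omega> > real N}"
        using k(1,2)[of N] by simp
      finally have "(real (Suc N))\<^sup>2 * prob (bad N) \<le>
          (real (Suc N))\<^sup>2 * (2 * \<delta> N ^ 3 + prob {\<omega> \<in> space M. Q \<omega> > real N})"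
        by (intro mult_left_mono) auto
      also have "\<dots> = 2 * \<delta> N + (real (Suc N))\<^sup>2 * prob {\<omega> \<in> space M. Q \<omega> > real N}"
        by (simp add: \<delta>_def distrib_left power2_eq_square power3_eq_cube del: of_nat_Suc)
      finally show ?thesis .
    qed
    have lim: "(\<lambda>N. 2 * \<delta> N + (real (Suc N))\<^sup>2 * prob {\<omega> \<in> space M. Q \<omega> > real N}) \<longlonglongrightarrow> 0"
      using tendsto_add[OF tendsto_mult_left[OF inv0, of 2] tail] by simp
    show ?thesis
      by (rule Lim_null_comparison[OF _ lim]) (use le in \<open>simp add: abs_mult del: of_nat_Suc\<close>)
  qed
  have bad1: "(\<lambda>N. real (Suc N) * prob (bad N)) \<longlonglongrightarrow> 0"
  proof (rule Lim_null_comparison[OF _ bad])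
    show "\<forall>\<^sub>F N in sequentially. norm (real (Suc N) * prob (bad N)) \<le> (real (Suc N))\<^sup>2 * prob (bad N)"
      unfolding power2_eq_square real_norm_def abs_mult
      by (intro always_eventually allI mult_mono) (auto simp: algebra_simps)
  qed
  have Y4: "(\<integral>\<^sup>+\<omega>. ennreal (Y N \<omega> ^ 4) \<partial>M) \<le> ennreal (96 * (real (Suc N))\<^sup>2)" for N
    unfolding Y_def by (rule step_sum_fourth_moment[OF step]) (use W(2) in \<open>simp_all add: W_def\<close>)
  note YD = tendsto_L2_outside_bad_sets[of Y D bad, OF _ _ _ _ Y4 _ good(1)[unfolded \<delta>_def] bad]
  have YD1: "integrable M (\<lambda>\<omega>. (Y N \<omega>)\<^sup>2)" "(\<lambda>N. expectation (\<lambda>\<omega>. \<bar>Y N \<omega> - D \<omega>\<bar>)) \<longlonglongrightarrow> 0"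
    "(\<lambda>N. expectation (\<lambda>\<omega>. (Y N \<omega>)\<^sup>2)) \<longlonglongrightarrow> expectation (\<lambda>\<omega>. (D \<omega>)\<^sup>2)" for N
    by (rule YD; use D2 in \<open>simp add: D_def[symmetric]\<close>)+
  have YW: "expectation (\<lambda>\<omega>. (Y N \<omega>)\<^sup>2) = expectation (W N)" "integrable M (W N)" for N
    using step_sum_isometry[OF step] by (auto simp: Y_def W_def)
  \<comment> \<open>On the bad sets the truncation level replaces any convergence:
    \<open>W N\<close> is at most N + 1, and this times \<open>prob (bad N)\<close>
    vanishes.\<close>
  have "(\<lambda>N. expectation (W N) - expectation Q) \<longlonglongrightarrow> 0"
  proof (rule Lim_null_comparison)
    let ?e = "\<lambda>N. \<delta> N + real (Suc N) * prob (bad N) + expectation (\<lambda>\<omega>. Q \<omega> * indicator (bad N) \<omega>)"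
    have "(\<lambda>N. expectation (\<lambda>\<omega>. Q \<omega> * indicator (bad N) \<omega>)) \<longlonglongrightarrow> 0"
      by (rule expectation_indicator_small[OF Qint Q0 bad_meas bad1])
    then show "?e \<longlonglongrightarrow> 0"
      using tendsto_add[OF tendsto_add[OF inv0 bad1]] by fastforce
    have "norm (expectation (W N) - expectation Q) \<le> ?e N" for N
    proof -
      have pt: "\<bar>W N \<omega> - Q \<omega>\<bar> \<le> \<delta> N + real (Suc N) * indicator (bad N) \<omega> + Q \<omega> * indicator (bad N) \<omega>"
        if "\<omega> \<in> space M" for \<omega>
      proof (cases "\<omega> \<in> bad N")
        case True
        then show ?thesis using W[of N \<omega>] Q0[of \<omega>] \<delta>(1)[of N] by (simp del: of_nat_Suc)
      qed (use good(2) that in auto)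
      have "norm (expectation (W N) - expectation Q) = \<bar>expectation (\<lambda>\<omega>. W N \<omega> - Q \<omega>)\<bar>"
        using YW Qint by simp
      also have "\<dots> \<le> expectation (\<lambda>\<omega>. \<bar>W N \<omega> - Q \<omega>\<bar>)" by (rule integral_abs_bound)
      also have "\<dots> \<le> expectation (\<lambda>\<omega>. \<delta> N + real (Suc N) * indicator (bad N) \<omega> + Q \<omega> * indicator (bad N) \<omega>)"
        using pt YW Qint bi integrable_real_mult_indicator[OF bad_meas Qint]
        by (intro integral_mono) (auto simp del: of_nat_Suc)
      also have "\<dots> = ?e N"
        using bi integrable_real_mult_indicator[OF bad_meas Qint] by (simp add: prob_space del: of_nat_Suc)
      finally show ?thesis .
    qed
    then show "\<forall>\<^sub>F N in sequentially. norm (expectation (W N) - expectation Q) \<le> ?e N" by simp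
  qed
  then have "(\<lambda>N. expectation (\<lambda>\<omega>. (Y N \<omega>)\<^sup>2)) \<longlonglongrightarrow> expectation Q"
    by (simp add: YW LIM_zero_iff)
  from LIMSEQ_unique[OF YD1(3) this] show ?isometry by (simp add: D_def Q_def)
  fix Z :: "'a \<Rightarrow> real" and K assume Z: "Z \<in> borel_measurable (F s)" and K: "\<And>\<omega>. \<omega> \<in> space M \<Longrightarrow> \<bar>Z \<omega>\<bar> \<le> K"
  have ZM[measurable]: "Z \<in> borel_measurable M" using measurable_F_M[OF Z st(1)] .
  have Dint: "integrable M D"
    by (rule square_integrable_imp_integrable) (use D2 in \<open>simp_all add: D_def[symmetric]\<close>)
  have Yint: "integrable M (Y N)" for N
    by (rule square_integrable_imp_integrable) (use YD1(1) in auto)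
  have ZD: "integrable M (\<lambda>\<omega>. Z \<omega> * D \<omega>)"
    by (rule Bochner_Integration.integrable_bound[of M "\<lambda>\<omega>. K * D \<omega>"])
       (use Dint K in \<open>auto simp: abs_mult intro!: mult_right_mono order_trans[OF K abs_ge_self]\<close>)
  have ZY: "integrable M (\<lambda>\<omega>. Z \<omega> * Y N \<omega>)" "expectation (\<lambda>\<omega>. Z \<omega> * Y N \<omega>) = 0" for N
  proof -
    have "Z \<in> borel_measurable (F (c (k N) 0))"
      by (rule measurable_F_mono[OF Z st(1) *(2)])
    from step_sum_martingale[OF step this K]
    show "integrable M (\<lambda>\<omega>. Z \<omega> * Y N \<omega>)" "expectation (\<lambda>\<omega>. Z \<omega> * Y N \<omega>) = 0"
      by (auto simp: Y_def)
  qed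
  \<comment> \<open>The truncated sums are exactly orthogonal to \<open>Z\<close>; against a bounded
    factor, convergence in mean carries this over to \<open>D\<close>.\<close>
  have le: "\<bar>expectation (\<lambda>\<omega>. Z \<omega> * D \<omega>)\<bar> \<le> K * expectation (\<lambda>\<omega>. \<bar>Y N \<omega> - D \<omega>\<bar>)" for N
  proof -
    have "\<bar>expectation (\<lambda>\<omega>. Z \<omega> * D \<omega>)\<bar> = \<bar>expectation (\<lambda>\<omega>. Z \<omega> * Y N \<omega> - Z \<omega> * D \<omega>)\<bar>"
      using ZY ZD by simp
    also have "\<dots> \<le> expectation (\<lambda>\<omega>. \<bar>Z \<omega> * Y N \<omega> - Z \<omega> * D \<omega>\<bar>)" by (rule integral_abs_bound)
    also have "\<dots> \<le> expectation (\<lambda>\<omega>. K * \<bar>Y N \<omega> - D \<omega>\<bar>)"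
    proof (rule integral_mono)
      fix \<omega> assume "\<omega> \<in> space M"
      then show "\<bar>Z \<omega> * Y N \<omega> - Z \<omega> * D \<omega>\<bar> \<le> K * \<bar>Y N \<omega> - D \<omega>\<bar>"
        using K by (simp add: abs_mult mult_right_mono flip: right_diff_distrib)
    qed (use ZY ZD Yint Dint in auto)
    finally show ?thesis by simp
  qed
  have "(\<lambda>N. K * expectation (\<lambda>\<omega>. \<bar>Y N \<omega> - D \<omega>\<bar>)) \<longlonglongrightarrow> K * 0"
    by (intro tendsto_intros YD1)
  then have "\<bar>expectation (\<lambda>\<omega>. Z \<omega> * D \<omega>)\<bar> \<le> K * 0"
    by (rule LIMSEQ_le_const) (use le in auto)
  then show "expectation (\<lambda>\<omega>. Z \<omega> * (I t \<omega> - I s \<omega>)) = 0" by (simp add: D_def)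
qed

text \<open>The factor is clipped to [-m, m] and dominated convergence applies with the sum of the
  two squares as majorant. The extension is needed because the later test variables, such as
  \<open>Y s\<close>, are unbounded.\<close>

lemma ito_martingale_L2:
  assumes ito: "is_ito_integral M F B H I" and st: "0 \<le> s" "s \<le> t"
    and D2: "integrable M (\<lambda>\<omega>. (I t \<omega> - I s \<omega>)\<^sup>2)"
    and Q2: "integrable M (\<lambda>\<omega>. (qv H s t \<omega>)\<^sup>2)"
    and Z: "Z \<in> borel_measurable (F s)" "integrable M (\<lambda>\<omega>. (Z \<omega>)\<^sup>2)"
  shows "expectation (\<lambda>\<omega>. Z \<omega> * (I t \<omega> - I s \<omega>)) = 0"
proof -
  define D where "D \<omega> = I t \<omega> - I s \<omega>" for \<omega>
  have [measurable]: "D \<in> borel_measurable M"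
    using ito_integral_measurable[OF ito] st by (auto simp: D_def[abs_def])
  have ZM[measurable]: "Z \<in> borel_measurable M" using measurable_F_M[OF Z(1) st(1)] .
  define C where "C m \<omega> = max (- real m) (min (real m) (Z \<omega>))" for m \<omega>
  have [measurable]: "C m \<in> borel_measurable M" for m by (simp add: C_def[abs_def])
  have C: "\<bar>C m \<omega>\<bar> \<le> \<bar>Z \<omega>\<bar>" "\<bar>C m \<omega>\<bar> \<le> real m" for m \<omega> by (auto simp: C_def)
  have "C m \<in> borel_measurable (F s)" for m
    unfolding C_def[abs_def] using Z(1) by measurable
  then have zero: "expectation (\<lambda>\<omega>. C m \<omega> * D \<omega>) = 0" for m
    unfolding D_def using ito_martingale_isometry(2)[OF ito st D2 Q2] C(2) by blast
  have "(\<lambda>m. expectation (\<lambda>\<omega>. C m \<omega> * D \<omega>)) \<longlonglongrightarrow> expectation (\<lambda>\<omega>. Z \<omega> * D \<omega>)"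
  proof (rule integral_dominated_convergence)
    show "integrable M (\<lambda>\<omega>. (Z \<omega>)\<^sup>2 + (D \<omega>)\<^sup>2)" using Z(2) D2 by (simp add: D_def)
    show "AE \<omega> in M. (\<lambda>m. C m \<omega> * D \<omega>) \<longlonglongrightarrow> Z \<omega> * D \<omega>"
    proof (intro AE_I2 tendsto_eventually)
      fix \<omega>
      obtain m where m: "\<bar>Z \<omega>\<bar> \<le> real m" using real_arch_simple by blast
      show "\<forall>\<^sub>F N in sequentially. C N \<omega> * D \<omega> = Z \<omega> * D \<omega>"
        using eventually_ge_at_top[of m] by eventually_elim (use m in \<open>auto simp: C_def\<close>)
    qed
    show "AE \<omega> in M. norm (C m \<omega> * D \<omega>) \<le> (Z \<omega>)\<^sup>2 + (D \<omega>)\<^sup>2" for m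
    proof (rule AE_I2)
      fix \<omega>
      have "\<bar>C m \<omega>\<bar> * \<bar>D \<omega>\<bar> \<le> \<bar>Z \<omega>\<bar> * \<bar>D \<omega>\<bar>" using C(1) by (intro mult_right_mono) auto
      moreover have "2 * (\<bar>Z \<omega>\<bar> * \<bar>D \<omega>\<bar>) \<le> (Z \<omega>)\<^sup>2 + (D \<omega>)\<^sup>2"
        using zero_le_power2[of "\<bar>Z \<omega>\<bar> - \<bar>D \<omega>\<bar>"] by (simp add: power2_diff)
      moreover have "0 \<le> \<bar>Z \<omega>\<bar> * \<bar>D \<omega>\<bar>" by simp
      ultimately have "\<bar>C m \<omega>\<bar> * \<bar>D \<omega>\<bar> \<le> (Z \<omega>)\<^sup>2 + (D \<omega>)\<^sup>2" by linarith
      then show "norm (C m \<omega> * D \<omega>) \<le> (Z \<omega>)\<^sup>2 + (D \<omega>)\<^sup>2" by (simp add: abs_mult)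
    qed
  qed auto
  then have "(\<lambda>m. 0) \<longlonglongrightarrow> expectation (\<lambda>\<omega>. Z \<omega> * D \<omega>)"
    by (simp only: zero)
  then have "expectation (\<lambda>\<omega>. Z \<omega> * D \<omega>) = 0"
    by (simp only: LIMSEQ_const_iff)
  then show ?thesis by (simp add: D_def)
qed

end

section \<open>Moments of the integrated intensity\<close>

lemma set_integral_exp:
  fixes c t :: real
  assumes "0 \<le> t"
  shows "set_integrable lborel {0..t} (\<lambda>r. exp (c * r))"
    "c * (LBINT r:{0..t}. exp (c * r)) = exp (c * t) - 1"
proof -
  show int: "set_integrable lborel {0..t} (\<lambda>r. exp (c * r))"
    by (rule borel_integrable_atLeastAtMost') (intro continuous_intros)
  have "(LBINT r. (c * exp (c * r)) * indicator {0..t} r) = exp (c * t) - exp (c * 0)"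
    using assms by (intro integral_FTC_Icc_real) (auto intro!: derivative_eq_intros continuous_intros)
  then show "c * (LBINT r:{0..t}. exp (c * r)) = exp (c * t) - 1"
    by (simp add: set_lebesgue_integral_def mult_ac flip: integral_mult_right_zero)
qed

lemma set_integral_singleton: "(LBINT r:{a}. f r) = 0" for f :: "real \<Rightarrow> real"
  unfolding set_lebesgue_integral_def
  by (rule integral_eq_zero_AE, rule eventually_mono[OF AE_lborel_singleton[of a]]) simp

lemma set_integral_split_Icc:
  fixes f :: "real \<Rightarrow> real"
  assumes "0 \<le> s" "s \<le> t" "set_integrable lborel {0..t} f"
  shows "(LBINT r:{0..t}. f r) = (LBINT r:{0..s}. f r) + (LBINT r:{s<..t}. f r)"
    "(LBINT r:{s<..t}. f r) = (LBINT r:{s..t}. f r)"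
proof -
  have "{0..t} = {0..s} \<union> {s<..t}" using assms by auto
  then show "(LBINT r:{0..t}. f r) = (LBINT r:{0..s}. f r) + (LBINT r:{s<..t}. f r)"
    using assms by (auto intro!: set_integral_Un intro: set_integrable_subset)
  have "AE x in lborel. x \<noteq> s" by (rule AE_lborel_singleton)
  then show "(LBINT r:{s<..t}. f r) = (LBINT r:{s..t}. f r)"
    unfolding set_lebesgue_integral_def
  proof (intro integral_cong_AE)
    have "set_integrable lborel {s<..t} f" "set_integrable lborel {s..t} f"
      using assms by (auto intro: set_integrable_subset)
    then show "(\<lambda>x. indicator {s<..t} x *\<^sub>R f x) \<in> borel_measurable lborel"
      "(\<lambda>x. indicator {s..t} x *\<^sub>R f x) \<in> borel_measurable lborel"
      by (auto simp: set_integrable_def)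
  qed (auto elim!: eventually_mono split: split_indicator)
qed

section \<open>Square-integrable random variables\<close>

context prob_space
begin

definition square_integrable :: "('a \<Rightarrow> real) \<Rightarrow> bool" where
  "square_integrable f \<longleftrightarrow> f \<in> borel_measurable M \<and> integrable M (\<lambda>\<omega>. (f \<omega>)\<^sup>2)"

lemma square_integrable_mult:
  assumes "square_integrable f" "square_integrable g"
  shows "integrable M (\<lambda>\<omega>. f \<omega> * g \<omega>)"
proof (rule Bochner_Integration.integrable_bound)
  show "integrable M (\<lambda>\<omega>. (f \<omega>)\<^sup>2 + (g \<omega>)\<^sup>2)"
    using assms by (auto simp: square_integrable_def)
  show "AE \<omega> in M. norm (f \<omega> * g \<omega>) \<le> norm ((f \<omega>)\<^sup>2 + (g \<omega>)\<^sup>2)"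
  proof (rule AE_I2)
    fix \<omega>
    have "2 * (\<bar>f \<omega>\<bar> * \<bar>g \<omega>\<bar>) \<le> (f \<omega>)\<^sup>2 + (g \<omega>)\<^sup>2"
      using zero_le_power2[of "\<bar>f \<omega>\<bar> - \<bar>g \<omega>\<bar>"] by (simp add: power2_diff)
    moreover have "0 \<le> \<bar>f \<omega>\<bar> * \<bar>g \<omega>\<bar>" by simp
    ultimately have "\<bar>f \<omega>\<bar> * \<bar>g \<omega>\<bar> \<le> (f \<omega>)\<^sup>2 + (g \<omega>)\<^sup>2" by linarith
    then show "norm (f \<omega> * g \<omega>) \<le> norm ((f \<omega>)\<^sup>2 + (g \<omega>)\<^sup>2)"
      by (simp add: abs_mult)
  qed
qed (use assms in \<open>auto simp: square_integrable_def\<close>)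

lemma square_integrable_const: "square_integrable (\<lambda>_. c)"
  by (simp add: square_integrable_def)

lemma square_integrable_cmult: "square_integrable f \<Longrightarrow> square_integrable (\<lambda>\<omega>. c * f \<omega>)"
  by (auto simp: square_integrable_def power_mult_distrib)

lemma square_integrable_add:
  assumes "square_integrable f" "square_integrable g"
  shows "square_integrable (\<lambda>\<omega>. f \<omega> + g \<omega>)"
  using square_integrable_mult[OF assms] assms
  by (auto simp: square_integrable_def power2_sum mult.assoc)

lemma square_integrable_diff:
  assumes "square_integrable f" "square_integrable g"
  shows "square_integrable (\<lambda>\<omega>. f \<omega> - g \<omega>)"
  using square_integrable_add[OF assms(1) square_integrable_cmult[OF assms(2), of "- 1"]] by simp

lemma square_integrable_integrable: "square_integrable f \<Longrightarrow> integrable M f"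
  using square_integrable_mult[OF _ square_integrable_const[of 1]] by simp

lemma square_integrable_cong_AE:
  assumes "square_integrable f" "g \<in> borel_measurable M" "AE \<omega> in M. f \<omega> = g \<omega>"
  shows "square_integrable g"
proof -
  have "integrable M (\<lambda>\<omega>. (f \<omega>)\<^sup>2) \<longleftrightarrow> integrable M (\<lambda>\<omega>. (g \<omega>)\<^sup>2)"
    using assms by (intro integrable_cong_AE) (auto simp: square_integrable_def)
  then show ?thesis using assms by (simp add: square_integrable_def)
qed

end

text \<open>The stationary law enters through its first two moments. \<open>X0_second\<close> states
  that \<open>X 0\<close> has variance \<open>q / (2 * \<kappa>)\<close>, with \<open>q\<close> as
  below, which is the equilibrium of the variance equation. The parameter \<open>I\<close> names the
  stochastic integral whose existence the equation asserts.\<close>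

locale cir = brownian M F B
  for M :: "'a measure" and F :: "real \<Rightarrow> 'a measure" and B :: "real \<Rightarrow> 'a \<Rightarrow> real" +
  fixes l \<kappa> \<sigma> \<alpha> :: real and X I :: "real \<Rightarrow> 'a \<Rightarrow> real"
  assumes pos: "l > 0" "\<kappa> > 0" "\<sigma> > 0"
    and X_nonneg: "AE \<omega> in M. \<forall>t\<ge>0. X t \<omega> \<ge> 0"
    and X_adapted: "adapted F X"
    and drift_integrable: "AE \<omega> in M. \<forall>t\<ge>0. set_integrable lborel {0..t} (\<lambda>r. \<kappa> * (l - X r \<omega>))"
    and ito: "is_ito_integral M F B (\<lambda>r \<omega>. \<sigma> * sqrt (l powr \<alpha> * X r \<omega>)) I"
    and sde: "AE \<omega> in M. \<forall>t\<ge>0. X t \<omega> = X 0 \<omega> + (LBINT r:{0..t}. \<kappa> * (l - X r \<omega>)) + I t \<omega>"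
    and X0_L2: "integrable M (\<lambda>\<omega>. (X 0 \<omega>)\<^sup>2)"
    and X0_mean: "expectation (X 0) = l"
    and X0_second: "expectation (\<lambda>\<omega>. (X 0 \<omega>)\<^sup>2) = l\<^sup>2 + \<sigma>\<^sup>2 * l powr (\<alpha> + 1) / (2 * \<kappa>)"
begin

section \<open>Pathwise relations between intensity, stochastic integral and quadratic
  variation\<close>

abbreviation H :: "real \<Rightarrow> 'a \<Rightarrow> real" where
  "H r \<omega> \<equiv> \<sigma> * sqrt (l powr \<alpha> * X r \<omega>)"

definition c :: real where "c = \<sigma>\<^sup>2 * l powr \<alpha>"

definition q :: real where "q = \<sigma>\<^sup>2 * l powr (\<alpha> + 1)"

definition Y :: "real \<Rightarrow> 'a \<Rightarrow> real" where "Y t \<omega> = X t \<omega> - l"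

definition Z :: "real \<Rightarrow> 'a \<Rightarrow> real" where "Z t \<omega> = (LBINT r:{0..t}. Y r \<omega>)"

lemma c_pos: "c > 0" using pos by (simp add: c_def)

lemma q_eq: "q = c * l" using pos by (simp add: q_def c_def powr_add)

lemma X_measurable: "0 \<le> t \<Longrightarrow> X t \<in> borel_measurable (F t)"
  using X_adapted by (simp add: adapted_def)

lemma Y_measurable: "0 \<le> t \<Longrightarrow> Y t \<in> borel_measurable (F t)"
  unfolding Y_def[abs_def] using X_measurable[of t] by measurable

lemma X_measurable_M: "0 \<le> t \<Longrightarrow> X t \<in> borel_measurable M"
  using measurable_F_M[OF X_measurable] by blast

lemma Y_measurable_M: "0 \<le> t \<Longrightarrow> Y t \<in> borel_measurable M"
  using measurable_F_M[OF Y_measurable] by blast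

lemma I_measurable_M: "0 \<le> t \<Longrightarrow> I t \<in> borel_measurable M"
  by (rule ito_integral_measurable[OF ito])

lemma H_progressive: "progressively_measurable F H"
  using ito by (simp add: is_ito_integral_def)

text \<open>Since \<^const>\<open>sqrt\<close> is odd, \<open>X\<close> is recovered from the diffusion coefficient even where it is
  negative.\<close>

lemma Y_joint_measurable:
  assumes "0 \<le> t"
  shows "(\<lambda>p. if fst p \<in> {0..t} then Y (fst p) (snd p) else 0) \<in> borel_measurable (lborel \<Otimes>\<^sub>M M)"
proof -
  define h where "h p = (if fst p \<in> {0..t} then H (fst p) (snd p) else 0)" for p
  have [measurable]: "h \<in> borel_measurable (lborel \<Otimes>\<^sub>M M)"
    unfolding h_def[abs_def] by (rule progressively_measurable_joint[OF H_progressive assms])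
  have "X r \<omega> = H r \<omega> * \<bar>H r \<omega>\<bar> / c" for r \<omega>
  proof -
    have "sqrt u * \<bar>sqrt u\<bar> = u" for u :: real
      by (cases "u \<ge> 0") (auto simp: real_sqrt_minus abs_if real_sqrt_mult_self)
    then have "H r \<omega> * \<bar>H r \<omega>\<bar> = \<sigma> * \<sigma> * (l powr \<alpha> * X r \<omega>)"
      using pos by (simp add: abs_mult mult_ac)
    then show ?thesis using pos by (simp add: c_def power2_eq_square)
  qed
  then have "(\<lambda>p. if fst p \<in> {0..t} then Y (fst p) (snd p) else 0) =
      (\<lambda>p. if fst p \<in> {0..t} then h p * \<bar>h p\<bar> / c - l else 0)"
    by (auto simp: h_def Y_def fun_eq_iff)
  also have "\<dots> \<in> borel_measurable (lborel \<Otimes>\<^sub>M M)"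
    by measurable
  finally show ?thesis .
qed

lemma Y_integrable: "AE \<omega> in M. \<forall>t\<ge>0. set_integrable lborel {0..t} (\<lambda>r. Y r \<omega>)"
  using drift_integrable
proof eventually_elim
  case (elim \<omega>)
  show ?case
  proof (intro allI impI)
    fix t :: real assume "0 \<le> t"
    then have "set_integrable lborel {0..t} (\<lambda>r. (- 1 / \<kappa>) * (\<kappa> * (l - X r \<omega>)))"
      using elim by (intro set_integrable_mult_right) auto
    then show "set_integrable lborel {0..t} (\<lambda>r. Y r \<omega>)"
      using pos by (simp add: Y_def algebra_simps)
  qed
qed

lemma Z_measurable_M:
  assumes "0 \<le> t" shows "Z t \<in> borel_measurable M"
proof -
  define h where "h p = (if fst p \<in> {0..t} then Y (fst p) (snd p) else 0)" for p
  have [measurable]: "h \<in> borel_measurable (lborel \<Otimes>\<^sub>M M)"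
    unfolding h_def[abs_def] by (rule Y_joint_measurable[OF assms])
  have "Z t = (\<lambda>\<omega>. LBINT r. h (r, \<omega>))"
    unfolding Z_def set_lebesgue_integral_def
    by (intro ext Bochner_Integration.integral_cong) (auto simp: h_def)
  also have "\<dots> \<in> borel_measurable M"
    by (intro lborel.borel_measurable_lebesgue_integral) measurable
  finally show ?thesis .
qed

lemma I_eq: "AE \<omega> in M. \<forall>t\<ge>0. I t \<omega> = Y t \<omega> - Y 0 \<omega> + \<kappa> * Z t \<omega>"
  using sde
proof eventually_elim
  case (elim \<omega>)
  show ?case
  proof (intro allI impI)
    fix t :: real assume t: "0 \<le> t"
    have "X t \<omega> = X 0 \<omega> + (LBINT r:{0..t}. \<kappa> * (l - X r \<omega>)) + I t \<omega>"
      by (rule elim[rule_format, OF t])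
    moreover have "(\<lambda>r. \<kappa> * (l - X r \<omega>)) = (\<lambda>r. (- \<kappa>) * Y r \<omega>)"
      by (simp add: fun_eq_iff Y_def algebra_simps)
    then have "(LBINT r:{0..t}. \<kappa> * (l - X r \<omega>)) = (- \<kappa>) * Z t \<omega>"
      by (simp only: set_integral_mult_right Z_def)
    ultimately show "I t \<omega> = Y t \<omega> - Y 0 \<omega> + \<kappa> * Z t \<omega>"
      by (simp add: Y_def)
  qed
qed

lemma I_eq_at: "0 \<le> t \<Longrightarrow> AE \<omega> in M. I t \<omega> = Y t \<omega> - Y 0 \<omega> + \<kappa> * Z t \<omega>"
  using I_eq by (auto elim!: eventually_mono)

lemma I_0: "AE \<omega> in M. I 0 \<omega> = 0"
  using sde
proof eventually_elim
  case (elim \<omega>)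
  have "(LBINT r:{0..0}. \<kappa> * (l - X r \<omega>)) = 0"
    by (simp add: set_integral_singleton)
  with elim[rule_format, OF order_refl] show ?case by linarith
qed

text \<open>\<open>Z t + l * t\<close> is the integrated intensity, so its sign is that of
  \<open>X\<close>.\<close>

lemma Z_bound: "AE \<omega> in M. \<forall>t\<ge>0. 0 \<le> Z t \<omega> + l * t"
  using X_nonneg Y_integrable
proof eventually_elim
  case (elim \<omega>)
  show ?case
  proof (intro allI impI)
    fix t :: real assume t: "0 \<le> t"
    then have int: "set_integrable lborel {0..t} (\<lambda>r. Y r \<omega>)" using elim by auto
    have cst: "set_integrable lborel {0..t} (\<lambda>r. l)" "(LBINT r:{0..t}. l) = l * t"
      using t by (auto simp: set_integrable_def set_lebesgue_integral_def)
    have "0 \<le> (LBINT r:{0..t}. Y r \<omega> + l)"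
      unfolding set_lebesgue_integral_def using elim(1)
      by (intro integral_nonneg_AE AE_I2) (auto simp: Y_def split: split_indicator)
    also have "\<dots> = Z t \<omega> + l * t"
      using set_integral_add(2)[OF int cst(1)] cst(2) by (simp add: Z_def)
    finally show "0 \<le> Z t \<omega> + l * t" .
  qed
qed

text \<open>Nonnegativity of \<open>X\<close> turns the squared square root into \<open>c\<close>
  times \<open>X\<close>; one exceptional null set serves all pairs of times.\<close>

lemma qv_eq: "AE \<omega> in M. \<forall>s t. 0 \<le> s \<and> s \<le> t \<longrightarrow> qv H s t \<omega> = c * (Z t \<omega> - Z s \<omega> + l * (t - s))"
  using X_nonneg Y_integrable
proof eventually_elim
  case (elim \<omega>)
  show ?case
  proof (intro allI impI)
    fix s t :: real assume st: "0 \<le> s \<and> s \<le> t"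
    then have int: "set_integrable lborel {0..t} (\<lambda>r. Y r \<omega>)" using elim by auto
    have int': "set_integrable lborel {s<..t} (\<lambda>r. Y r \<omega>)"
      by (rule set_integrable_subset[OF int]) (use st in auto)
    have cst: "set_integrable lborel {s<..t} (\<lambda>r. l)" "(LBINT r:{s<..t}. l) = l * (t - s)"
      using st by (auto simp: set_integrable_def set_lebesgue_integral_def)
    note YI = set_integral_add[OF int' cst(1)]
    have "(\<integral>\<^sup>+r\<in>{s<..t}. ennreal ((H r \<omega>)\<^sup>2) \<partial>lborel) =
        (\<integral>\<^sup>+r. ennreal (c * (indicator {s<..t} r *\<^sub>R (Y r \<omega> + l))) \<partial>lborel)"
    proof (rule nn_integral_cong)
      fix r :: real
      have "(H r \<omega>)\<^sup>2 = c * (Y r \<omega> + l)" if "r \<in> {s<..t}"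
        using that st elim(1) by (simp add: power_mult_distrib c_def Y_def)
      then show "ennreal ((H r \<omega>)\<^sup>2) * indicator {s<..t} r = ennreal (c * (indicator {s<..t} r *\<^sub>R (Y r \<omega> + l)))"
        by (auto split: split_indicator)
    qed
    also have "\<dots> = ennreal (c * (LBINT r:{s<..t}. Y r \<omega> + l))"
      unfolding set_lebesgue_integral_def integral_mult_right_zero[symmetric]
    proof (rule nn_integral_eq_integral)
      show "integrable lborel (\<lambda>r. c * (indicator {s<..t} r *\<^sub>R (Y r \<omega> + l)))"
        using YI(1) unfolding set_integrable_def by (rule integrable_mult_right)
      show "AE r in lborel. 0 \<le> c * (indicator {s<..t} r *\<^sub>R (Y r \<omega> + l))"
        using elim(1) st c_pos by (auto simp: Y_def split: split_indicator)
    qed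
    also have "(LBINT r:{s<..t}. Y r \<omega> + l) = Z t \<omega> - Z s \<omega> + l * (t - s)"
      using YI(2) cst(2) set_integral_split_Icc(1)[OF _ _ int, of s] st by (simp add: Z_def)
    finally have eq: "(\<integral>\<^sup>+r\<in>{s<..t}. ennreal ((H r \<omega>)\<^sup>2) \<partial>lborel) = ennreal (c * (Z t \<omega> - Z s \<omega> + l * (t - s)))" .
    have "0 \<le> (LBINT r:{s<..t}. Y r \<omega> + l)"
      unfolding set_lebesgue_integral_def using elim(1) st
      by (intro integral_nonneg_AE AE_I2) (auto simp: Y_def split: split_indicator)
    then have "0 \<le> Z t \<omega> - Z s \<omega> + l * (t - s)"
      using YI(2) cst(2) set_integral_split_Icc(1)[OF _ _ int, of s] st by (simp add: Z_def)
    then show "qv H s t \<omega> = c * (Z t \<omega> - Z s \<omega> + l * (t - s))"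
      unfolding qv_def eq using c_pos by simp
  qed
qed

text \<open>With \<open>\<theta> = \<kappa> / c\<close> the exponential supermartingale
  \<open>exp (\<theta> I - \<theta>\<^sup>2/2 qv)\<close> has the exponent \<open>\<theta> (X t + \<kappa>/2 L) - \<theta> (X 0 + \<kappa> l t)\<close>, where
  \<open>L = \<integral>\<^sub>0\<^sup>t X\<close>; both \<open>X\<close> and \<open>L\<close> are nonnegative.\<close>

lemma second_moment_bound:
  assumes t: "0 \<le> t"
  shows "(\<integral>\<^sup>+\<omega>. ennreal ((X t \<omega> + \<kappa> / 2 * (Z t \<omega> + l * t))\<^sup>2) \<partial>M) \<le>
    ennreal (2 * expectation (\<lambda>\<omega>. (X 0 \<omega> + \<kappa> * l * t)\<^sup>2) + 4 * (c / \<kappa>)\<^sup>2)"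
proof -
  define \<theta> where "\<theta> = \<kappa> / c"
  have \<theta>: "\<theta> > 0" using pos c_pos by (simp add: \<theta>_def)
  note [measurable] = X_measurable_M[OF t] X_measurable_M[of 0, simplified] Z_measurable_M[OF t]
    I_measurable_M[OF t] I_measurable_M[of 0, simplified] qv_measurable[OF H_progressive order_refl t]
  let ?U = "\<lambda>\<omega>. \<theta> * (I t \<omega> - I 0 \<omega>) - \<theta>\<^sup>2 / 2 * qv H 0 t \<omega>"
  have int: "integrable M (\<lambda>\<omega>. (X 0 \<omega> + \<kappa> * l * t)\<^sup>2)"
  proof -
    have "square_integrable (\<lambda>\<omega>. X 0 \<omega> + \<kappa> * l * t)"
      using X0_L2 by (intro square_integrable_add square_integrable_const) (auto simp: square_integrable_def)
    then show ?thesis by (simp add: square_integrable_def)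
  qed
  have "AE \<omega> in M. (X t \<omega> + \<kappa> / 2 * (Z t \<omega> + l * t))\<^sup>2 \<le>
      2 * (X 0 \<omega> + \<kappa> * l * t)\<^sup>2 + 4 / \<theta>\<^sup>2 * exp (?U \<omega>)"
    using X_nonneg I_eq I_0 qv_eq Z_bound
  proof eventually_elim
    case (elim \<omega>)
    define W where "W = X t \<omega> + \<kappa> / 2 * (Z t \<omega> + l * t)"
    define V where "V = X 0 \<omega> + \<kappa> * l * t"
    have W: "W \<ge> 0" using elim t pos by (auto simp: W_def intro!: add_nonneg_nonneg)
    have V: "V \<ge> 0" using elim t pos by (auto simp: V_def intro!: add_nonneg_nonneg)
    have I: "I t \<omega> = X t \<omega> - X 0 \<omega> + \<kappa> * Z t \<omega>" using elim t by (simp add: Y_def)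
    have qv: "qv H 0 t \<omega> = c * (Z t \<omega> + l * t)"
      using elim(4)[rule_format, of 0 t] t by (simp add: Z_def set_integral_singleton)
    have U: "?U \<omega> = \<theta> * (W - V)"
    proof -
      have "\<theta>\<^sup>2 / 2 * qv H 0 t \<omega> = \<theta> * (\<kappa> / 2) * (Z t \<omega> + l * t)"
        using c_pos by (simp add: qv \<theta>_def power2_eq_square)
      then show ?thesis using elim(3) by (simp add: I W_def V_def add_divide_distrib algebra_simps)
    qed
    have sq: "x\<^sup>2 \<le> 2 * exp x" if "x \<ge> 0" for x :: real
      using exp_lower_Taylor_quadratic[OF that] that by simp
    \<comment> \<open>Only an excess of \<open>W\<close> over \<open>V\<close> is paid for
      exponentially. It enters through
      \<open>W\<^sup>2 \<le> 2 * V\<^sup>2 + 2 * (W - V)\<^sup>2\<close> and through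
      \<open>x\<^sup>2 \<le> 2 * exp x\<close> at \<open>x = \<theta> * (W - V)\<close>, which
      explains \<open>4 / \<theta>\<^sup>2\<close>. Thus a second moment of \<open>X 0\<close>
      suffices.\<close>
    have "W\<^sup>2 \<le> 2 * V\<^sup>2 + 4 / \<theta>\<^sup>2 * exp (\<theta> * (W - V))"
    proof (cases "W \<le> V")
      case True
      then have "W\<^sup>2 \<le> V\<^sup>2" using W by (intro power_mono)
      then show ?thesis using \<theta> by (smt (verit) zero_le_power2 exp_gt_zero divide_nonneg_nonneg mult_nonneg_nonneg)
    next
      case False
      have "W\<^sup>2 \<le> 2 * V\<^sup>2 + 2 * (W - V)\<^sup>2"
        using zero_le_power2[of "W - 2 * V"] by (simp add: power2_eq_square algebra_simps)
      also have "(\<theta> * (W - V))\<^sup>2 \<le> 2 * exp (\<theta> * (W - V))"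
        using False \<theta> by (intro sq) auto
      then have "2 * (W - V)\<^sup>2 \<le> 4 / \<theta>\<^sup>2 * exp (\<theta> * (W - V))"
      proof -
        define E where "E = exp (\<theta> * (W - V))"
        assume "(\<theta> * (W - V))\<^sup>2 \<le> 2 * exp (\<theta> * (W - V))"
        then have "\<theta>\<^sup>2 * (W - V)\<^sup>2 \<le> 2 * E" by (simp only: power_mult_distrib E_def)
        then have "2 * (W - V)\<^sup>2 * \<theta>\<^sup>2 \<le> 4 * E" by (simp add: mult.commute)
        then have "2 * (W - V)\<^sup>2 \<le> 4 * E / \<theta>\<^sup>2" using \<theta> by (simp only: pos_le_divide_eq zero_less_power)
        then show ?thesis by (simp add: E_def)
      qed
      finally show ?thesis by simp
    qed
    then show ?case by (simp only: U W_def[symmetric] V_def[symmetric])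
  qed
  then have "(\<integral>\<^sup>+\<omega>. ennreal ((X t \<omega> + \<kappa> / 2 * (Z t \<omega> + l * t))\<^sup>2) \<partial>M) \<le>
      (\<integral>\<^sup>+\<omega>. ennreal (2 * (X 0 \<omega> + \<kappa> * l * t)\<^sup>2) + ennreal (4 / \<theta>\<^sup>2) * ennreal (exp (?U \<omega>)) \<partial>M)"
    by (intro nn_integral_mono_AE)
       (auto elim!: eventually_mono simp: ennreal_mult'[symmetric] ennreal_plus[symmetric] simp del: ennreal_plus intro!: ennreal_leI)
  also have "\<dots> = (\<integral>\<^sup>+\<omega>. ennreal (2 * (X 0 \<omega> + \<kappa> * l * t)\<^sup>2) \<partial>M) + ennreal (4 / \<theta>\<^sup>2) * (\<integral>\<^sup>+\<omega>. ennreal (exp (?U \<omega>)) \<partial>M)"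
    by (subst nn_integral_add) (auto simp: nn_integral_cmult)
  also have "\<dots> \<le> ennreal (expectation (\<lambda>\<omega>. 2 * (X 0 \<omega> + \<kappa> * l * t)\<^sup>2)) + ennreal (4 / \<theta>\<^sup>2) * 1"
    using int t
    by (intro add_mono mult_left_mono ito_exponential_supermartingale[OF ito]) (auto simp: nn_integral_eq_integral)
  also have "\<dots> = ennreal (2 * expectation (\<lambda>\<omega>. (X 0 \<omega> + \<kappa> * l * t)\<^sup>2) + 4 * (c / \<kappa>)\<^sup>2)"
    using \<theta> by (simp add: \<theta>_def power_divide ennreal_plus[symmetric] del: ennreal_plus)
  finally show ?thesis .
qed

text \<open>Both summands of \<open>?W\<close> are nonnegative, so each is controlled by the sum.
  The explicit bound is kept because Fubini's theorem requires second moments of \<open>X r\<close>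
  bounded uniformly over a time interval.\<close>

lemma X_Z_square_integrable:
  assumes t: "0 \<le> t"
  shows "square_integrable (X t)" "square_integrable (Z t)"
    "expectation (\<lambda>\<omega>. (X t \<omega>)\<^sup>2) \<le> 2 * expectation (\<lambda>\<omega>. (X 0 \<omega> + \<kappa> * l * t)\<^sup>2) + 4 * (c / \<kappa>)\<^sup>2"
proof -
  note [measurable] = X_measurable_M[OF t] Z_measurable_M[OF t]
  let ?W = "\<lambda>\<omega>. X t \<omega> + \<kappa> / 2 * (Z t \<omega> + l * t)"
  let ?K = "2 * expectation (\<lambda>\<omega>. (X 0 \<omega> + \<kappa> * l * t)\<^sup>2) + 4 * (c / \<kappa>)\<^sup>2"
  have K0: "?K \<ge> 0" by (intro add_nonneg_nonneg mult_nonneg_nonneg integral_nonneg_AE) auto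
  have W: "integrable M (\<lambda>\<omega>. (?W \<omega>)\<^sup>2)"
    by (rule integrableI_nonneg) (use le_less_trans[OF second_moment_bound[OF t]] in auto)
  have EW: "expectation (\<lambda>\<omega>. (?W \<omega>)\<^sup>2) \<le> ?K"
    using second_moment_bound[OF t] K0
    by (subst (asm) nn_integral_eq_integral[OF W]) (simp_all del: ennreal_plus)
  have leX: "AE \<omega> in M. (X t \<omega>)\<^sup>2 \<le> (?W \<omega>)\<^sup>2"
    using X_nonneg Z_bound
  proof eventually_elim
    case (elim \<omega>)
    then have "0 \<le> \<kappa> / 2 * (Z t \<omega> + l * t)" using t pos by (intro mult_nonneg_nonneg) auto
    then show ?case using elim t by (intro power_mono) auto
  qed
  have leL: "AE \<omega> in M. (Z t \<omega> + l * t)\<^sup>2 \<le> (2 / \<kappa>)\<^sup>2 * (?W \<omega>)\<^sup>2"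
    using X_nonneg Z_bound
  proof eventually_elim
    case (elim \<omega>)
    have "Z t \<omega> + l * t \<le> 2 / \<kappa> * ?W \<omega>"
      using elim t pos by (simp add: field_simps)
    then show ?case using elim t unfolding power_mult_distrib[symmetric] by (intro power_mono) auto
  qed
  have XI: "integrable M (\<lambda>\<omega>. (X t \<omega>)\<^sup>2)"
    by (rule Bochner_Integration.integrable_bound[OF W]) (use leX in auto)
  then show "square_integrable (X t)" by (simp add: square_integrable_def)
  have "integrable M (\<lambda>\<omega>. (2 / \<kappa>)\<^sup>2 * (?W \<omega>)\<^sup>2)"
    using W by (rule integrable_mult_right)
  then have "integrable M (\<lambda>\<omega>. (Z t \<omega> + l * t)\<^sup>2)"
    by (rule Bochner_Integration.integrable_bound) (use leL in \<open>auto elim!: eventually_mono\<close>)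
  then have "square_integrable (\<lambda>\<omega>. Z t \<omega> + l * t)" by (simp add: square_integrable_def)
  from square_integrable_diff[OF this square_integrable_const[of "l * t"]]
  show "square_integrable (Z t)" by simp
  show "expectation (\<lambda>\<omega>. (X t \<omega>)\<^sup>2) \<le> ?K"
    using integral_mono_AE[OF XI W leX] EW by simp
qed

lemma Y_square_integrable: "0 \<le> t \<Longrightarrow> square_integrable (Y t)"
  unfolding Y_def[abs_def] by (intro square_integrable_diff square_integrable_const X_Z_square_integrable)

lemma I_square_integrable:
  assumes "0 \<le> t" shows "square_integrable (I t)"
proof (rule square_integrable_cong_AE)
  show "square_integrable (\<lambda>\<omega>. Y t \<omega> - Y 0 \<omega> + \<kappa> * Z t \<omega>)"
    using assms by (intro square_integrable_add square_integrable_diff square_integrable_cmult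
        Y_square_integrable X_Z_square_integrable) auto
  show "AE \<omega> in M. Y t \<omega> - Y 0 \<omega> + \<kappa> * Z t \<omega> = I t \<omega>"
    using I_eq assms by (auto elim!: eventually_mono)
qed (rule I_measurable_M[OF assms])

lemma qv_square_integrable:
  assumes "0 \<le> s" "s \<le> t" shows "square_integrable (qv H s t)"
proof (rule square_integrable_cong_AE)
  show "square_integrable (\<lambda>\<omega>. c * (Z t \<omega> - Z s \<omega> + l * (t - s)))"
    using assms by (intro square_integrable_add square_integrable_diff square_integrable_cmult
        square_integrable_const X_Z_square_integrable) auto
  show "AE \<omega> in M. c * (Z t \<omega> - Z s \<omega> + l * (t - s)) = qv H s t \<omega>"
    using qv_eq assms by (auto elim!: eventually_mono)
qed (rule qv_measurable[OF H_progressive assms])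

lemma I_orthogonal:
  assumes st: "0 \<le> s" "s \<le> t" and f: "f \<in> borel_measurable (F s)" "square_integrable f"
  shows "expectation (\<lambda>\<omega>. f \<omega> * I t \<omega>) = expectation (\<lambda>\<omega>. f \<omega> * I s \<omega>)"
proof -
  have "square_integrable (\<lambda>\<omega>. I t \<omega> - I s \<omega>)"
    using st by (intro square_integrable_diff I_square_integrable) auto
  then have "expectation (\<lambda>\<omega>. f \<omega> * (I t \<omega> - I s \<omega>)) = 0"
    using qv_square_integrable[OF st] f
    by (intro ito_martingale_L2[OF ito st]) (auto simp: square_integrable_def)
  moreover have "integrable M (\<lambda>\<omega>. f \<omega> * I t \<omega>)" "integrable M (\<lambda>\<omega>. f \<omega> * I s \<omega>)"
    using st f by (auto intro!: square_integrable_mult I_square_integrable)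
  ultimately show ?thesis by (simp add: right_diff_distrib)
qed

text \<open>\<open>f\<close> is an arbitrary square-integrable variable because it will be
  \<open>I t\<close> or \<open>Y t\<close>, which look ahead of the integration time. The
  integrability claim is the regularity that \<open>linear_integral_equation\<close> asks
  for.\<close>

lemma fubini:
  assumes f: "square_integrable f" and t: "0 \<le> t"
  shows "set_integrable lborel {0..t} (\<lambda>r. expectation (\<lambda>\<omega>. f \<omega> * Y r \<omega>))"
    "expectation (\<lambda>\<omega>. f \<omega> * Z t \<omega>) = (LBINT r:{0..t}. expectation (\<lambda>\<omega>. f \<omega> * Y r \<omega>))"
proof -
  interpret P: pair_sigma_finite lborel M ..
  define h where "h p = (if fst p \<in> {0..t} then Y (fst p) (snd p) else 0)" for p
  have [measurable]: "h \<in> borel_measurable (lborel \<Otimes>\<^sub>M M)"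
    unfolding h_def[abs_def] by (rule Y_joint_measurable[OF t])
  have fm[measurable]: "f \<in> borel_measurable M" using f by (simp add: square_integrable_def)
  define g where "g p = f (snd p) * h p" for p
  have gm[measurable]: "g \<in> borel_measurable (lborel \<Otimes>\<^sub>M M)"
    unfolding g_def[abs_def] by measurable
  have g_in: "g (r, \<omega>) = f \<omega> * Y r \<omega>" if "r \<in> {0..t}" for r \<omega> using that by (simp add: g_def h_def)
  have g_out: "g (r, \<omega>) = 0" if "r \<notin> {0..t}" for r \<omega> using that by (auto simp: g_def h_def)
  have fY: "integrable M (\<lambda>\<omega>. f \<omega> * Y r \<omega>)" if "r \<in> {0..t}" for r
    using that f by (auto intro!: square_integrable_mult Y_square_integrable)
  \<comment> \<open>Obtained from \<open>\<bar>a * (b - l)\<bar> \<le> a\<^sup>2 + 2 * l\<^sup>2 + 2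
    * b\<^sup>2\<close> and the second moment bound for \<open>X r\<close>, which grows with
    \<open>r\<close> and is therefore taken at \<open>t\<close>.\<close>
  define K where "K = expectation (\<lambda>\<omega>. (f \<omega>)\<^sup>2) + 2 * l\<^sup>2 +
    2 * (2 * expectation (\<lambda>\<omega>. (X 0 \<omega> + \<kappa> * l * t)\<^sup>2) + 4 * (c / \<kappa>)\<^sup>2)"
  have bound: "expectation (\<lambda>\<omega>. \<bar>f \<omega> * Y r \<omega>\<bar>) \<le> K" if r: "r \<in> {0..t}" for r
  proof -
    have Xr: "integrable M (\<lambda>\<omega>. (X r \<omega>)\<^sup>2)"
      using X_Z_square_integrable(1)[of r] r by (auto simp: square_integrable_def)
    have ff: "integrable M (\<lambda>\<omega>. (f \<omega>)\<^sup>2)" using f by (simp add: square_integrable_def)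
    have "\<bar>a * (b - l)\<bar> \<le> a\<^sup>2 + 2 * l\<^sup>2 + 2 * b\<^sup>2" for a b
    proof -
      have "2 * (\<bar>a\<bar> * \<bar>b - l\<bar>) \<le> a\<^sup>2 + (b - l)\<^sup>2"
        using zero_le_power2[of "\<bar>a\<bar> - \<bar>b - l\<bar>"] by (simp add: power2_diff)
      moreover have "(b - l)\<^sup>2 \<le> 2 * b\<^sup>2 + 2 * l\<^sup>2"
        using zero_le_power2[of "b + l"] by (simp add: power2_eq_square algebra_simps)
      moreover have "0 \<le> \<bar>a\<bar> * \<bar>b - l\<bar>" by simp
      ultimately show ?thesis unfolding abs_mult using zero_le_power2[of a] by linarith
    qed
    then have "expectation (\<lambda>\<omega>. \<bar>f \<omega> * Y r \<omega>\<bar>) \<le> expectation (\<lambda>\<omega>. (f \<omega>)\<^sup>2 + 2 * l\<^sup>2 + 2 * (X r \<omega>)\<^sup>2)"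
      using fY[OF r] Xr ff by (intro integral_mono) (auto simp: Y_def)
    also have "\<dots> = expectation (\<lambda>\<omega>. (f \<omega>)\<^sup>2) + 2 * l\<^sup>2 + 2 * expectation (\<lambda>\<omega>. (X r \<omega>)\<^sup>2)"
      using Xr ff by (simp add: prob_space)
    also have "expectation (\<lambda>\<omega>. (X r \<omega>)\<^sup>2) \<le> 2 * expectation (\<lambda>\<omega>. (X 0 \<omega> + \<kappa> * l * r)\<^sup>2) + 4 * (c / \<kappa>)\<^sup>2"
      using r by (intro X_Z_square_integrable) auto
    also have "expectation (\<lambda>\<omega>. (X 0 \<omega> + \<kappa> * l * r)\<^sup>2) \<le> expectation (\<lambda>\<omega>. (X 0 \<omega> + \<kappa> * l * t)\<^sup>2)"
    proof (rule integral_mono_AE)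
      have "square_integrable (\<lambda>\<omega>. X 0 \<omega> + a)" for a
        by (intro square_integrable_add square_integrable_const X_Z_square_integrable) auto
      then show "integrable M (\<lambda>\<omega>. (X 0 \<omega> + \<kappa> * l * r)\<^sup>2)" "integrable M (\<lambda>\<omega>. (X 0 \<omega> + \<kappa> * l * t)\<^sup>2)"
        by (auto simp: square_integrable_def)
      show "AE \<omega> in M. (X 0 \<omega> + \<kappa> * l * r)\<^sup>2 \<le> (X 0 \<omega> + \<kappa> * l * t)\<^sup>2"
        using X_nonneg
      proof eventually_elim
        case (elim \<omega>)
        have "\<kappa> * l * r \<le> \<kappa> * l * t" using r pos by auto
        then show ?case using elim r pos by (intro power_mono add_mono) auto
      qed
    qed
    finally show ?thesis by (simp add: K_def)
  qed
  have gint: "integrable (lborel \<Otimes>\<^sub>M M) g"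
  proof (rule P.Fubini_integrable[OF gm])
    show "AE r in lborel. integrable M (\<lambda>\<omega>. g (r, \<omega>))"
    proof (rule AE_I2)
      fix r show "integrable M (\<lambda>\<omega>. g (r, \<omega>))"
        by (cases "r \<in> {0..t}") (simp_all add: g_in g_out fY)
    qed
    show "integrable lborel (\<lambda>r. expectation (\<lambda>\<omega>. norm (g (r, \<omega>))))"
    proof (rule Bochner_Integration.integrable_bound)
      show "integrable lborel (\<lambda>r. K * indicator {0..t} r)"
        using t by (intro integrable_mult_right) simp
      show "AE r in lborel. norm (expectation (\<lambda>\<omega>. norm (g (r, \<omega>)))) \<le> norm (K * indicator {0..t} r)"
      proof (rule AE_I2)
        fix r show "norm (expectation (\<lambda>\<omega>. norm (g (r, \<omega>)))) \<le> norm (K * indicator {0..t} r)"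
          using bound[of r] by (cases "r \<in> {0..t}") (auto simp: g_in g_out intro: order_trans[OF _ abs_ge_self])
      qed
    qed measurable
  qed
  have g_fst: "expectation (\<lambda>\<omega>. g (r, \<omega>)) = indicator {0..t} r *\<^sub>R expectation (\<lambda>\<omega>. f \<omega> * Y r \<omega>)" for r
    by (cases "r \<in> {0..t}") (simp_all add: g_in g_out)
  show "set_integrable lborel {0..t} (\<lambda>r. expectation (\<lambda>\<omega>. f \<omega> * Y r \<omega>))"
    unfolding set_integrable_def g_fst[symmetric] by (rule P.integrable_fst'[OF gint])
  have g_snd: "(LBINT r. g (r, \<omega>)) = f \<omega> * Z t \<omega>" for \<omega>
  proof -
    have "(LBINT r. g (r, \<omega>)) = (LBINT r. f \<omega> * (indicator {0..t} r *\<^sub>R Y r \<omega>))"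
      by (intro Bochner_Integration.integral_cong refl) (simp add: g_def h_def)
    then show ?thesis by (simp add: Z_def set_lebesgue_integral_def)
  qed
  have "(LBINT r. expectation (\<lambda>\<omega>. g (r, \<omega>))) = expectation (\<lambda>\<omega>. LBINT r. g (r, \<omega>))"
    using P.Fubini_integral[of "\<lambda>r \<omega>. g (r, \<omega>)"] gint by simp
  then show "expectation (\<lambda>\<omega>. f \<omega> * Z t \<omega>) = (LBINT r:{0..t}. expectation (\<lambda>\<omega>. f \<omega> * Y r \<omega>))"
    by (simp add: g_fst g_snd set_lebesgue_integral_def)
qed

text \<open>Tested against \<open>f\<close>, the stochastic integral is constant in time after
  \<open>s\<close>, so the expectation of \<open>f * Y r\<close> changes only through the drift. The
  choice \<open>f = 1\<close> yields the mean, \<open>f = Y s\<close> the autocovariance.\<close>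

lemma Y_decay:
  assumes st: "0 \<le> s" "s \<le> t" and f: "f \<in> borel_measurable (F s)" "square_integrable f"
  shows "expectation (\<lambda>\<omega>. f \<omega> * Y t \<omega>) = expectation (\<lambda>\<omega>. f \<omega> * Y s \<omega>) * exp (- \<kappa> * (t - s))"
proof (rule linear_integral_equation[OF st(2)])
  have t: "0 \<le> t" using st by simp
  show "set_integrable lborel {s..t} (\<lambda>r. expectation (\<lambda>\<omega>. f \<omega> * Y r \<omega>))"
    by (rule set_integrable_subset[OF fubini(1)[OF f(2) t]]) (use st in auto)
  fix r assume r: "r \<in> {s..t}"
  then have r0: "0 \<le> r" "s \<le> r" using st by auto
  have I: "expectation (\<lambda>\<omega>. f \<omega> * I u \<omega>) = expectation (\<lambda>\<omega>. f \<omega> * Y u \<omega>) -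
      expectation (\<lambda>\<omega>. f \<omega> * Y 0 \<omega>) + \<kappa> * expectation (\<lambda>\<omega>. f \<omega> * Z u \<omega>)" if u: "0 \<le> u" for u
  proof -
    note [measurable] = Y_measurable_M[OF u] Y_measurable_M[of 0, simplified] Z_measurable_M[OF u] I_measurable_M[OF u]
    have [measurable]: "f \<in> borel_measurable M" using f by (simp add: square_integrable_def)
    have "expectation (\<lambda>\<omega>. f \<omega> * I u \<omega>) =
        expectation (\<lambda>\<omega>. f \<omega> * Y u \<omega> - f \<omega> * Y 0 \<omega> + \<kappa> * (f \<omega> * Z u \<omega>))"
      by (intro integral_cong_AE eventually_mono[OF I_eq_at[OF u]])
         (measurable, measurable, erule ssubst, simp add: algebra_simps)
    then show ?thesis
      using f u by (simp add: square_integrable_mult Y_square_integrable X_Z_square_integrable)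
  qed
  have J: "(LBINT x:{s..r}. expectation (\<lambda>\<omega>. f \<omega> * Y x \<omega>)) =
      expectation (\<lambda>\<omega>. f \<omega> * Z r \<omega>) - expectation (\<lambda>\<omega>. f \<omega> * Z s \<omega>)"
    using set_integral_split_Icc[OF st(1) r0(2) fubini(1)[OF f(2) r0(1)]] fubini(2)[OF f(2)] r0 st by simp
  show "expectation (\<lambda>\<omega>. f \<omega> * Y r \<omega>) = expectation (\<lambda>\<omega>. f \<omega> * Y s \<omega>) -
      \<kappa> * (LBINT x:{s..r}. expectation (\<lambda>\<omega>. f \<omega> * Y x \<omega>))"
    unfolding J right_diff_distrib
    using I_orthogonal[OF st(1) r0(2) f] I[OF r0(1)] I[OF st(1)] by linarith
qed

lemma Y_mean: "0 \<le> t \<Longrightarrow> expectation (Y t) = 0"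
proof -
  assume t: "0 \<le> t"
  have "integrable M (X 0)"
    using X_Z_square_integrable(1)[of 0] square_integrable_integrable by simp
  then have "expectation (Y 0) = 0"
    by (simp add: Y_def[abs_def] X0_mean prob_space)
  then show ?thesis
    using Y_decay[of 0 t "\<lambda>_. 1"] t square_integrable_const[of 1] by simp
qed

lemma Z_mean:
  assumes t: "0 \<le> t" shows "expectation (Z t) = 0"
proof -
  have "expectation (Z t) = (LBINT r:{0..t}. expectation (Y r))"
    using fubini(2)[OF square_integrable_const[of 1] t] by simp
  also have "\<dots> = (LBINT r:{0..t}. 0)"
    by (rule set_lebesgue_integral_cong) (auto simp: Y_mean)
  finally show ?thesis by simp
qed

section \<open>Second moments of the stationary solution\<close>

lemma I_second_moment: "0 \<le> t \<Longrightarrow> expectation (\<lambda>\<omega>. (I t \<omega>)\<^sup>2) = q * t"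
proof -
  assume t: "0 \<le> t"
  note [measurable] = I_measurable_M[OF t] I_measurable_M[of 0, simplified] Z_measurable_M[OF t]
    qv_measurable[OF H_progressive order_refl t] Z_measurable_M[of 0, simplified]
  have "square_integrable (\<lambda>\<omega>. I t \<omega> - I 0 \<omega>)"
    using t by (intro square_integrable_diff I_square_integrable) auto
  then have "expectation (\<lambda>\<omega>. (I t \<omega> - I 0 \<omega>)\<^sup>2) = expectation (qv H 0 t)"
    using t qv_square_integrable[of 0 t]
    by (intro ito_martingale_isometry(1)[OF ito]) (auto simp: square_integrable_def)
  moreover have "expectation (\<lambda>\<omega>. (I t \<omega> - I 0 \<omega>)\<^sup>2) = expectation (\<lambda>\<omega>. (I t \<omega>)\<^sup>2)"
    using I_0 by (intro integral_cong_AE) (auto elim!: eventually_mono)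
  moreover have "expectation (qv H 0 t) = expectation (\<lambda>\<omega>. c * (Z t \<omega> - Z 0 \<omega> + l * (t - 0)))"
    using qv_eq t by (intro integral_cong_AE) (auto elim!: eventually_mono)
  moreover have "\<dots> = c * (expectation (Z t) - expectation (Z 0) + l * t)"
    using X_Z_square_integrable(2)[THEN square_integrable_integrable] t by (simp add: prob_space)
  ultimately show ?thesis using t by (simp add: Z_mean q_eq)
qed

text \<open>The identity for \<open>I r\<close> is multiplied by \<open>I r\<close> itself. In the
  mean of \<open>I r * Z r\<close>, orthogonality replaces \<open>I r\<close> by \<open>I u\<close>
  in front of each earlier \<open>Y u\<close>, so the unknown function reappears under the time
  integral.\<close>

lemma I_Y_covariance:
  assumes t: "0 \<le> t"
  shows "expectation (\<lambda>\<omega>. I t \<omega> * Y t \<omega>) = q / \<kappa> * (1 - exp (- \<kappa> * t))"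
proof -
  let ?p = "\<lambda>t. expectation (\<lambda>\<omega>. I t \<omega> * Y t \<omega>)"
  have early: "expectation (\<lambda>\<omega>. I t \<omega> * Y r \<omega>) = ?p r" if "0 \<le> r" "r \<le> t" for r t
    using I_orthogonal[OF that Y_measurable Y_square_integrable] that by (simp add: mult.commute)
  have p0: "?p 0 = 0"
  proof -
    have "?p 0 = expectation (\<lambda>\<omega>. 0)"
      using I_0 I_measurable_M[of 0] Y_measurable_M[of 0]
      by (intro integral_cong_AE) (auto elim!: eventually_mono)
    then show ?thesis by simp
  qed
  have int: "set_integrable lborel {0..r} ?p" if r: "0 \<le> r" for r
  proof -
    have "set_integrable lborel {0..r} (\<lambda>u. expectation (\<lambda>\<omega>. I r \<omega> * Y u \<omega>))"
      by (rule fubini(1)[OF I_square_integrable[OF r] r])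
    moreover have "set_integrable lborel {0..r} (\<lambda>u. expectation (\<lambda>\<omega>. I r \<omega> * Y u \<omega>)) \<longleftrightarrow>
        set_integrable lborel {0..r} ?p"
      by (intro set_integrable_cong refl early) auto
    ultimately show ?thesis by blast
  qed
  have eq: "q * r = ?p r + \<kappa> * (LBINT u:{0..r}. ?p u)" if r: "0 \<le> r" for r
  proof -
    note [measurable] = Y_measurable_M[OF r] Y_measurable_M[of 0, simplified] Z_measurable_M[OF r] I_measurable_M[OF r]
    have "q * r = expectation (\<lambda>\<omega>. I r \<omega> * Y r \<omega> - I r \<omega> * Y 0 \<omega> + \<kappa> * (I r \<omega> * Z r \<omega>))"
      unfolding I_second_moment[OF r, symmetric] 
    proof (rule integral_cong_AE)
      show "AE \<omega> in M. (I r \<omega>)\<^sup>2 = I r \<omega> * Y r \<omega> - I r \<omega> * Y 0 \<omega> + \<kappa> * (I r \<omega> * Z r \<omega>)"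
        using I_eq_at[OF r]
      proof eventually_elim
        case (elim \<omega>)
        have "(I r \<omega>)\<^sup>2 = I r \<omega> * (Y r \<omega> - Y 0 \<omega> + \<kappa> * Z r \<omega>)"
          unfolding power2_eq_square by (subst (2) elim) (rule refl)
        then show ?case by (simp add: algebra_simps)
      qed
    qed measurable
    also have "\<dots> = ?p r - expectation (\<lambda>\<omega>. I r \<omega> * Y 0 \<omega>) + \<kappa> * expectation (\<lambda>\<omega>. I r \<omega> * Z r \<omega>)"
      using r by (simp add: square_integrable_mult Y_square_integrable X_Z_square_integrable I_square_integrable)
    also have "expectation (\<lambda>\<omega>. I r \<omega> * Y 0 \<omega>) = 0" using early[of 0 r] r p0 by simp
    also have "expectation (\<lambda>\<omega>. I r \<omega> * Z r \<omega>) = (LBINT u:{0..r}. expectation (\<lambda>\<omega>. I r \<omega> * Y u \<omega>))"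
      by (rule fubini(2)[OF I_square_integrable[OF r] r])
    also have "\<dots> = (LBINT u:{0..r}. ?p u)"
      by (rule set_lebesgue_integral_cong) (auto intro: early)
    finally show ?thesis by simp
  qed
  have cst: "set_integrable lborel {0..r} (\<lambda>_. a)" "(LBINT u:{0..r}. a) = a * r" if "0 \<le> r" for r a :: real
    using that by (auto simp: set_integrable_def set_lebesgue_integral_def)
  \<comment> \<open>The equilibrium value \<open>q / \<kappa>\<close> is subtracted: \<kappa> times
    its integral over [0, r] is \<open>q * r\<close>, so the difference satisfies the homogeneous
    equation.\<close>
  have "?p t - q / \<kappa> = (?p 0 - q / \<kappa>) * exp (- \<kappa> * (t - 0))"
  proof (rule linear_integral_equation[OF t])
    show "set_integrable lborel {0..t} (\<lambda>t. ?p t - q / \<kappa>)"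
      by (rule set_integral_diff(1)[OF int[OF t] cst(1)[OF t]])
    fix r assume "r \<in> {0..t}"
    then have r: "0 \<le> r" by simp
    have "\<kappa> * (LBINT u:{0..r}. ?p u - q / \<kappa>) = \<kappa> * (LBINT u:{0..r}. ?p u) - q * r"
      using set_integral_diff(2)[OF int[OF r] cst(1)[OF r]] cst(2)[OF r] pos
      by (simp add: right_diff_distrib)
    then show "?p r - q / \<kappa> = ?p 0 - q / \<kappa> - \<kappa> * (LBINT u:{0..r}. ?p u - q / \<kappa>)"
      using eq[OF r] p0 by simp
  qed
  then show ?thesis by (simp add: p0 algebra_simps)
qed

text \<open>Testing the identity against \<open>Y r\<close> gives a renewal equation for
  \<open>?g\<close>, since \<open>Y_decay\<close> turns the covariance of \<open>Y x\<close> and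
  \<open>Y r\<close> into \<open>?g x * exp (- \<kappa> * (r - x))\<close>. Because the initial
  variance is already \<open>\<gamma>\<close>, the deviation from it solves a homogeneous equation
  with initial value 0.\<close>

lemma Y_variance:
  assumes t: "0 \<le> t"
  shows "expectation (\<lambda>\<omega>. (Y t \<omega>)\<^sup>2) = q / (2 * \<kappa>)"
proof -
  define \<gamma> where "\<gamma> = q / (2 * \<kappa>)"
  let ?g = "\<lambda>t. expectation (\<lambda>\<omega>. Y t \<omega> * Y t \<omega>)"
  have YY: "expectation (\<lambda>\<omega>. Y t \<omega> * Y r \<omega>) = ?g r * exp (- \<kappa> * (t - r))" if "0 \<le> r" "r \<le> t" for r t
    using Y_decay[OF that Y_measurable Y_square_integrable] that by (simp add: mult.commute)
  have g0: "?g 0 = \<gamma>"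
  proof -
    have X: "integrable M (X 0)" "integrable M (\<lambda>\<omega>. (X 0 \<omega>)\<^sup>2)"
      using X_Z_square_integrable(1)[of 0] X_Z_square_integrable(1)[of 0, THEN square_integrable_integrable]
      by (auto simp: square_integrable_def)
    have "?g 0 = expectation (\<lambda>\<omega>. (X 0 \<omega>)\<^sup>2 - 2 * l * X 0 \<omega> + l\<^sup>2)"
      by (simp add: Y_def power2_eq_square algebra_simps)
    also have "\<dots> = expectation (\<lambda>\<omega>. (X 0 \<omega>)\<^sup>2) - 2 * l * expectation (X 0) + l\<^sup>2"
      using X by (simp add: prob_space)
    also have "\<dots> = \<gamma>"
      unfolding X0_mean X0_second by (simp add: \<gamma>_def q_def power2_eq_square)
    finally show ?thesis .
  qed
  \<comment> \<open>Multiplication by \<open>exp (\<kappa> * r)\<close> frees the renewal kernel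
    from its dependence on \<open>r\<close> and leaves an equation that
    \<open>linear_integral_equation\<close> covers.\<close>
  define u where "u r = (?g r - \<gamma>) * exp (\<kappa> * r)" for r
  have int: "set_integrable lborel {0..r} (\<lambda>x. ?g x * exp (\<kappa> * x))"
    and eq: "q / \<kappa> * (1 - exp (- \<kappa> * r)) = ?g r - \<gamma> * exp (- \<kappa> * r) +
      \<kappa> * (exp (- \<kappa> * r) * (LBINT x:{0..r}. ?g x * exp (\<kappa> * x)))" if r: "0 \<le> r" for r
  proof -
    have YYr: "expectation (\<lambda>\<omega>. Y r \<omega> * Y x \<omega>) = exp (- \<kappa> * r) * (?g x * exp (\<kappa> * x))" if "x \<in> {0..r}" for x
      using YY[of x r] that by (simp add: right_diff_distrib exp_diff exp_minus field_simps)
    have "set_integrable lborel {0..r} (\<lambda>x. exp (\<kappa> * r) * expectation (\<lambda>\<omega>. Y r \<omega> * Y x \<omega>))"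
      by (intro set_integrable_mult_right fubini(1)[OF Y_square_integrable[OF r] r])
    moreover have "exp (\<kappa> * r) * expectation (\<lambda>\<omega>. Y r \<omega> * Y x \<omega>) = ?g x * exp (\<kappa> * x)" if "x \<in> {0..r}" for x
      unfolding YYr[OF that] by (simp add: exp_minus field_simps)
    ultimately show "set_integrable lborel {0..r} (\<lambda>x. ?g x * exp (\<kappa> * x))"
      by (subst (asm) set_integrable_cong[OF refl refl]) auto
    note [measurable] = Y_measurable_M[OF r] Y_measurable_M[of 0, simplified] Z_measurable_M[OF r] I_measurable_M[OF r]
    have "q / \<kappa> * (1 - exp (- \<kappa> * r)) =
        expectation (\<lambda>\<omega>. Y r \<omega> * Y r \<omega> - Y r \<omega> * Y 0 \<omega> + \<kappa> * (Y r \<omega> * Z r \<omega>))"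
      unfolding I_Y_covariance[OF r, symmetric] 
      by (intro integral_cong_AE eventually_mono[OF I_eq_at[OF r]])
         (measurable, measurable, erule ssubst, simp add: algebra_simps)
    also have "\<dots> = ?g r - expectation (\<lambda>\<omega>. Y r \<omega> * Y 0 \<omega>) + \<kappa> * expectation (\<lambda>\<omega>. Y r \<omega> * Z r \<omega>)"
      using r by (simp add: square_integrable_mult Y_square_integrable X_Z_square_integrable)
    also have "expectation (\<lambda>\<omega>. Y r \<omega> * Y 0 \<omega>) = \<gamma> * exp (- \<kappa> * r)"
      using YY[of 0 r] r g0 by simp
    also have "expectation (\<lambda>\<omega>. Y r \<omega> * Z r \<omega>) = (LBINT x:{0..r}. expectation (\<lambda>\<omega>. Y r \<omega> * Y x \<omega>))"
      by (rule fubini(2)[OF Y_square_integrable[OF r] r])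
    also have "\<dots> = (LBINT x:{0..r}. exp (- \<kappa> * r) * (?g x * exp (\<kappa> * x)))"
      by (rule set_lebesgue_integral_cong) (simp, intro allI impI YYr)
    finally show "q / \<kappa> * (1 - exp (- \<kappa> * r)) = ?g r - \<gamma> * exp (- \<kappa> * r) +
      \<kappa> * (exp (- \<kappa> * r) * (LBINT x:{0..r}. ?g x * exp (\<kappa> * x)))" by simp
  qed
  have "u t = u 0 * exp (- \<kappa> * (t - 0))"
  proof (rule linear_integral_equation[OF t])
    have u_eq: "u = (\<lambda>r. ?g r * exp (\<kappa> * r) - \<gamma> * exp (\<kappa> * r))"
      by (simp add: u_def fun_eq_iff algebra_simps)
    have e: "set_integrable lborel {0..r} (\<lambda>x. \<gamma> * exp (\<kappa> * x))" if "0 \<le> r" for r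
      using set_integral_exp(1)[OF that] by (intro set_integrable_mult_right) auto
    show "set_integrable lborel {0..t} u"
      unfolding u_eq by (rule set_integral_diff(1)[OF int[OF t] e[OF t]])
    fix r assume "r \<in> {0..t}"
    then have r: "0 \<le> r" by simp
    define J where "J = (LBINT x:{0..r}. ?g x * exp (\<kappa> * x))"
    have u_int: "(LBINT x:{0..r}. u x) = J - \<gamma> * (LBINT x:{0..r}. exp (\<kappa> * x))"
      unfolding u_eq using set_integral_diff(2)[OF int[OF r] e[OF r]] by (simp add: J_def)
    have 1: "\<kappa> * (LBINT x:{0..r}. u x) = \<kappa> * J - \<gamma> * (exp (\<kappa> * r) - 1)"
      unfolding u_int right_diff_distrib[of \<kappa>] mult.left_commute[of \<kappa> \<gamma>]
        set_integral_exp(2)[OF r, of \<kappa>] ..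
    have ex: "exp (- \<kappa> * r) * exp (\<kappa> * r) = 1" by (simp add: exp_minus)
    \<comment> \<open>The equation \<open>eq\<close> multiplied by
      \<open>exp (\<kappa> * r)\<close>, with \<open>q / \<kappa> = 2 * \<gamma>\<close>.\<close>
    have 2: "2 * \<gamma> * (exp (\<kappa> * r) - 1) = ?g r * exp (\<kappa> * r) - \<gamma> + \<kappa> * J"
    proof -
      have "2 * \<gamma> * (1 - exp (- \<kappa> * r)) * exp (\<kappa> * r) =
          (?g r - \<gamma> * exp (- \<kappa> * r) + \<kappa> * (exp (- \<kappa> * r) * J)) * exp (\<kappa> * r)"
        using eq[OF r] pos by (simp add: \<gamma>_def J_def)
      moreover have "2 * \<gamma> * (1 - exp (- \<kappa> * r)) * exp (\<kappa> * r) =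
          2 * \<gamma> * (exp (\<kappa> * r) - exp (- \<kappa> * r) * exp (\<kappa> * r))"
        by (simp only: left_diff_distrib right_diff_distrib mult_1_left mult_1_right mult.assoc)
      moreover have "(?g r - \<gamma> * exp (- \<kappa> * r) + \<kappa> * (exp (- \<kappa> * r) * J)) * exp (\<kappa> * r) =
          ?g r * exp (\<kappa> * r) - \<gamma> * (exp (- \<kappa> * r) * exp (\<kappa> * r)) + \<kappa> * J * (exp (- \<kappa> * r) * exp (\<kappa> * r))"
      proof -
        have "(G - \<gamma> * a + \<kappa> * (a * j)) * b = G * b - \<gamma> * (a * b) + \<kappa> * j * (a * b)" for G a b j
          by (simp add: algebra_simps)
        then show ?thesis .
      qed
      ultimately show ?thesis unfolding ex by simp
    qed
    have "u 0 = 0" by (simp add: u_def g0)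
    then show "u r = u 0 - \<kappa> * (LBINT x:{0..r}. u x)"
      unfolding 1 using 2 by (simp add: u_def algebra_simps)
  qed
  then have "u t = 0" by (simp add: u_def g0)
  then show ?thesis by (simp add: u_def \<gamma>_def power2_eq_square)
qed

lemma Z_second_moment:
  assumes t: "0 \<le> t"
  shows "expectation (\<lambda>\<omega>. (Z t \<omega>)\<^sup>2) = (q * t - q / \<kappa> * (1 - exp (- \<kappa> * t))) / \<kappa>\<^sup>2"
proof -
  note [measurable] = Y_measurable_M[OF t] Y_measurable_M[of 0, simplified] Z_measurable_M[OF t] I_measurable_M[OF t]
  have IY0: "expectation (\<lambda>\<omega>. I t \<omega> * Y 0 \<omega>) = 0"
  proof -
    have "expectation (\<lambda>\<omega>. Y 0 \<omega> * I t \<omega>) = expectation (\<lambda>\<omega>. Y 0 \<omega> * I 0 \<omega>)"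
      using t by (intro I_orthogonal Y_measurable Y_square_integrable) auto
    also have "\<dots> = expectation (\<lambda>\<omega>. 0)"
      using I_0 I_measurable_M[of 0] by (intro integral_cong_AE) (auto elim!: eventually_mono)
    finally show ?thesis by (simp add: mult.commute)
  qed
  have YY0: "expectation (\<lambda>\<omega>. Y t \<omega> * Y 0 \<omega>) = q / (2 * \<kappa>) * exp (- \<kappa> * t)"
    using Y_decay[of 0 t "Y 0"] Y_variance[of 0] t Y_measurable[of 0] Y_square_integrable[of 0]
    by (simp add: mult.commute power2_eq_square)
  have "\<kappa>\<^sup>2 * expectation (\<lambda>\<omega>. (Z t \<omega>)\<^sup>2) = expectation (\<lambda>\<omega>. (\<kappa> * Z t \<omega>)\<^sup>2)"
    by (simp add: power_mult_distrib)
  also have "\<dots> = expectation (\<lambda>\<omega>. (I t \<omega>)\<^sup>2 + (Y t \<omega>)\<^sup>2 + (Y 0 \<omega>)\<^sup>2 +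
      2 * (I t \<omega> * Y 0 \<omega>) - 2 * (I t \<omega> * Y t \<omega>) - 2 * (Y t \<omega> * Y 0 \<omega>))"
    by (intro integral_cong_AE eventually_mono[OF I_eq_at[OF t]])
       (measurable, measurable, erule ssubst, simp add: power2_eq_square algebra_simps)
  also have "\<dots> = expectation (\<lambda>\<omega>. (I t \<omega>)\<^sup>2) + expectation (\<lambda>\<omega>. (Y t \<omega>)\<^sup>2) + expectation (\<lambda>\<omega>. (Y 0 \<omega>)\<^sup>2) +
      2 * expectation (\<lambda>\<omega>. I t \<omega> * Y 0 \<omega>) - 2 * expectation (\<lambda>\<omega>. I t \<omega> * Y t \<omega>) -
      2 * expectation (\<lambda>\<omega>. Y t \<omega> * Y 0 \<omega>)"
  proof -
    note sq = I_square_integrable[OF t] Y_square_integrable[OF t] Y_square_integrable[OF order_refl]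
    have "integrable M (\<lambda>\<omega>. (I t \<omega>)\<^sup>2)" "integrable M (\<lambda>\<omega>. (Y t \<omega>)\<^sup>2)" "integrable M (\<lambda>\<omega>. (Y 0 \<omega>)\<^sup>2)"
      using sq by (simp_all add: square_integrable_def)
    then show ?thesis
      using square_integrable_mult[OF sq(1,2)] square_integrable_mult[OF sq(1,3)]
        square_integrable_mult[OF sq(2,3)] by simp
  qed
  \<comment> \<open>The two variances of \<open>Y\<close> add up to \<open>q / \<kappa>\<close>;
    together with the covariance terms they leave a single
    \<open>- q / \<kappa> * (1 - exp (- \<kappa> * t))\<close>.\<close>
  also have "\<dots> = q * t + q / (2 * \<kappa>) + q / (2 * \<kappa>) + 2 * 0 -
      2 * (q / \<kappa> * (1 - exp (- \<kappa> * t))) - 2 * (q / (2 * \<kappa>) * exp (- \<kappa> * t))"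
    by (simp only: I_second_moment[OF t] I_Y_covariance[OF t] YY0 IY0 Y_variance[OF t] Y_variance[OF order_refl])
  also have "\<dots> = q * t - q / \<kappa> * (1 - exp (- \<kappa> * t))"
    using pos by (simp add: field_simps)
  finally show ?thesis using pos by (simp add: field_simps)
qed

lemma intensity_integral_eq: "AE \<omega> in M. \<forall>t\<ge>0. (LBINT r:{0..t}. X r \<omega>) = l * t + Z t \<omega>"
  using Y_integrable
proof eventually_elim
  case (elim \<omega>)
  show ?case
  proof (intro allI impI)
    fix t :: real assume t: "0 \<le> t"
    have cst: "set_integrable lborel {0..t} (\<lambda>r. l)" "(LBINT r:{0..t}. l) = l * t"
      using t by (auto simp: set_integrable_def set_lebesgue_integral_def)
    have "(LBINT r:{0..t}. X r \<omega>) = (LBINT r:{0..t}. l + Y r \<omega>)"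
      by (simp add: Y_def)
    then show "(LBINT r:{0..t}. X r \<omega>) = l * t + Z t \<omega>"
      using set_integral_add(2)[OF cst(1)] elim t cst(2) by (simp add: Z_def)
  qed
qed

end

section \<open>Moments of the counting process\<close>

theorem theorem1:
  fixes M :: "'a measure" and F :: "real \<Rightarrow> 'a measure"
    and B X :: "real \<Rightarrow> 'a \<Rightarrow> real" and A :: "real \<Rightarrow> 'a \<Rightarrow> nat"
    and l \<kappa> \<sigma> \<alpha> t :: real
  assumes "filtered_prob_space M F"
    and "l > 0" and "\<kappa> > 0" and "\<sigma> > 0" and "\<alpha> \<ge> 0"
    and "2 * \<kappa> * l powr (1 - \<alpha>) \<ge> \<sigma>\<^sup>2"
    and "brownian_motion M F B"
    and "cir_process M F B l \<kappa> \<sigma> \<alpha> X"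
    and "doubly_stochastic_poisson M F X A"
    and "distr M borel (X 0) = cir_stationary l \<kappa> \<sigma> \<alpha>"
    and "t > 0"
  shows "prob_space.expectation M (\<lambda>\<omega>. real (A t \<omega>)) = l * t \<and>
    prob_space.variance M (\<lambda>\<omega>. real (A t \<omega>)) =
      l * t + \<sigma>\<^sup>2 * l powr (\<alpha> + 1) * t / \<kappa>\<^sup>2 * (1 - (1 - exp (- \<kappa> * t)) / (\<kappa> * t)) \<and>
    coefficient_of_dispersion M (\<lambda>\<omega>. real (A t \<omega>)) =
      1 + \<sigma>\<^sup>2 * l powr \<alpha> / \<kappa>\<^sup>2 * (1 - (1 - exp (- \<kappa> * t)) / (\<kappa> * t))"
proof -
  interpret filtered_prob_space M F by fact
  interpret brownian M F B by unfold_locales fact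
  obtain I where ito: "is_ito_integral M F B (\<lambda>r \<omega>. \<sigma> * sqrt (l powr \<alpha> * X r \<omega>)) I"
    and sde: "AE \<omega> in M. \<forall>t\<ge>0. X t \<omega> = X 0 \<omega> + (LBINT r:{0..t}. \<kappa> * (l - X r \<omega>)) + I t \<omega>"
    using assms(8) by (auto simp: cir_process_def sde_solution_def)
  have adapted_X: "adapted F X" and nonneg: "AE \<omega> in M. \<forall>t\<ge>0. X t \<omega> \<ge> 0"
    and drift: "AE \<omega> in M. \<forall>t\<ge>0. set_integrable lborel {0..t} (\<lambda>r. \<kappa> * (l - X r \<omega>))"
    using assms(8) by (simp_all add: cir_process_def sde_solution_def)
  have X_meas: "X r \<in> borel_measurable M" if "0 \<le> r" for r
    using adapted_X that measurable_F_M[of "X r" r borel] by (simp add: adapted_def)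
  define a where "a = 2 * \<kappa> / (\<sigma>\<^sup>2 * l powr (\<alpha> - 1))"
  define b where "b = 2 * \<kappa> / (\<sigma>\<^sup>2 * l powr \<alpha>)"
  \<comment> \<open>The gamma law has mean \<open>a / b = l\<close> and variance
    \<open>a / b\<^sup>2 = l / b\<close>; the last equation gives this variance the form required by
    the locale \<open>cir\<close>.\<close>
  have ab: "a > 0" "b > 0" "a = l * b" "l / b = \<sigma>\<^sup>2 * l powr (\<alpha> + 1) / (2 * \<kappa>)"
    using assms(2-4) by (auto simp: a_def b_def powr_diff powr_add)
  have "distr M borel (X 0) = density lborel (\<lambda>x. ennreal (gamma_density a b x))"
    using assms(10) by (simp add: cir_stationary_def a_def b_def)
  note gamma = gamma_distributed_moments[OF X_meas[OF order_refl] this ab(1,2)]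
  have "a * (a + 1) / b\<^sup>2 = l\<^sup>2 + l / b"
    unfolding ab(3) using ab(2) by (simp add: power2_eq_square field_simps)
  then interpret cir M F B l \<kappa> \<sigma> \<alpha> X I
    using gamma(2-4) ab assms(2-4) nonneg adapted_X drift ito sde by unfold_locales simp_all
  have t: "0 \<le> t" using assms(11) by simp
  \<comment> \<open>The integrated intensity is expressed through \<open>Z\<close>, whose
    measurability and square integrability are established; it agrees with the integral of
    \<open>X\<close> almost surely.\<close>
  define L where "L \<omega> = l * t + Z t \<omega>" for \<omega>
  have L_sq: "square_integrable L"
    unfolding L_def[abs_def]
    by (intro square_integrable_add square_integrable_const X_Z_square_integrable t)
  have L_meas[measurable]: "L \<in> borel_measurable M" using L_sq by (simp add: square_integrable_def)
  have L_nonneg: "AE \<omega> in M. L \<omega> \<ge> 0"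
    using Z_bound t by (auto elim!: eventually_mono simp: L_def add.commute)
  have adapted_A: "adapted F (\<lambda>t \<omega>. real (A t \<omega>))" and counting: "AE \<omega> in M. counting_path (\<lambda>t. A t \<omega>)"
    and poisson: "AE \<omega> in M. real_cond_exp M (join_path_sigma M (F 0) X)
          (indicator {\<omega> \<in> space M. A t \<omega> = A 0 \<omega> + k}) \<omega> =
        (LBINT r:{0..t}. X r \<omega>) ^ k / fact k * exp (- (LBINT r:{0..t}. X r \<omega>))" for k
    using assms(9,11) by (simp_all add: doubly_stochastic_poisson_def)
  have real_A_meas: "(\<lambda>\<omega>. real (A r \<omega>)) \<in> borel_measurable M" if "0 \<le> r" for r
    using adapted_A that measurable_F_M[of "\<lambda>\<omega>. real (A r \<omega>)" r borel] by (simp add: adapted_def)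
  have A_meas: "A t \<in> measurable M (count_space UNIV)"
  proof -
    note [measurable] = real_A_meas[OF t]
    \<comment> \<open>Adaptedness concerns the real-valued process, so the count is recovered from
      its real embedding.\<close>
    have "(\<lambda>\<omega>. nat \<lfloor>real (A t \<omega>)\<rfloor>) \<in> measurable M (count_space UNIV)"
      by measurable
    then show ?thesis by simp
  qed
  have "subalgebra M (join_path_sigma M (F 0) X)"
  proof -
    let ?S = "sets (F 0) \<union> {X r -` S \<inter> space M |r S. 0 \<le> r \<and> S \<in> sets borel}"
    have sub: "?S \<subseteq> sets M"
      using subalg[of 0] measurable_sets[OF X_meas] by (auto simp: subalgebra_def)
    have pow: "?S \<subseteq> Pow (space M)"
      by (rule order_trans[OF sub sets.space_closed])
    show ?thesis
      unfolding subalgebra_def join_path_sigma_def sets_measure_of[OF pow] space_measure_of[OF pow]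
      using sets.sigma_sets_subset[OF sub] by simp
  qed
  then interpret G: sigma_finite_subalgebra M "join_path_sigma M (F 0) X"
    by (intro finite_measure_subalgebra_is_sigma_finite)
       (auto simp: finite_measure_subalgebra_def finite_measure_subalgebra_axioms_def finite_measure_axioms)
  have A_distr: "prob {\<omega> \<in> space M. A t \<omega> = k} = expectation (\<lambda>\<omega>. L \<omega> ^ k / fact k * exp (- L \<omega>))" for k
  proof -
    let ?E = "{\<omega> \<in> space M. A t \<omega> = A 0 \<omega> + k}"
    have "{\<omega> \<in> space M. real (A t \<omega>) = real (A 0 \<omega>) + real k} \<in> sets M"
      by (intro borel_measurable_eq borel_measurable_add real_A_meas t) auto
    then have E[measurable]: "?E \<in> sets M" by (simp flip: of_nat_add)
    \<comment> \<open>\<open>A 0 = 0\<close> holds only almost surely, through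
      \<open>counting_path\<close>, so the two events agree up to a null set.\<close>
    have "prob {\<omega> \<in> space M. A t \<omega> = k} = prob ?E"
      using counting E measurable_sets[OF A_meas, of "{k}"]
      by (intro measure_eq_AE) (auto elim!: eventually_mono simp: counting_path_def vimage_def Int_def conj_commute)
    also have "\<dots> = expectation (indicator ?E)" by simp
    \<comment> \<open>Integrating the conditional law removes the conditioning: from here on only
      the mixed Poisson law of \<open>A t\<close> is used.\<close>
    also have "\<dots> = expectation (real_cond_exp M (join_path_sigma M (F 0) X) (indicator ?E))"
      by (rule G.real_cond_exp_int(2)[symmetric]) (rule integrable_const_bound[where B = 1], use E in auto)
    also have "\<dots> = expectation (\<lambda>\<omega>. L \<omega> ^ k / fact k * exp (- L \<omega>))"
    proof (rule integral_cong_AE)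
      show "AE \<omega> in M. real_cond_exp M (join_path_sigma M (F 0) X) (indicator ?E) \<omega> =
          L \<omega> ^ k / fact k * exp (- L \<omega>)"
        using poisson[of k] intensity_integral_eq
      proof eventually_elim
        case (elim \<omega>)
        have "(LBINT r:{0..t}. X r \<omega>) = L \<omega>" using elim(2) t by (simp add: L_def)
        then show ?case using elim(1) by simp
      qed
    qed measurable
    finally show ?thesis .
  qed
  have L_int: "integrable M L" "integrable M (\<lambda>\<omega>. (L \<omega>)\<^sup>2)"
    using square_integrable_integrable[OF L_sq] L_sq by (auto simp: square_integrable_def)
  note A_moments = mixed_poisson_moments[OF A_meas L_meas L_nonneg A_distr L_int]
  have Z_int: "integrable M (Z t)" "integrable M (\<lambda>\<omega>. (Z t \<omega>)\<^sup>2)"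
    using X_Z_square_integrable(2)[OF t] square_integrable_integrable[OF X_Z_square_integrable(2)[OF t]]
    by (auto simp: square_integrable_def)
  have EL: "expectation L = l * t"
    using Z_int by (simp add: L_def[abs_def] prob_space Z_mean[OF t])
  have EL2: "expectation (\<lambda>\<omega>. (L \<omega>)\<^sup>2) = (l * t)\<^sup>2 + expectation (\<lambda>\<omega>. (Z t \<omega>)\<^sup>2)"
    using Z_int by (simp add: L_def power2_sum prob_space Z_mean[OF t])
  have mean: "expectation (\<lambda>\<omega>. real (A t \<omega>)) = l * t"
    by (simp add: A_moments(3) EL)
  have "variance (\<lambda>\<omega>. real (A t \<omega>)) =
      expectation (\<lambda>\<omega>. (real (A t \<omega>))\<^sup>2) - (expectation (\<lambda>\<omega>. real (A t \<omega>)))\<^sup>2"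
    by (rule variance_eq[OF A_moments(1,2)])
  also have "\<dots> = l * t + expectation (\<lambda>\<omega>. (Z t \<omega>)\<^sup>2)"
    unfolding A_moments(3,4) EL EL2 by simp
  also have "expectation (\<lambda>\<omega>. (Z t \<omega>)\<^sup>2) =
      \<sigma>\<^sup>2 * l powr (\<alpha> + 1) * t / \<kappa>\<^sup>2 * (1 - (1 - exp (- \<kappa> * t)) / (\<kappa> * t))"
    using assms(3,11) by (simp add: Z_second_moment[OF t] q_def field_simps)
  finally have var: "variance (\<lambda>\<omega>. real (A t \<omega>)) =
      l * t + \<sigma>\<^sup>2 * l powr (\<alpha> + 1) * t / \<kappa>\<^sup>2 * (1 - (1 - exp (- \<kappa> * t)) / (\<kappa> * t))" .
  have "(l * t + \<sigma>\<^sup>2 * l powr (\<alpha> + 1) * t / \<kappa>\<^sup>2 * d) / (l * t) = 1 + \<sigma>\<^sup>2 * l powr \<alpha> / \<kappa>\<^sup>2 * d" for d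
    using assms(2,11) by (simp add: add_divide_distrib powr_add)
  then show ?thesis
    using mean var by (simp add: coefficient_of_dispersion_def)
qed

end
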